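(* Let $\mathcal{G}$ be a hereditary class of graphs for which there is a polynomial $p$ such that for every positive integer $s$, every bipartite graph in $\mathcal{G}$ that does not contain $K_{s,s}$ as a subgraph has average degree at most $p(s)$. Then there is a polynomial $p'$ such that for every positive integer $s$, every graph in $\mathcal{G}$ that does not contain $K_{s,s}$ as a subgraph has average degree at most $p'(s)$.
   Context: A class of graphs is hereditary if it is closed under taking induced subgraphs (and isomorphism). "Subgraph" means not necessarily induced subgraph. *)

theory Defs
  imports
    Complex_Main
    "HOL-Computational_Algebra.Polynomial"
    "Graph_Theory.Kuratowski"
    "Graph_Theory.Digraph_Isomorphism"
begin

text \<open>
  Following Graph_Theory, a finite simple graph is a finite, loopfree, symmetric digraph without
  parallel arcs (locale \<open>pair_graph\<close>), so each undirected edge is a pair of opposite arcs.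
\<close>

definition bipartite :: "('a, 'b) pre_digraph \<Rightarrow> bool" where
  "bipartite G \<longleftrightarrow>
     (\<exists>U V. verts G = U \<union> V \<and> U \<inter> V = {} \<and> arcs_ends G \<subseteq> U \<times> V \<union> V \<times> U)"

definition contains_biclique :: "('a, 'b) pre_digraph \<Rightarrow> nat \<Rightarrow> bool" where
  "contains_biclique G s \<longleftrightarrow> (\<exists>H. subgraph H G \<and> K\<^bsub>s,s\<^esub> H)"

text \<open>
  In a symmetric digraph without loops and parallel arcs, the out-degree of a vertex is its degree
  in the undirected graph. The null graph gets average degree 0 from division by zero.
\<close>

definition average_degree :: "('a, 'b) pre_digraph \<Rightarrow> real" where
  "average_degree G = (\<Sum>v\<in>verts G. real (out_degree G v)) / real (card (verts G))"

text \<open>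
  A class of graphs is represented by its members with vertices in \<open>'a\<close>; for infinite \<open>'a\<close>, every
  finite graph has an isomorphic copy there.
\<close>

definition hereditary :: "'a pair_pre_digraph set \<Rightarrow> bool" where
  "hereditary \<G> \<longleftrightarrow>
     (\<forall>G\<in>\<G>. \<forall>H. induced_subgraph (with_proj H) (with_proj G) \<longrightarrow> H \<in> \<G>) \<and>
     (\<forall>G\<in>\<G>. \<forall>H. digraph_iso (with_proj G) (with_proj H) \<longrightarrow> H \<in> \<G>)"

end

(*
  Fix k > p(2) and m > p(s). A K_{s,s}-free graph G in the class has no induced bipartite subgraph
  (S, T) with |S| <= |T| in which every vertex of T has at least k neighbours in S and there is no C4,
  and none in which every vertex of T has at least m neighbours in S. Such a pair is found in every
  K_{s,s}-free graph whose average degree is a large enough power of s + m.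

  Dense spots. If two vertex sets of size at most N span at least delta N^2 edges and N is a large power
  of s / delta, then the point-line incidence graph of an affine plane embeds as an induced subgraph:
  many independent tuples have a large common neighbourhood, and nonadjacency is cheap since fewer than
  s vertices can be adjacent to almost all of a large set. So G is locally sparse.

  Pass to a subgraph of maximum average degree D = L^M, which is then degenerate, and split the vertices
  into the degree scales D L^i. By pigeonhole, many vertices b of degree at most D L have at least D / L
  neighbours on one scale A, or in the top part A of vertices of degree more than D L^R.

  Regular case. A random subset of A of density slightly below 1 / D is nearly independent, and T consists
  of the b with k neighbours in it. By local sparsity two adjacent b rarely have many common neighbours,
  so the events b in T are almost independent along edges, and T is sparse enough to contain a large
  subset without edges and without C4. The density is lowered by a power of L below 1 / D so that the
  resulting independent subset of T outweighs S.

  Unbalanced case. Here A is so small that even probability D^(-m), at which a random independent set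
  contains a given independent m-set of neighbours of b, leaves enough vertices.
*)

theory Submission
  imports Defs "HOL-Computational_Algebra.Primes"
begin


section \<open>Random subsets\<close>

text \<open>The final bound has to be polynomial in \<open>s\<close> although \<open>m\<close> grows
  with \<open>s\<close>, so no exponent in it may depend on \<open>m\<close>. Hence the two
  obstructions: \<open>k\<close> comes from p(2) and is constant, at the price of avoiding C4 in the
  pair, and the exponents \<open>A\<close>, \<open>g\<close>, \<open>M\<close> are functions of
  \<open>k\<close>. The loss of order D^m in the unbalanced case enters only through the number
  \<open>R\<close> of degree scales. This number is linear in \<open>m\<close> and is paid for by
  \<open>L\<close>, through the pigeonhole step, and not by the exponent in
  \<open>D = L ^ M\<close>.

  In the regular case the difficulty is to make T larger than S. At density
  \<open>\<theta> / (D * L)\<close>, a vertex lies in T with probability about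
  \<open>\<theta> ^ k\<close>, up to powers of \<open>L\<close>, while the conflicts are governed by
  \<open>\<theta> ^ (2 * k)\<close>. After optimal thinning the yield is the square of the first
  quantity over the second, so that \<open>\<theta>\<close> cancels, whereas S is proportional to
  \<open>\<theta>\<close>. A small \<open>\<theta>\<close>, a fixed power of \<open>1 / L\<close>,
  therefore wins, provided that \<open>D\<close> is so large that the optimal thinning rate is at
  most 1. This is one origin of \<open>g\<close>, for which
  \<open>\<theta> ^ k = 1 / L ^ g\<close>.\<close>

definition subset_mean :: "real \<Rightarrow> 'a set \<Rightarrow> ('a set \<Rightarrow> real) \<Rightarrow> real" where
  "subset_mean q A f = (\<Sum>S\<in>Pow A. q ^ card S * (1 - q) ^ card (A - S) * f S)"

lemma subset_mean_add:
  "subset_mean q A (\<lambda>S. f S + g S) = subset_mean q A f + subset_mean q A g"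
  by (simp add: subset_mean_def distrib_left sum.distrib)

lemma subset_mean_diff:
  "subset_mean q A (\<lambda>S. f S - g S) = subset_mean q A f - subset_mean q A g"
  by (simp add: subset_mean_def right_diff_distrib sum_subtractf)

lemma subset_mean_cmult: "subset_mean q A (\<lambda>S. c * f S) = c * subset_mean q A f"
  by (simp add: subset_mean_def sum_distrib_left mult_ac)

lemma subset_mean_sum:
  "subset_mean q A (\<lambda>S. \<Sum>i\<in>I. f i S) = (\<Sum>i\<in>I. subset_mean q A (f i))"
  unfolding subset_mean_def by (simp add: sum_distrib_left sum.swap[of _ I])

lemma subset_mean_mono:
  assumes "0 \<le> q" "q \<le> 1" "\<And>S. S \<subseteq> A \<Longrightarrow> f S \<le> g S"
  shows "subset_mean q A f \<le> subset_mean q A g"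
  unfolding subset_mean_def using assms by (intro sum_mono mult_left_mono) auto

text \<open>The product of \<open>?f i + ?g i\<close> over \<open>A\<close> expands into one term
  per subset \<open>S\<close>. An inclusion weight 0 on \<open>F\<close> and an exclusion weight 0
  on \<open>M\<close> kill every unwanted \<open>S\<close>, and elements outside
  \<open>M \<union> F\<close> contribute \<open>q + (1 - q) = 1\<close>. This is the independence on
  which the later probability estimates rest.\<close>

lemma subset_mean_indicator:
  assumes "finite A" "M \<subseteq> A" "F \<subseteq> A" "M \<inter> F = {}"
  shows "subset_mean q A (\<lambda>S. of_bool (M \<subseteq> S \<and> S \<inter> F = {})) = q ^ card M * (1 - q) ^ card F"
proof -
  let ?f = "\<lambda>i. if i \<in> F then 0 else q" and ?g = "\<lambda>i. if i \<in> M then 0 else 1 - q"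
  have fin: "finite M" "finite F" using assms(1-3) by (auto intro: finite_subset)
  have "(\<Prod>i\<in>A. ?f i + ?g i) = (\<Sum>S\<in>Pow A. (\<Prod>i\<in>S. ?f i) * (\<Prod>i\<in>A-S. ?g i))"
    by (rule prod_add[OF assms(1)])
  also have "\<dots> = subset_mean q A (\<lambda>S. of_bool (M \<subseteq> S \<and> S \<inter> F = {}))"
    unfolding subset_mean_def
  proof (intro sum.cong refl)
    fix S assume S: "S \<in> Pow A"
    then have fS: "finite S" "finite (A - S)" using assms(1) finite_subset by auto
    show "(\<Prod>i\<in>S. ?f i) * (\<Prod>i\<in>A-S. ?g i)
      = q ^ card S * (1 - q) ^ card (A - S) * of_bool (M \<subseteq> S \<and> S \<inter> F = {})"
    proof (cases "M \<subseteq> S \<and> S \<inter> F = {}")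
      case True
      then have "(\<Prod>i\<in>S. ?f i) = (\<Prod>i\<in>S. q)" "(\<Prod>i\<in>A-S. ?g i) = (\<Prod>i\<in>A-S. 1 - q)"
        by (intro prod.cong refl; auto)+
      with True show ?thesis by simp
    next
      case False
      then consider x where "x \<in> M" "x \<notin> S" | x where "x \<in> S" "x \<in> F" by auto
      then have "(\<Prod>i\<in>S. ?f i) = 0 \<or> (\<Prod>i\<in>A-S. ?g i) = 0"
      proof cases
        case 1
        then have "x \<in> A - S" using assms by auto
        then show ?thesis using 1 fS by (intro disjI2 prod_zero) auto
      next
        case 2
        then show ?thesis using fS by (intro disjI1 prod_zero) auto
      qed
      with False show ?thesis by auto
    qed
  qed
  also have "(\<Prod>i\<in>A. ?f i + ?g i) = (\<Prod>i\<in>A. (if i \<in> M then q else 1) * (if i \<in> F then 1 - q else 1))"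
    using assms(4) by (intro prod.cong) auto
  also have "\<dots> = q ^ card M * (1 - q) ^ card F"
    using assms(1-3) by (simp add: prod.distrib prod.If_cases Int_absorb1 Int_absorb2)
  finally show ?thesis by simp
qed

lemma subset_mean_superset:
  assumes "finite A" "M \<subseteq> A"
  shows "subset_mean q A (\<lambda>S. of_bool (M \<subseteq> S)) = q ^ card M"
  using subset_mean_indicator[OF assms, of "{}"] by simp

lemma subset_mean_const: "finite A \<Longrightarrow> subset_mean q A (\<lambda>_. c) = c"
  using subset_mean_superset[of A "{}" q] subset_mean_cmult[of q A c "\<lambda>_. 1"] by simp

lemma subset_mean_obtain:
  assumes "finite A" "0 \<le> q" "q \<le> 1"
  obtains S where "S \<subseteq> A" "subset_mean q A f \<le> f S"
proof -
  have "Max (f ` Pow A) \<in> f ` Pow A" using assms(1) by (intro Max_in) auto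
  then obtain S where S: "S \<in> Pow A" "Max (f ` Pow A) = f S" by blast
  have "f X \<le> f S" if "X \<subseteq> A" for X
    unfolding S(2)[symmetric] using that assms(1) by (intro Max_ge) auto
  have "subset_mean q A f \<le> subset_mean q A (\<lambda>_. f S)"
    using assms \<open>\<And>X. X \<subseteq> A \<Longrightarrow> f X \<le> f S\<close> by (intro subset_mean_mono) auto
  also have "\<dots> = f S" using assms(1) by (rule subset_mean_const)
  finally show thesis using S that by auto
qed

lemma subset_mean_card:
  assumes "finite A"
  shows "subset_mean q A (\<lambda>S. real (card S)) = q * card A"
proof -
  have "subset_mean q A (\<lambda>S. real (card S)) = subset_mean q A (\<lambda>S. \<Sum>x\<in>A. of_bool ({x} \<subseteq> S))"
    unfolding subset_mean_def
  proof (intro sum.cong refl)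
    fix S assume "S \<in> Pow A"
    then have "A \<inter> {x. {x} \<subseteq> S} = S" by auto
    with assms have "(\<Sum>x\<in>A. of_bool ({x} \<subseteq> S)) = real (card S)" by (simp add: Int_absorb1 Collect_conj_eq)
    then show "q ^ card S * (1 - q) ^ card (A - S) * real (card S) =
      q ^ card S * (1 - q) ^ card (A - S) * (\<Sum>x\<in>A. of_bool ({x} \<subseteq> S))" by simp
  qed
  also have "\<dots> = (\<Sum>x\<in>A. q)"
    unfolding subset_mean_sum by (intro sum.cong refl) (simp add: subset_mean_superset[OF assms, of "{_}", simplified])
  finally show ?thesis by simp
qed

text \<open>Union bound over the ways to complete \<open>F\<close> to a \<open>k\<close>-subset of
  \<open>N \<inter> S\<close>: there are at most \<open>card N ^ (k - card F)\<close> of them, each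
  present with probability \<open>q ^ k\<close>. The set \<open>F\<close> will consist of at most
  two common neighbours of a pair of vertices.\<close>

lemma subset_mean_many_le:
  fixes q :: real
  assumes "finite A" "F \<subseteq> N" "N \<subseteq> A" "card F \<le> k" "0 \<le> q" "q \<le> 1"
  shows "subset_mean q A (\<lambda>S. of_bool (F \<subseteq> S \<and> k \<le> card (N \<inter> S)))
    \<le> q ^ card F * (card N * q) ^ (k - card F)"
proof -
  let ?j = "k - card F" and ?\<M> = "{M. M \<subseteq> N - F \<and> card M = k - card F}"
  have fin: "finite N" "finite F" using assms finite_subset by (auto intro: finite_subset)
  have finM: "finite ?\<M>" using fin by simp
  have "subset_mean q A (\<lambda>S. of_bool (F \<subseteq> S \<and> k \<le> card (N \<inter> S)))
    \<le> subset_mean q A (\<lambda>S. \<Sum>M\<in>?\<M>. of_bool (F \<union> M \<subseteq> S))"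
  proof (rule subset_mean_mono[OF assms(5,6)])
    fix S assume "S \<subseteq> A"
    show "of_bool (F \<subseteq> S \<and> k \<le> card (N \<inter> S)) \<le> (\<Sum>M\<in>?\<M>. of_bool (F \<union> M \<subseteq> S) :: real)"
    proof (cases "F \<subseteq> S \<and> k \<le> card (N \<inter> S)")
      case True
      have "F \<subseteq> N \<inter> S" using True assms by auto
      then have "?j \<le> card (N \<inter> S - F)" using True fin by (simp add: card_Diff_subset diff_le_mono)
      then obtain M where M: "M \<subseteq> N \<inter> S - F" "card M = ?j" by (metis obtain_subset_with_card_n)
      have "(1::real) = of_bool (F \<union> M \<subseteq> S)" using True M by auto
      also have "\<dots> \<le> (\<Sum>M\<in>?\<M>. of_bool (F \<union> M \<subseteq> S))"
        using M finM by (intro member_le_sum) auto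
      finally show ?thesis using True by simp
    next
      case False
      then have "(F \<subseteq> S \<and> k \<le> card (N \<inter> S)) = False" by blast
      then show ?thesis by (simp only: of_bool_eq) (auto intro: sum_nonneg)
    qed
  qed
  also have "\<dots> = (\<Sum>M\<in>?\<M>. q ^ k)"
    unfolding subset_mean_sum
  proof (intro sum.cong refl)
    fix M assume M: "M \<in> ?\<M>"
    then have "finite M" using fin finite_subset by auto
    then have "card (F \<union> M) = k" using M fin assms(4) by (subst card_Un_disjoint) auto
    moreover have "F \<union> M \<subseteq> A" using M assms by auto
    ultimately show "subset_mean q A (\<lambda>S. of_bool (F \<union> M \<subseteq> S)) = q ^ k"
      using subset_mean_superset[OF assms(1)] by metis
  qed
  also have "\<dots> = real (card ?\<M>) * q ^ k" by simp
  also have "\<dots> \<le> real (card N ^ ?j) * q ^ k"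
  proof (intro mult_right_mono)
    have "card ?\<M> = card (N - F) choose ?j" using fin by (simp add: n_subsets)
    also have "\<dots> \<le> card (N - F) ^ ?j"
      by (cases "?j \<le> card (N - F)") (auto simp: binomial_le_pow binomial_eq_0)
    also have "\<dots> \<le> card N ^ ?j" using fin by (intro power_mono card_mono) auto
    finally show "real (card ?\<M>) \<le> real (card N ^ ?j)" by linarith
  qed (use assms in simp)
  also have "q ^ k = q ^ card F * q ^ ?j" using assms(4) by (simp flip: power_add)
  finally show ?thesis by (simp add: power_mult_distrib mult_ac)
qed

text \<open>Union bound over pairs of \<open>k\<close>-sets, one on each side. Disjointness gives
  their union \<open>2 * k\<close> elements, hence the product of the two one-sided bounds.\<close>

lemma subset_mean_many_disjoint_le:
  fixes q :: real
  assumes "finite A" "N1 \<subseteq> A" "N2 \<subseteq> A" "N1 \<inter> N2 = {}" "0 \<le> q" "q \<le> 1"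
  shows "subset_mean q A (\<lambda>S. of_bool (k \<le> card (N1 \<inter> S) \<and> k \<le> card (N2 \<inter> S)))
    \<le> (card N1 * q) ^ k * (card N2 * q) ^ k"
proof -
  let ?\<M> = "\<lambda>N. {M. M \<subseteq> N \<and> card M = k}"
  have fin: "finite N1" "finite N2" using assms(1-3) by (auto intro: finite_subset)
  then have finM: "finite (?\<M> N1)" "finite (?\<M> N2)" by auto
  have "subset_mean q A (\<lambda>S. of_bool (k \<le> card (N1 \<inter> S) \<and> k \<le> card (N2 \<inter> S)))
    \<le> subset_mean q A (\<lambda>S. \<Sum>P\<in>?\<M> N1 \<times> ?\<M> N2. of_bool (fst P \<union> snd P \<subseteq> S))"
  proof (rule subset_mean_mono[OF assms(5,6)])
    fix S assume "S \<subseteq> A"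
    show "of_bool (k \<le> card (N1 \<inter> S) \<and> k \<le> card (N2 \<inter> S))
      \<le> (\<Sum>P\<in>?\<M> N1 \<times> ?\<M> N2. of_bool (fst P \<union> snd P \<subseteq> S) :: real)"
    proof (cases "k \<le> card (N1 \<inter> S) \<and> k \<le> card (N2 \<inter> S)")
      case True
      then obtain M1 M2 where M: "M1 \<subseteq> N1 \<inter> S" "card M1 = k" "M2 \<subseteq> N2 \<inter> S" "card M2 = k"
        by (metis obtain_subset_with_card_n)
      have "(1::real) = of_bool (fst (M1, M2) \<union> snd (M1, M2) \<subseteq> S)" using M by auto
      also have "\<dots> \<le> (\<Sum>P\<in>?\<M> N1 \<times> ?\<M> N2. of_bool (fst P \<union> snd P \<subseteq> S))"
        using M finM by (intro member_le_sum) auto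
      finally show ?thesis using True by simp
    next
      case False
      then have "(k \<le> card (N1 \<inter> S) \<and> k \<le> card (N2 \<inter> S)) = False" by blast
      then show ?thesis by (simp only: of_bool_eq) (auto intro: sum_nonneg)
    qed
  qed
  also have "\<dots> = (\<Sum>P\<in>?\<M> N1 \<times> ?\<M> N2. q ^ k * q ^ k)"
    unfolding subset_mean_sum
  proof (intro sum.cong refl)
    fix P assume P: "P \<in> ?\<M> N1 \<times> ?\<M> N2"
    then have "finite (fst P)" "finite (snd P)" using fin by (auto dest: finite_subset)
    moreover have "fst P \<inter> snd P = {}" using P assms(4) by fastforce
    ultimately have "card (fst P \<union> snd P) = k + k" using P by (subst card_Un_disjoint) auto
    moreover have "fst P \<union> snd P \<subseteq> A" using P assms by auto
    ultimately show "subset_mean q A (\<lambda>S. of_bool (fst P \<union> snd P \<subseteq> S)) = q ^ k * q ^ k"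
      using subset_mean_superset[OF assms(1)] by (metis power_add)
  qed
  also have "\<dots> = (card (?\<M> N1) * q ^ k) * (card (?\<M> N2) * q ^ k)"
    by (simp add: card_cartesian_product)
  also have "\<dots> \<le> (card N1 ^ k * q ^ k) * (card N2 ^ k * q ^ k)"
  proof -
    have "card (?\<M> N) \<le> card N ^ k" if "finite N" for N :: "'a set"
      using that by (cases "k \<le> card N") (auto simp: n_subsets binomial_le_pow binomial_eq_0)
    then show ?thesis using fin assms by (intro mult_mono mult_right_mono) (auto simp flip: of_nat_power)
  qed
  finally show ?thesis by (simp add: power_mult_distrib)
qed


text \<open>Alteration: keep each element with probability \<open>\<sigma>\<close> and delete one end of every surviving conflict.\<close>

lemma conflict_free_subset:
  fixes \<sigma> e :: real
  assumes "finite T" "0 \<le> \<sigma>" "\<sigma> \<le> 1" "\<And>u. \<not> C u u"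
    and e: "real (card {(u, v). u \<in> T \<and> v \<in> T \<and> C u v}) \<le> e"
  obtains T' where "T' \<subseteq> T" "\<forall>u\<in>T'. \<forall>v\<in>T'. \<not> C u v" "\<sigma> * card T - \<sigma>\<^sup>2 * e \<le> card T'"
proof -
  define P where "P = {(u, v). u \<in> T \<and> v \<in> T \<and> C u v}"
  have "P \<subseteq> T \<times> T" by (auto simp: P_def)
  then have finP: "finite P" using assms(1) by (meson finite_SigmaI finite_subset)
  let ?f = "\<lambda>S. real (card S) - (\<Sum>p\<in>P. of_bool ({fst p, snd p} \<subseteq> S))"
  have "subset_mean \<sigma> T ?f = \<sigma> * card T - (\<Sum>p\<in>P. \<sigma>\<^sup>2)"
    unfolding subset_mean_diff subset_mean_sum subset_mean_card[OF assms(1)]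
  proof (intro arg_cong2[where f = "(-)"] sum.cong refl)
    fix p assume "p \<in> P"
    then have "{fst p, snd p} \<subseteq> T" "card {fst p, snd p} = 2"
      using assms(4) by (auto simp: P_def card_insert_if)
    then show "subset_mean \<sigma> T (\<lambda>S. of_bool ({fst p, snd p} \<subseteq> S)) = \<sigma>\<^sup>2"
      using subset_mean_superset[OF assms(1)] by metis
  qed
  also have "\<dots> \<ge> \<sigma> * card T - \<sigma>\<^sup>2 * e"
    using mult_left_mono[OF e, of "\<sigma>\<^sup>2"] by (simp add: P_def mult.commute)
  finally have mean: "\<sigma> * card T - \<sigma>\<^sup>2 * e \<le> subset_mean \<sigma> T ?f" .
  obtain S where S: "S \<subseteq> T" "subset_mean \<sigma> T ?f \<le> ?f S"
    using subset_mean_obtain[OF assms(1-3)] by blast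
  let ?P = "{p\<in>P. {fst p, snd p} \<subseteq> S}"
  have "finite S" using S assms(1) finite_subset by auto
  have "(\<Sum>p\<in>P. of_bool ({fst p, snd p} \<subseteq> S)) = real (card ?P)"
    using finP by (simp add: Int_def)
  moreover have "card (fst ` ?P) \<le> card ?P" using finP by (intro card_image_le) auto
  moreover have "card S - card (fst ` ?P) \<le> card (S - fst ` ?P)"
    using finP by (intro diff_card_le_card_Diff) auto
  ultimately have "?f S \<le> card (S - fst ` ?P)" by linarith
  then have "\<sigma> * card T - \<sigma>\<^sup>2 * e \<le> card (S - fst ` ?P)" using mean S by linarith
  moreover have "\<forall>u\<in>S - fst ` ?P. \<forall>v\<in>S - fst ` ?P. \<not> C u v"
  proof (intro ballI notI)
    fix u v assume "u \<in> S - fst ` ?P" "v \<in> S - fst ` ?P" "C u v"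
    then have "(u, v) \<in> ?P" using S by (auto simp: P_def)
    then have "fst (u, v) \<in> fst ` ?P" by (rule imageI)
    then show False using \<open>u \<in> S - fst ` ?P\<close> by simp
  qed
  ultimately show thesis using that[of "S - fst ` ?P"] S by blast
qed

section \<open>Graphs and degeneracy\<close>

locale ugraph =
  fixes V :: "'a set" and E :: "'a \<Rightarrow> 'a \<Rightarrow> bool"
  assumes finV: "finite V"
    and E_sym: "E u v \<Longrightarrow> E v u"
    and E_irrefl: "\<not> E v v"
    and E_V: "E u v \<Longrightarrow> u \<in> V"
begin

definition nbr :: "'a \<Rightarrow> 'a set" where "nbr v = {u. E v u}"

definition indep :: "'a set \<Rightarrow> bool" where "indep S \<longleftrightarrow> (\<forall>u\<in>S. \<forall>v\<in>S. \<not> E u v)"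

text \<open>For \<open>1 \<le> s\<close>, complete adjacency between \<open>P\<close> and
  \<open>Q\<close> already puts both into \<open>V\<close> and, by irreflexivity, makes them
  disjoint; a violating pair is thus a genuine biclique.\<close>

definition biclique_free :: "nat \<Rightarrow> bool" where
  "biclique_free s \<longleftrightarrow> (\<forall>P Q. card P = s \<and> card Q = s \<longrightarrow> (\<exists>x\<in>P. \<exists>y\<in>Q. \<not> E x y))"

text \<open>
  Since \<open>card S \<le> card T\<close>, a rich pair induces a bipartite graph of average degree at least \<open>k\<close>; a linear
  pair has no 4-cycle, that is, no \<open>K\<^bsub>2,2\<^esub>\<close>.
\<close>

definition rich_pair :: "nat \<Rightarrow> 'a set \<Rightarrow> 'a set \<Rightarrow> bool" where
  "rich_pair k S T \<longleftrightarrow> S \<subseteq> V \<and> T \<subseteq> V \<and> S \<inter> T = {} \<and> indep S \<and> indep T \<and> T \<noteq> {} \<and>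
     card S \<le> card T \<and> (\<forall>v\<in>T. k \<le> card (nbr v \<inter> S))"

definition linear_pair :: "'a set \<Rightarrow> 'a set \<Rightarrow> bool" where
  "linear_pair S T \<longleftrightarrow> (\<forall>u\<in>T. \<forall>v\<in>T. u \<noteq> v \<longrightarrow> card (nbr u \<inter> nbr v \<inter> S) \<le> 1)"

lemma nbr_V: "nbr v \<subseteq> V" using E_V E_sym by (auto simp: nbr_def)

lemma fin_nbr [simp]: "finite (nbr v)" using nbr_V finV finite_subset by blast

lemma nbr_sym: "u \<in> nbr v \<longleftrightarrow> v \<in> nbr u" using E_sym by (auto simp: nbr_def)

lemma nbr_irrefl [simp]: "v \<notin> nbr v" using E_irrefl by (auto simp: nbr_def)

lemma card_ordered_edges:
  assumes "finite P" "finite Q"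
  shows "card {(u, v). u \<in> P \<and> v \<in> Q \<and> E u v} = (\<Sum>v\<in>P. card (nbr v \<inter> Q))"
proof -
  have "{(u, v). u \<in> P \<and> v \<in> Q \<and> E u v} = (SIGMA u:P. nbr u \<inter> Q)" by (auto simp: nbr_def)
  then show ?thesis using assms by (simp add: card_SigmaI)
qed

lemma sum_card_nbr_swap:
  assumes "finite P" "finite Q"
  shows "(\<Sum>v\<in>P. card (nbr v \<inter> Q)) = (\<Sum>v\<in>Q. card (nbr v \<inter> P))"
proof -
  have "card {(u, v). u \<in> P \<and> v \<in> Q \<and> E u v} = card {(u, v). u \<in> Q \<and> v \<in> P \<and> E u v}"
    using E_sym by (intro bij_betw_same_card[of prod.swap] bij_betw_byWitness[where f' = prod.swap]) auto
  then show ?thesis using assms by (simp add: card_ordered_edges)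
qed

text \<open>Degeneracy: every induced subgraph has average degree at most \<open>D\<close>, hence a
  vertex of degree at most \<open>D\<close>. Its edges are directed away from it, it is removed, and
  the rest is treated in the same way; each edge is recorded at the end that is removed
  earlier.\<close>

lemma orientation:
  fixes D :: real
  assumes dens: "\<And>W. W \<subseteq> V \<Longrightarrow> real (\<Sum>v\<in>W. card (nbr v \<inter> W)) \<le> D * card W"
  obtains low where "\<And>v. low v \<subseteq> nbr v" "\<And>v. v \<in> V \<Longrightarrow> card (low v) \<le> D"
    "\<And>u v. E u v \<Longrightarrow> u \<in> low v \<or> v \<in> low u"
proof -
  have "\<exists>low. (\<forall>v. low v \<subseteq> nbr v) \<and> (\<forall>v\<in>W. card (low v) \<le> D) \<and>
     (\<forall>u\<in>W. \<forall>v\<in>W. E u v \<longrightarrow> u \<in> low v \<or> v \<in> low u)" if "finite W" "W \<subseteq> V" for W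
    using that
  proof (induction "card W" arbitrary: W)
    case 0
    then show ?case by (intro exI[of _ "\<lambda>_. {}"]) auto
  next
    case (Suc n)
    have "\<exists>w\<in>W. card (nbr w \<inter> W) \<le> D"
    proof (rule ccontr)
      assume "\<not> ?thesis"
      then have "\<And>w. w \<in> W \<Longrightarrow> D < card (nbr w \<inter> W)" by auto
      moreover have "W \<noteq> {}" using Suc by auto
      ultimately have "(\<Sum>w\<in>W. D) < (\<Sum>w\<in>W. real (card (nbr w \<inter> W)))"
        using Suc by (intro sum_strict_mono) auto
      then show False using dens[OF Suc.prems(2)] by (simp add: mult.commute)
    qed
    then obtain w where w: "w \<in> W" "card (nbr w \<inter> W) \<le> D" by blast
    have "n = card (W - {w})" using Suc w by simp
    moreover have "finite (W - {w})" "W - {w} \<subseteq> V" using Suc.prems by auto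
    ultimately obtain low where b: "\<forall>v. low v \<subseteq> nbr v" "\<forall>v\<in>W - {w}. card (low v) \<le> D"
      "\<forall>u\<in>W - {w}. \<forall>v\<in>W - {w}. E u v \<longrightarrow> u \<in> low v \<or> v \<in> low u"
      using Suc.hyps(1)[of "W - {w}"] by blast
    show ?case
      using b w E_irrefl E_sym by (intro exI[of _ "low(w := nbr w \<inter> W)"]) (auto simp: nbr_def)
  qed
  from this[OF finV] show thesis using that E_V E_sym by (metis order_refl)
qed

end


section \<open>Dense pairs contain affine planes\<close>

text \<open>The set \<open>F ys zs\<close> sees only the entries before and after position
  \<open>j\<close>. Splitting a list at \<open>j\<close> therefore injects the bad lists into a
  disjoint union, over the other \<open>a - 1\<close> entries, of sets of size at most
  \<open>s\<close>.\<close>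

lemma card_lists_coordinate_le:
  assumes "finite P" "j < a"
    and F: "\<And>ys zs. length ys = j \<Longrightarrow> length zs = a - Suc j \<Longrightarrow> card (P \<inter> F ys zs) \<le> s"
  shows "card {xs. length xs = a \<and> set xs \<subseteq> P \<and> xs ! j \<in> F (take j xs) (drop (Suc j) xs)}
    \<le> s * card P ^ (a - 1)"
proof -
  let ?L = "\<lambda>n. {xs. set xs \<subseteq> P \<and> length xs = n}"
  let ?X = "{xs. length xs = a \<and> set xs \<subseteq> P \<and> xs ! j \<in> F (take j xs) (drop (Suc j) xs)}"
  let ?S = "SIGMA p:?L j \<times> ?L (a - Suc j). P \<inter> F (fst p) (snd p)"
  let ?g = "\<lambda>xs. ((take j xs, drop (Suc j) xs), xs ! j)"
  have fin: "finite ?S" using assms(1) by (auto intro!: finite_SigmaI finite_lists_length_eq)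
  have inj: "inj_on ?g ?X"
  proof (rule inj_onI)
    fix xs ys assume "xs \<in> ?X" "ys \<in> ?X" "?g xs = ?g ys"
    then show "xs = ys" using assms(2) id_take_nth_drop[of j xs] id_take_nth_drop[of j ys] by auto
  qed
  have "?g ` ?X \<subseteq> ?S"
    using assms(2) by (auto dest: in_set_takeD in_set_dropD)
  then have "card ?X \<le> card ?S" using card_inj_on_le[OF inj _ fin] by blast
  also have "\<dots> = (\<Sum>p\<in>?L j \<times> ?L (a - Suc j). card (P \<inter> F (fst p) (snd p)))"
    using assms(1) by (subst card_SigmaI) (auto intro!: finite_SigmaI finite_lists_length_eq)
  also have "\<dots> \<le> (\<Sum>p\<in>?L j \<times> ?L (a - Suc j). s)"
    using F by (intro sum_mono) auto
  also have "\<dots> = s * (card P ^ j * card P ^ (a - Suc j))"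
    using assms(1) by (simp add: card_cartesian_product card_lists_length_eq)
  also have "card P ^ j * card P ^ (a - Suc j) = card P ^ (a - 1)"
    using assms(2) by (simp flip: power_add)
  finally show ?thesis .
qed

section \<open>Independent tuples and representatives in biclique-free graphs\<close>

context ugraph
begin

text \<open>The closed neighbourhood. Removing it from the candidates also removes \<open>v\<close>
  itself, which is where distinctness of the chosen vertices comes from.\<close>

definition cnbr :: "'a \<Rightarrow> 'a set" where "cnbr v = insert v (nbr v)"

text \<open>
  Outside of \<open>dominators s Q\<close>, passing from \<open>Q\<close> to the non-neighbours of a vertex costs a factor \<open>4 s\<close> only.
\<close>

definition dominators :: "nat \<Rightarrow> 'a set \<Rightarrow> 'a set" where
  "dominators s Q = {v. 4 * s * card (Q - cnbr v) < card Q}"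

definition indep_tuples :: "nat \<Rightarrow> 'a set \<Rightarrow> 'a list set" where
  "indep_tuples a U = {xs. length xs = a \<and> set xs \<subseteq> U \<and> distinct xs \<and> indep (set xs)}"

lemma indep_insert:
  assumes "indep S" "\<And>v. v \<in> S \<Longrightarrow> v \<notin> cnbr y"
  shows "indep (insert y S)"
  unfolding indep_def
proof (intro ballI)
  fix u v assume "u \<in> insert y S" "v \<in> insert y S"
  then show "\<not> E u v"
    using assms E_irrefl[of y] E_sym[of u y] unfolding indep_def cnbr_def nbr_def by blast
qed

text \<open>Each of \<open>s\<close> dominators would miss at most a \<open>1 / (2 * s)\<close> part
  of \<open>Q\<close>, so together they would have at least half of \<open>Q\<close> as common
  neighbours, which contains \<open>s\<close> vertices and gives a biclique. The assumption
  \<open>4 * s \<le> card Q\<close> also pays for the step from closed to open neighbourhoods, which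
  can lose one vertex.\<close>

lemma card_dominators_less:
  assumes "biclique_free s" "1 \<le> s" "finite Q" "4 * s \<le> card Q" "P \<subseteq> dominators s Q"
  shows "card P < s"
proof (rule ccontr)
  assume "\<not> card P < s"
  then obtain X where X: "X \<subseteq> P" "card X = s" "finite X"
    by (meson not_less obtain_subset_with_card_n)
  let ?Y = "Q - (\<Union>v\<in>X. Q - nbr v)"
  have each: "2 * s * card (Q - nbr v) \<le> card Q" if "v \<in> X" for v
  proof -
    have "Q - nbr v \<subseteq> insert v (Q - cnbr v)" by (auto simp: cnbr_def)
    then have "card (Q - nbr v) \<le> card (insert v (Q - cnbr v))" using assms(3) by (intro card_mono) auto
    also have "\<dots> \<le> Suc (card (Q - cnbr v))" using assms(3) by (simp add: card_insert_if)
    finally have "4 * s * card (Q - nbr v) \<le> 4 * s * card (Q - cnbr v) + 4 * s"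
      using mult_le_mono2[of "card (Q - nbr v)" "Suc (card (Q - cnbr v))" "4 * s"] by simp
    moreover have "4 * s * card (Q - cnbr v) < card Q" using that X assms(5) by (auto simp: dominators_def)
    ultimately show ?thesis using assms(4) by linarith
  qed
  have "2 * s * card (\<Union>v\<in>X. Q - nbr v) \<le> 2 * s * (\<Sum>v\<in>X. card (Q - nbr v))"
    using X by (intro mult_le_mono2 card_UN_le) auto
  also have "\<dots> = (\<Sum>v\<in>X. 2 * s * card (Q - nbr v))" by (simp add: sum_distrib_left)
  also have "\<dots> \<le> (\<Sum>v\<in>X. card Q)" using each by (rule sum_mono)
  also have "\<dots> = s * card Q" using X by simp
  finally have "2 * card (\<Union>v\<in>X. Q - nbr v) \<le> card Q" using assms(2) by simp
  moreover have "card Q - card (\<Union>v\<in>X. Q - nbr v) \<le> card ?Y"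
    using X assms(3) by (intro diff_card_le_card_Diff) auto
  ultimately have "s \<le> card ?Y" using assms(4) by linarith
  then obtain Y where Y: "Y \<subseteq> ?Y" "card Y = s" by (meson obtain_subset_with_card_n)
  then have "\<forall>x\<in>X. \<forall>y\<in>Y. E x y" by (fastforce simp: nbr_def)
  then show False using assms(1) X Y unfolding biclique_free_def by blast
qed

text \<open>Greedy count: fewer than \<open>s\<close> first entries dominate \<open>U\<close>, and
  any other one leaves at least \<open>card U / (4 * s)\<close> candidates for the remaining
  entries. The exponent \<open>a + 1\<close> keeps the candidate set above \<open>4 * s\<close> at
  every stage.\<close>

lemma card_indep_tuples_ge:
  assumes "biclique_free s" "1 \<le> s" "finite U" "(4 * real s) ^ (a + 1) \<le> card U"
  shows "(card U / (4 * real s) ^ a) ^ a \<le> card (indep_tuples a U)"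
  using assms(3,4)
proof (induction a arbitrary: U)
  case 0
  have "indep_tuples 0 U = {[]}" by (auto simp: indep_tuples_def indep_def)
  then show ?case by simp
next
  case (Suc a)
  let ?K = "4 * real s"
  let ?Z = "U - dominators s U"
  have K: "4 \<le> ?K" using assms(2) by simp
  have "?K \<le> ?K ^ (Suc a + 1)" by (rule self_le_power) (use K in auto)
  then have "real (4 * s) \<le> real (card U)"
    unfolding of_nat_mult of_nat_numeral using Suc.prems(2) by (rule order_trans)
  then have U: "4 * s \<le> card U" by (simp only: of_nat_le_iff)
  have "card (U \<inter> dominators s U) < s"
    using card_dominators_less[OF assms(1,2) Suc.prems(1) U] by blast
  moreover have "card U = card (U \<inter> dominators s U) + card ?Z"
    using Suc.prems(1) by (metis card_Int_Diff)
  ultimately have Z: "card U / 4 \<le> card ?Z" using U by linarith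
  have fin: "finite (indep_tuples a X)" if "finite X" for X a
    using finite_lists_length_eq[OF that, of a] by (rule rev_finite_subset) (auto simp: indep_tuples_def)
  let ?S = "SIGMA x:?Z. indep_tuples a (U - cnbr x)"
  have sub: "(\<lambda>(x, xs). x # xs) ` ?S \<subseteq> indep_tuples (Suc a) U"
  proof clarify
    fix x xs assume x: "x \<in> U" "x \<notin> dominators s U" and xs: "xs \<in> indep_tuples a (U - cnbr x)"
    then have "indep (insert x (set xs))"
      by (intro indep_insert) (auto simp: indep_tuples_def)
    then show "x # xs \<in> indep_tuples (Suc a) U"
      using x xs by (auto simp: indep_tuples_def cnbr_def)
  qed
  have "card ?S = card ((\<lambda>(x, xs). x # xs) ` ?S)"
    by (intro card_image[symmetric]) (auto simp: inj_on_def)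
  also have "\<dots> \<le> card (indep_tuples (Suc a) U)"
    using sub fin Suc.prems by (intro card_mono) auto
  finally have 1: "card ?S \<le> card (indep_tuples (Suc a) U)" .
  have each: "(card U / ?K ^ Suc a) ^ a \<le> card (indep_tuples a (U - cnbr x))" if "x \<in> ?Z" for x
  proof -
    have "card U \<le> 4 * s * card (U - cnbr x)" using that by (auto simp: dominators_def)
    then have "real (card U) \<le> real (4 * s * card (U - cnbr x))" by (rule of_nat_mono)
    then have c: "card U / ?K \<le> card (U - cnbr x)" using K by (simp add: field_simps)
    have "?K ^ (a + 1) \<le> card U / ?K" using Suc.prems(2) K by (simp add: field_simps)
    then have "(card (U - cnbr x) / ?K ^ a) ^ a \<le> card (indep_tuples a (U - cnbr x))"
      using c Suc.prems by (intro Suc.IH) auto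
    moreover have "(card U / ?K ^ Suc a) ^ a \<le> (card (U - cnbr x) / ?K ^ a) ^ a"
    proof (intro power_mono)
      have "card U / ?K ^ Suc a = card U / ?K / ?K ^ a" by simp
      also have "\<dots> \<le> card (U - cnbr x) / ?K ^ a" using c by (intro divide_right_mono) auto
      finally show "card U / ?K ^ Suc a \<le> card (U - cnbr x) / ?K ^ a" .
    qed simp
    ultimately show ?thesis by linarith
  qed
  have "?K \<le> ?K ^ Suc a" by (rule self_le_power) (use K in auto)
  then have "4 \<le> ?K ^ Suc a" using K by linarith
  then have "card U / ?K ^ Suc a \<le> card U / 4" by (rule divide_left_mono) (use assms(2) in auto)
  then have "card U / ?K ^ Suc a \<le> card ?Z" using Z by linarith
  then have "(card U / ?K ^ Suc a) ^ Suc a \<le> card ?Z * (card U / ?K ^ Suc a) ^ a"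
    by (subst power_Suc) (intro mult_right_mono; simp)
  also have "\<dots> = (\<Sum>x\<in>?Z. (card U / ?K ^ Suc a) ^ a)" by simp
  also have "\<dots> \<le> (\<Sum>x\<in>?Z. real (card (indep_tuples a (U - cnbr x))))"
    using each by (intro sum_mono)
  also have "\<dots> = card ?S" using Suc.prems fin by (subst card_SigmaI) auto
  also have "\<dots> \<le> card (indep_tuples (Suc a) U)" using 1 by simp
  finally show ?case .
qed

text \<open>The representative of the first set is taken outside the dominators of all remaining
  sets, so that each of these shrinks by a factor of at most \<open>4 * s\<close>. The factor
  \<open>length Qs\<close> is there because each remaining set excludes up to \<open>s\<close>
  choices. The sets may overlap.\<close>

lemma independent_representatives:
  assumes "biclique_free s" "1 \<le> s"
    and "\<And>Q. Q \<in> set Qs \<Longrightarrow> finite Q \<and> length Qs * (4 * s) ^ length Qs \<le> card Q"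
  obtains ys where "length ys = length Qs" "\<And>j. j < length Qs \<Longrightarrow> ys ! j \<in> Qs ! j"
    "distinct ys" "indep (set ys)"
proof -
  have "\<exists>ys. length ys = length Qs \<and> (\<forall>j<length Qs. ys ! j \<in> Qs ! j) \<and> distinct ys \<and> indep (set ys)"
    using assms(3)
  proof (induction "length Qs" arbitrary: Qs)
    case 0
    then show ?case by (auto simp: indep_def)
  next
    case (Suc n Qs0)
    obtain Q Qs where Qs0: "Qs0 = Q # Qs" "n = length Qs" using Suc.hyps(2) by (cases Qs0) auto
    let ?n = "length Qs"
    have K: "4 * s \<le> (4 * s) ^ Suc ?n" using assms(2) by simp
    have card: "finite R" "Suc ?n * (4 * s) \<le> card R" "4 * s \<le> card R"
      "Suc ?n * (4 * s) ^ Suc ?n \<le> card R" if "R \<in> set (Q # Qs)" for R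
    proof -
      show f: "finite R" and big: "Suc ?n * (4 * s) ^ Suc ?n \<le> card R" using Suc.prems[of R] that Qs0 by auto
      then show "Suc ?n * (4 * s) \<le> card R" using mult_le_mono2[OF K, of "Suc ?n"] by linarith
      then show "4 * s \<le> card R" by simp
    qed
    let ?B = "\<Union>R\<in>set Qs. Q \<inter> dominators s R"
    have "card ?B \<le> (\<Sum>R\<in>set Qs. card (Q \<inter> dominators s R))" by (intro card_UN_le) auto
    also have "\<dots> \<le> (\<Sum>R\<in>set Qs. s)"
    proof (intro sum_mono)
      fix R assume "R \<in> set Qs"
      then have "finite R" "4 * s \<le> card R" using card(1,3)[of R] by auto
      from card_dominators_less[OF assms(1,2) this, of "Q \<inter> dominators s R"]
      show "card (Q \<inter> dominators s R) \<le> s" by simp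
    qed
    also have "\<dots> \<le> ?n * s" by (simp add: card_length)
    also have "\<dots> < Suc ?n * (4 * s)" using assms(2) by simp
    also have "\<dots> \<le> card Q" using card(2)[of Q] by simp
    finally have "card ?B < card Q" .
    moreover have "finite ?B" using card(1)[of Q] by auto
    ultimately have "\<not> Q \<subseteq> ?B" using card_mono[of ?B Q] by linarith
    then obtain y where y: "y \<in> Q" "y \<notin> ?B" by blast
    let ?Rs = "map (\<lambda>R. R - cnbr y) Qs"
    have "finite R' \<and> length ?Rs * (4 * s) ^ length ?Rs \<le> card R'" if R': "R' \<in> set ?Rs" for R'
    proof -
      obtain R where R: "R \<in> set Qs" "R' = R - cnbr y" using R' by auto
      then have "card R \<le> 4 * s * card R'" using y by (auto simp: dominators_def)
      moreover have "Suc ?n * (4 * s) ^ Suc ?n \<le> card R" "finite R" using card R by auto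
      ultimately have "4 * s * (Suc ?n * (4 * s) ^ ?n) \<le> 4 * s * card R'" by (simp add: algebra_simps)
      then have "Suc ?n * (4 * s) ^ ?n \<le> card R'" using assms(2) by simp
      then show ?thesis using R \<open>finite R\<close> by simp
    qed
    from Suc.hyps(1)[of ?Rs, OF _ this] obtain zs where zs: "length zs = ?n"
      "\<forall>j<?n. zs ! j \<in> ?Rs ! j" "distinct zs" "indep (set zs)"
      using Qs0 by auto
    have z: "z \<notin> cnbr y" if "z \<in> set zs" for z
      using that zs by (auto simp: in_set_conv_nth)
    have "indep (set (y # zs))"
      using indep_insert[OF zs(4) z] by simp
    moreover have "distinct (y # zs)" using z zs(3) by (auto simp: cnbr_def)
    moreover have "\<forall>j<length Qs0. (y # zs) ! j \<in> Qs0 ! j"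
      using zs(1,2) y(1) Qs0 by (auto simp: nth_Cons split: nat.split)
    ultimately show ?case using zs(1) Qs0 by (intro exI[of _ "y # zs"]) auto
  qed
  then show thesis using that by blast
qed


text \<open>Double counting of pairs \<open>(z, xs)\<close> with \<open>xs\<close> an independent
  tuple in \<open>nbr z \<inter> P\<close>. At least \<open>\<delta> * N / 2\<close> vertices
  \<open>z\<close> have at least \<open>\<delta> * N / 2\<close> neighbours in \<open>P\<close>,
  hence many such tuples. There are at most \<open>N ^ a\<close> tuples, so those with fewer than
  \<open>\<kappa> * N / 2\<close> common neighbours account for at most half of the pairs, and each
  of the others for at most \<open>N\<close>.\<close>

lemma dense_pair_tuple:
  fixes \<delta> N :: real
  assumes "biclique_free s" "1 \<le> s" "finite P" "finite Q" "card P \<le> N" "card Q \<le> N" "0 < N" "0 < \<delta>"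
    and dense: "\<delta> * N\<^sup>2 \<le> (\<Sum>z\<in>Q. card (nbr z \<inter> P))"
    and large: "(4 * real s) ^ (a + 1) \<le> \<delta> * N / 2"
  defines "\<kappa> \<equiv> (\<delta> / (2 * (4 * real s) ^ a)) ^ (a + 1)"
  shows "\<kappa> * N ^ a / 2 \<le> card {xs \<in> indep_tuples a P. \<kappa> * N / 2 \<le> card {z\<in>Q. set xs \<subseteq> nbr z}}"
proof -
  let ?K = "4 * real s"
  let ?c = "\<lambda>xs. {z\<in>Q. set xs \<subseteq> nbr z}"
  let ?G = "{xs \<in> indep_tuples a P. \<kappa> * N / 2 \<le> card (?c xs)}"
  let ?Q' = "{z\<in>Q. \<delta> * N / 2 \<le> card (nbr z \<inter> P)}"
  have K: "4 \<le> ?K" using assms(2) by simp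
  have finI: "finite (indep_tuples a P)"
    using finite_lists_length_eq[OF assms(3), of a] by (rule rev_finite_subset) (auto simp: indep_tuples_def)
  have cardI: "card (indep_tuples a P) \<le> N ^ a"
  proof -
    have "card (indep_tuples a P) \<le> card {xs. set xs \<subseteq> P \<and> length xs = a}"
      using finite_lists_length_eq[OF assms(3), of a] by (intro card_mono) (auto simp: indep_tuples_def)
    also have "\<dots> = card P ^ a" using assms(3) by (simp add: card_lists_length_eq)
    finally have "real (card (indep_tuples a P)) \<le> real (card P) ^ a" by (metis of_nat_le_iff of_nat_power)
    also have "\<dots> \<le> N ^ a" using assms(5) by (intro power_mono) auto
    finally show ?thesis .
  qed
  have "\<delta> * N\<^sup>2 \<le> (\<Sum>z\<in>Q. real (card (nbr z \<inter> P)))" using dense by simp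
  also have "\<dots> \<le> (\<Sum>z\<in>Q. (if z \<in> ?Q' then N else 0) + \<delta> * N / 2)"
  proof (rule sum_mono)
    fix z assume "z \<in> Q"
    have "card (nbr z \<inter> P) \<le> card P" using assms(3) by (intro card_mono) auto
    then have "real (card (nbr z \<inter> P)) \<le> N" using assms(5) by linarith
    moreover have "0 \<le> \<delta> * N" using assms by simp
    ultimately show "real (card (nbr z \<inter> P)) \<le> (if z \<in> ?Q' then N else 0) + \<delta> * N / 2"
      using \<open>z \<in> Q\<close> by auto
  qed
  also have "\<dots> = card ?Q' * N + card Q * (\<delta> * N / 2)"
    using assms(4) by (simp add: sum.distrib sum.If_cases Int_def)
  also have "\<dots> \<le> card ?Q' * N + N * (\<delta> * N / 2)"
    using assms(6-8) by (intro add_left_mono mult_right_mono) auto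
  finally have "(\<delta> * N / 2) * N \<le> card ?Q' * N" by (simp add: power2_eq_square algebra_simps)
  then have Q': "\<delta> * N / 2 \<le> card ?Q'" using assms(7) by simp
  \<comment> \<open>Of the \<open>a + 1\<close> factors in \<open>\<kappa>\<close>, \<open>a\<close>
    come from the tuples and one from the choice of \<open>z\<close>; the latter is weakened by
    \<open>?K ^ a\<close> to make \<open>\<kappa>\<close> a pure power.\<close>
  have \<kappa>: "\<kappa> * N ^ (a + 1) \<le> \<delta> * N / 2 * (\<delta> * N / 2 / ?K ^ a) ^ a"
  proof -
    have "\<kappa> * N ^ (a + 1) = (\<delta> * N / 2 / ?K ^ a) ^ (a + 1)"
      unfolding \<kappa>_def by (simp only: power_mult_distrib[symmetric]) (simp add: mult_ac)
    also have "\<dots> = (\<delta> * N / 2 / ?K ^ a) * (\<delta> * N / 2 / ?K ^ a) ^ a" by simp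
    also have "\<dots> \<le> \<delta> * N / 2 * (\<delta> * N / 2 / ?K ^ a) ^ a"
    proof (intro mult_right_mono)
      have "1 \<le> ?K ^ a" using K by (intro one_le_power) auto
      then show "\<delta> * N / 2 / ?K ^ a \<le> \<delta> * N / 2" using assms(7,8) by (simp add: divide_le_eq mult_left_le)
    qed (use assms in auto)
    finally show ?thesis .
  qed
  have "\<delta> * N / 2 * (\<delta> * N / 2 / ?K ^ a) ^ a \<le> card ?Q' * (\<delta> * N / 2 / ?K ^ a) ^ a"
    using Q' assms by (intro mult_right_mono) auto
  also have "\<dots> = (\<Sum>z\<in>?Q'. (\<delta> * N / 2 / ?K ^ a) ^ a)" by simp
  also have "\<dots> \<le> (\<Sum>z\<in>?Q'. real (card (indep_tuples a (nbr z \<inter> P))))"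
  proof (rule sum_mono)
    fix z assume z: "z \<in> ?Q'"
    then have "?K ^ (a + 1) \<le> card (nbr z \<inter> P)" using large by auto
    then have "(card (nbr z \<inter> P) / ?K ^ a) ^ a \<le> card (indep_tuples a (nbr z \<inter> P))"
      using assms by (intro card_indep_tuples_ge) auto
    moreover have "(\<delta> * N / 2 / ?K ^ a) ^ a \<le> (card (nbr z \<inter> P) / ?K ^ a) ^ a"
      using z assms by (intro power_mono divide_right_mono) auto
    ultimately show "(\<delta> * N / 2 / ?K ^ a) ^ a \<le> real (card (indep_tuples a (nbr z \<inter> P)))" by linarith
  qed
  also have "\<dots> \<le> (\<Sum>z\<in>Q. real (card (indep_tuples a (nbr z \<inter> P))))"
    using assms(4) by (intro sum_mono2) auto
  also have "\<dots> = (\<Sum>xs\<in>indep_tuples a P. real (card (?c xs)))"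
  proof -
    have "indep_tuples a (nbr z \<inter> P) = indep_tuples a P \<inter> {xs. set xs \<subseteq> nbr z}" for z
      by (auto simp: indep_tuples_def)
    then have "real (card (indep_tuples a (nbr z \<inter> P))) = (\<Sum>xs\<in>indep_tuples a P. of_bool (set xs \<subseteq> nbr z))" for z
      using finI by simp
    moreover have "real (card (?c xs)) = (\<Sum>z\<in>Q. of_bool (set xs \<subseteq> nbr z))" for xs
      using assms(4) by (simp add: Int_def)
    ultimately show ?thesis by (simp only: sum.swap[of _ Q])
  qed
  also have "\<dots> \<le> (\<Sum>xs\<in>indep_tuples a P. (if xs \<in> ?G then N else 0) + \<kappa> * N / 2)"
  proof (rule sum_mono)
    fix xs assume xs: "xs \<in> indep_tuples a P"
    have "card (?c xs) \<le> card Q" using assms(4) by (intro card_mono) auto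
    then have "real (card (?c xs)) \<le> N" using assms(6) by linarith
    moreover have "0 \<le> \<kappa> * N" using assms by (simp add: \<kappa>_def)
    ultimately show "real (card (?c xs)) \<le> (if xs \<in> ?G then N else 0) + \<kappa> * N / 2"
      using xs by auto
  qed
  also have "\<dots> = card ?G * N + card (indep_tuples a P) * (\<kappa> * N / 2)"
    using finI by (simp add: sum.distrib sum.If_cases Int_def)
  also have "\<dots> \<le> card ?G * N + N ^ a * (\<kappa> * N / 2)"
    using cardI assms(7,8) by (intro add_left_mono mult_right_mono) (auto simp: \<kappa>_def)
  finally have "\<kappa> * N ^ (a + 1) \<le> card ?G * N + N ^ a * (\<kappa> * N / 2)" using \<kappa> by linarith
  then have "(\<kappa> * N ^ a / 2) * N \<le> card ?G * N" by (simp add: algebra_simps)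
  then show ?thesis using assms(7) by simp
qed

text \<open>
  Nonadjacency is imposed one index at a time, so that \<open>pattern_class Q xs R j\<close> does not depend on \<open>xs ! j\<close>
  when \<open>R\<close> omits \<open>j\<close>, and few values of \<open>xs ! j\<close> are bad for it.
\<close>

definition pattern_class :: "'a set \<Rightarrow> 'a list \<Rightarrow> nat set \<Rightarrow> nat \<Rightarrow> 'a set" where
  "pattern_class Q xs R j =
     {z\<in>Q. (\<forall>i\<in>R. z \<in> nbr (xs ! i)) \<and> (\<forall>i<j. i \<notin> R \<longrightarrow> z \<notin> cnbr (xs ! i))}"

lemma card_bad_tuples:
  assumes "biclique_free s" "1 \<le> s" "finite P" "finite Q" "j < a" "R \<subseteq> {..<a}" "j \<notin> R"
  shows "card {xs. length xs = a \<and> set xs \<subseteq> P \<and> 4 * s \<le> card (pattern_class Q xs R j) \<and>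
      xs ! j \<in> dominators s (pattern_class Q xs R j)} \<le> s * card P ^ (a - 1)"
proof -
  \<comment> \<open>The placeholder \<open>undefined\<close> stands at position \<open>j\<close>, so
    that the class becomes a function of the other entries alone.\<close>
  let ?w = "\<lambda>ys zs. ys @ undefined # zs"
  let ?F = "\<lambda>ys zs. if 4 * s \<le> card (pattern_class Q (?w ys zs) R j)
    then dominators s (pattern_class Q (?w ys zs) R j) else {}"
  have eq: "pattern_class Q (?w (take j xs) (drop (Suc j) xs)) R j = pattern_class Q xs R j"
    if "length xs = a" for xs
  proof -
    have "?w (take j xs) (drop (Suc j) xs) ! i = xs ! i" if "i \<noteq> j" "i < a" for i
    proof -
      have "Suc (j + x) = i" if "i - j = Suc x" for x using that by linarith
      then show ?thesis
        using that assms(5) \<open>length xs = a\<close> by (auto simp: nth_append nth_Cons split: nat.split)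
    qed
    moreover have "i \<noteq> j \<and> i < a" if "i \<in> R" for i using that assms(6,7) by auto
    moreover have "i \<noteq> j \<and> i < a" if "i < j" for i using that assms(5) by auto
    ultimately show ?thesis unfolding pattern_class_def by auto
  qed
  have "{xs. length xs = a \<and> set xs \<subseteq> P \<and> 4 * s \<le> card (pattern_class Q xs R j) \<and>
      xs ! j \<in> dominators s (pattern_class Q xs R j)}
    = {xs. length xs = a \<and> set xs \<subseteq> P \<and> xs ! j \<in> ?F (take j xs) (drop (Suc j) xs)}"
    using eq by (auto split: if_splits)
  also have "card \<dots> \<le> s * card P ^ (a - 1)"
  proof (rule card_lists_coordinate_le[OF assms(3,5)])
    fix ys zs :: "'a list"
    have fin: "finite (pattern_class Q (?w ys zs) R j)" using assms(4) by (simp add: pattern_class_def)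
    show "card (P \<inter> ?F ys zs) \<le> s"
      using card_dominators_less[OF assms(1,2) fin, of "P \<inter> ?F ys zs"] by auto
  qed
  finally show ?thesis .
qed

text \<open>The class at stage 0 contains the common neighbourhood of all entries, and imposing
  nonadjacency to one entry outside \<open>R\<close> costs a factor of at most \<open>4 * s\<close>
  when this entry is no dominator. The exponent \<open>a + 1\<close> guarantees the
  \<open>4 * s\<close> vertices that \<open>good\<close> asks for at each stage.\<close>

lemma card_pattern_class_ge:
  fixes M :: real
  assumes "1 \<le> s" "finite Q" "R \<subseteq> {..<a}" "length xs = a"
    and M: "M \<le> card {z\<in>Q. set xs \<subseteq> nbr z}" "(4 * real s) ^ (a + 1) \<le> M"
    and good: "\<And>j. j < a \<Longrightarrow> j \<notin> R \<Longrightarrow> 4 * s \<le> card (pattern_class Q xs R j) \<Longrightarrow>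
      xs ! j \<notin> dominators s (pattern_class Q xs R j)"
    and "j \<le> a"
  shows "M / (4 * real s) ^ j \<le> card (pattern_class Q xs R j)"
  using assms(8)
proof (induction j)
  case 0
  have "{z\<in>Q. set xs \<subseteq> nbr z} \<subseteq> pattern_class Q xs R 0"
  proof clarify
    fix z assume z: "z \<in> Q" "set xs \<subseteq> nbr z"
    have "z \<in> nbr (xs ! i)" if "i \<in> R" for i
    proof -
      have "xs ! i \<in> set xs" using that assms(3,4) by auto
      then show ?thesis using z(2) nbr_sym by blast
    qed
    then show "z \<in> pattern_class Q xs R 0" using z(1) by (simp add: pattern_class_def)
  qed
  then have "card {z\<in>Q. set xs \<subseteq> nbr z} \<le> card (pattern_class Q xs R 0)"
    using assms(2) by (intro card_mono) (auto simp: pattern_class_def)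
  then show ?case using M by simp
next
  case (Suc j)
  let ?K = "4 * real s"
  have K: "4 \<le> ?K" using assms(1) by simp
  then have "?K ^ Suc j \<le> ?K ^ (a + 1)" using Suc.prems by (intro power_increasing) auto
  then have "?K ^ Suc j \<le> M" using M by linarith
  then have "?K \<le> M / ?K ^ j" using K by (simp add: field_simps)
  then have "?K \<le> card (pattern_class Q xs R j)" using Suc by simp
  then have "real (4 * s) \<le> card (pattern_class Q xs R j)" by simp
  then have big: "4 * s \<le> card (pattern_class Q xs R j)" by (simp only: of_nat_le_iff)
  have IH: "M / ?K ^ j \<le> card (pattern_class Q xs R j)" using Suc by simp
  show ?case
  proof (cases "j \<in> R")
    case True
    then have "pattern_class Q xs R (Suc j) = pattern_class Q xs R j"
      by (auto simp: pattern_class_def less_Suc_eq)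
    moreover have "0 \<le> M" using M(2) K by (meson order_trans zero_le_power zero_le_numeral)
    then have "M / ?K ^ Suc j \<le> M / ?K ^ j" using K by (intro divide_left_mono power_increasing) auto
    ultimately show ?thesis using IH by simp
  next
    case False
    then have "pattern_class Q xs R (Suc j) = pattern_class Q xs R j - cnbr (xs ! j)"
      by (auto simp: pattern_class_def less_Suc_eq)
    moreover have "card (pattern_class Q xs R j) \<le> 4 * s * card (pattern_class Q xs R j - cnbr (xs ! j))"
      using good[OF _ False big] Suc.prems by (auto simp: dominators_def)
    then have "real (card (pattern_class Q xs R j)) \<le> real (4 * s * card (pattern_class Q xs R j - cnbr (xs ! j)))"
      by (rule of_nat_mono)
    ultimately have "M / ?K ^ j \<le> ?K * card (pattern_class Q xs R (Suc j))" using IH by simp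
    then show ?thesis using K by (simp add: field_simps)
  qed
qed

end


text \<open>The line \<open>y = m x + c\<close> over \<open>\<int>/q\<close> has index \<open>m q + c\<close>, the point \<open>(x, y)\<close> has index \<open>x q + y\<close>.\<close>

lemma affine_plane_lines:
  fixes k :: nat
  obtains a :: nat and L :: "nat \<Rightarrow> nat set" where "0 < a" "\<And>j. L j \<subseteq> {..<a}" "\<And>j. k \<le> card (L j)"
    "\<And>j j'. j < a \<Longrightarrow> j' < a \<Longrightarrow> j \<noteq> j' \<Longrightarrow> card (L j \<inter> L j') \<le> 1"
proof -
  obtain q :: nat where q: "prime q" "k < q" using bigger_prime by blast
  then have q0: "0 < q" by auto
  define y where "y = (\<lambda>j x. (j div q * x + j mod q) mod q)"
  define L where "L = (\<lambda>j. (\<lambda>x. x * q + y j x) ` {..<q})"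
  have y: "y j x < q" for j x using q0 by (simp add: y_def)
  have dec: "(x * q + y j x) div q = x" "(x * q + y j x) mod q = y j x" for j x
    using y[of j x] by auto
  have sub: "L j \<subseteq> {..<q * q}" for j
  proof -
    have "x * q + y j x < q * q" if "x < q" for x
    proof -
      have "x * q + y j x < (x + 1) * q" using y[of j x] by simp
      also have "\<dots> \<le> q * q" using that by (intro mult_right_mono) auto
      finally show ?thesis .
    qed
    then show ?thesis by (auto simp: L_def)
  qed
  have "inj_on (\<lambda>x. x * q + y j x) {..<q}" for j
    by (rule inj_on_inverseI[where g = "\<lambda>i. i div q"]) (rule dec)
  then have card: "k \<le> card (L j)" for j using q by (simp add: L_def card_image)
  have "card (L j \<inter> L j') \<le> 1" if j: "j < q * q" "j' < q * q" "j \<noteq> j'" for j j'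
  proof (rule ccontr)
    assume "\<not> ?thesis"
    then obtain i1 i2 where i: "i1 \<in> L j \<inter> L j'" "i2 \<in> L j \<inter> L j'" "i1 \<noteq> i2"
      by (metis One_nat_def card_le_Suc0_iff_eq finite_Int finite_imageI finite_lessThan L_def)
    define m c m' c' where "m = int (j div q)" "c = int (j mod q)" "m' = int (j' div q)" "c' = int (j' mod q)"
    have key: "int q dvd (m - m') * int x + (c - c')" if x: "x * q + y j x \<in> L j'" for x
    proof -
      obtain x' where "x * q + y j x = x' * q + y j' x'" using x by (auto simp: L_def)
      then have "y j x = y j' x" using dec[of x j] dec[of x' j'] by metis
      then have "int (j div q * x + j mod q) mod int q = int (j' div q * x + j' mod q) mod int q"
        by (simp only: y_def zmod_int[symmetric])
      then have "int q dvd int (j div q * x + j mod q) - int (j' div q * x + j' mod q)"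
        by (simp add: mod_eq_dvd_iff)
      then show ?thesis by (simp add: m_c_m'_c'_def algebra_simps)
    qed
    obtain x1 x2 where x: "x1 < q" "i1 = x1 * q + y j x1" "x2 < q" "i2 = x2 * q + y j x2"
      using i by (auto simp: L_def)
    \<comment> \<open>Subtracting the congruences of two common points removes the constant term. As
      \<open>q\<close> is prime and the abscissas differ modulo \<open>q\<close>, the slopes agree,
      and then so do the intercepts.\<close>
    have "int q dvd ((m - m') * int x1 + (c - c')) - ((m - m') * int x2 + (c - c'))"
      using key[of x1] key[of x2] i x by (intro dvd_diff) auto
    then have "int q dvd (m - m') * (int x1 - int x2)" by (simp add: algebra_simps)
    then have "int q dvd m - m' \<or> int q dvd int x1 - int x2" using q(1) by (simp add: prime_dvd_mult_iff)
    moreover have small: "d = 0" if "int q dvd d" "\<bar>d\<bar> < int q" for d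
      using that dvd_imp_le_int[of d "int q"] by auto
    have "int x1 - int x2 \<noteq> 0" "\<bar>int x1 - int x2\<bar> < int q" using x i(3) by auto
    then have "\<not> int q dvd int x1 - int x2" using small by blast
    ultimately have dm: "int q dvd m - m'" by blast
    have "j div q < q" "j' div q < q" using j by (simp_all add: less_mult_imp_div_less)
    then have "\<bar>m - m'\<bar> < int q" by (auto simp: m_c_m'_c'_def)
    then have "m = m'" using small[OF dm] by simp
    then have dc: "int q dvd c - c'" using key[of x1] i x by auto
    have "j mod q < q" "j' mod q < q" using q0 by auto
    then have "\<bar>c - c'\<bar> < int q" by (auto simp: m_c_m'_c'_def simp del: mod_less_divisor)
    then have "c = c'" using small[OF dc] by simp
    then have "j = j'" using \<open>m = m'\<close> by (metis m_c_m'_c'_def of_nat_eq_iff div_mult_mod_eq)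
    then show False using j by simp
  qed
  \<comment> \<open>Without the vertical lines there are as many lines as points, so one number
    \<open>a\<close> serves for both.\<close>
  then show thesis
    using q0 sub card by (intro that[of "q * q" L]) auto
qed

text \<open>Everything is measured in powers of \<open>W = K / \<delta>\<close>. The part
  \<open>(a + 1)\<^sup>2\<close> of the exponent compensates \<open>\<kappa>\<close>, since
  \<open>1 \<le> \<kappa> * W ^ ((a + 1)\<^sup>2)\<close>; the remaining
  \<open>2 * a + 2 * b + 3\<close> powers cover the explicit losses, where \<open>2 ^ a\<close>,
  \<open>a\<close> and \<open>b\<close> are bounded by powers of \<open>W\<close> as well.\<close>

lemma dense_embedding_arith:
  fixes \<delta> N K :: real
  assumes "4 \<le> K" "0 < \<delta>" "\<delta> \<le> 1" "(K / \<delta>) ^ ((a + 1)\<^sup>2 + 2 * a + 2 * b + 3) \<le> N" "0 < a" "real s \<le> K"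
  defines "\<kappa> \<equiv> (\<delta> / (2 * K ^ a)) ^ (a + 1)"
  shows "0 < N" "K ^ (a + 1) \<le> \<delta> * N / 2" "K ^ (a + 1) \<le> \<kappa> * N / 2"
    "2 ^ a * real a * real s * N ^ (a - 1) < \<kappa> * N ^ a / 2" "b * K ^ b \<le> \<kappa> * N / 2 / K ^ a"
proof -
  define W where "W = K / \<delta>"
  have WK: "K \<le> W" using assms(1-3) by (simp add: W_def le_divide_eq mult_left_le)
  then have W4: "4 \<le> W" using assms(1) by linarith
  have mono: "W ^ m \<le> W ^ n" if "m \<le> n" for m n using that W4 by (intro power_increasing) auto
  have KW: "K ^ m \<le> W ^ m" for m using WK assms(1) by (intro power_mono) auto
  have N: "W ^ ((a + 1)\<^sup>2 + (2 * a + 2 * b + 3)) \<le> N" using assms(4) by (simp add: W_def add.assoc)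
  show N0: "0 < N" using N W4 by (smt (verit) zero_less_power)
  have K0: "0 < K ^ a" "1 \<le> K ^ a" using assms(1) by (auto intro: one_le_power)
  have \<kappa>0: "0 < \<kappa>" using assms(1,2) by (simp add: \<kappa>_def)
  have "1 \<le> \<delta> / (2 * K ^ a) * W ^ (a + 1)"
  proof -
    have "\<delta> / (2 * K ^ a) * W ^ (a + 1) = K / 2 / \<delta> ^ a"
      using assms(1,2) by (simp add: W_def power_divide field_simps)
    moreover have "\<delta> ^ a \<le> 1" using assms(2,3) by (simp add: power_le_one)
    ultimately show ?thesis using assms(1,2) by (simp add: le_divide_eq)
  qed
  then have "1 \<le> (\<delta> / (2 * K ^ a) * W ^ (a + 1)) ^ (a + 1)" by (rule one_le_power)
  also have "\<dots> = \<kappa> * W ^ ((a + 1)\<^sup>2)"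
    by (simp only: power_mult_distrib \<kappa>_def power_mult[symmetric] power2_eq_square)
  finally have 1: "1 \<le> \<kappa> * W ^ ((a + 1)\<^sup>2)" .
  have "W ^ (2 * a + 2 * b + 3) \<le> \<kappa> * W ^ ((a + 1)\<^sup>2) * W ^ (2 * a + 2 * b + 3)"
    using mult_right_mono[OF 1, of "W ^ (2 * a + 2 * b + 3)"] W4 by simp
  also have "\<dots> = \<kappa> * W ^ ((a + 1)\<^sup>2 + (2 * a + 2 * b + 3))" by (simp only: power_add mult.assoc)
  also have "\<dots> \<le> \<kappa> * N" using N \<kappa>0 by (intro mult_left_mono) auto
  finally have big: "W ^ (2 * a + 2 * b + 3) \<le> \<kappa> * N" .
  have "2 * K ^ (a + 1) \<le> W * W ^ (a + 1)" using W4 assms(1) KW[of "a + 1"] by (intro mult_mono) auto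
  also have "\<dots> = W ^ (a + 2)" by simp
  also have "\<dots> \<le> W ^ (2 * a + 2 * b + 3)" by (intro mono) auto
  finally show 3: "K ^ (a + 1) \<le> \<kappa> * N / 2" using big by linarith
  have "\<kappa> \<le> \<delta> / (2 * K ^ a)"
  proof -
    have "\<delta> / (2 * K ^ a) \<le> 1" using K0 assms(2,3) by (simp add: divide_le_eq)
    then show ?thesis unfolding \<kappa>_def using assms(1,2) power_decreasing[of 1 "a + 1" "\<delta> / (2 * K ^ a)"] by simp
  qed
  also have "\<dots> \<le> \<delta>" using K0 assms(2) by (simp add: divide_le_eq mult_left_le)
  finally have "\<kappa> * N \<le> \<delta> * N" using N0 by (intro mult_right_mono) auto
  then show "K ^ (a + 1) \<le> \<delta> * N / 2" using 3 by linarith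
  have "2 ^ (a + 1) * real a * real s < W ^ (a + 1) * W ^ a * W"
  proof -
    have "real a < 2 ^ a" by (rule of_nat_less_two_power)
    also have "\<dots> \<le> W ^ a" using W4 by (intro power_mono) auto
    finally have "real a < W ^ a" .
    moreover have "2 ^ (a + 1) \<le> W ^ (a + 1)" using W4 by (intro power_mono) auto
    ultimately have "2 ^ (a + 1) * real a < W ^ (a + 1) * W ^ a" using W4 by (intro mult_le_less_imp_less) auto
    moreover have "real s \<le> W" using assms(6) WK by linarith
    then have "2 ^ (a + 1) * real a * real s \<le> 2 ^ (a + 1) * real a * W" by (rule mult_left_mono) auto
    ultimately show ?thesis using W4 mult_strict_right_mono[of "2 ^ (a + 1) * real a" "W ^ (a + 1) * W ^ a" W]
      by linarith
  qed
  also have "\<dots> = W ^ (a + 1 + a + 1)" by (simp add: power_add mult_ac)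
  also have "\<dots> \<le> \<kappa> * N" using big mono[of "a + 1 + a + 1" "2 * a + 2 * b + 3"] by linarith
  finally have "2 ^ (a + 1) * real a * real s * N ^ (a - 1) < \<kappa> * N * N ^ (a - 1)"
    using N0 by (intro mult_strict_right_mono) auto
  moreover have "N ^ a = N * N ^ (a - 1)" using assms(5) by (simp add: power_eq_if)
  ultimately show "2 ^ a * real a * real s * N ^ (a - 1) < \<kappa> * N ^ a / 2" by (simp add: mult_ac)
  have "2 * (real b * K ^ b * K ^ a) \<le> W * (W ^ b * W ^ b * W ^ a)"
  proof -
    have "real b \<le> 2 ^ b" using of_nat_less_two_power[of b] by (simp add: less_imp_le)
    also have "\<dots> \<le> W ^ b" using W4 by (intro power_mono) auto
    finally have "real b \<le> W ^ b" .
    then show ?thesis using W4 KW K0 assms(1) by (intro mult_mono) auto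
  qed
  also have "\<dots> = W ^ (1 + b + b + a)" by (simp add: power_add)
  also have "\<dots> \<le> \<kappa> * N" using big mono[of "1 + b + b + a" "2 * a + 2 * b + 3"] by linarith
  finally show "b * K ^ b \<le> \<kappa> * N / 2 / K ^ a" using K0 by (simp add: le_divide_eq)
qed


section \<open>Embedding linear set systems into dense pairs\<close>

context ugraph
begin

text \<open>Over all \<open>R\<close> and \<open>j\<close>, the bad tuples number at most
  \<open>2 ^ a * a * s * N ^ (a - 1)\<close>, one power of \<open>N\<close> below the tuples with a
  large common neighbourhood. So a single independent tuple \<open>xs\<close> has every adjacency
  pattern realised by many vertices. Its entries become the points of the set system and independent
  representatives of the classes of \<open>L j\<close> become the sets; \<open>a \<le> b\<close>
  yields \<open>card S \<le> card T\<close>.\<close>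

lemma pattern_embedding:
  fixes \<delta> N :: real and L :: "nat \<Rightarrow> nat set"
  assumes "biclique_free s" "1 \<le> s" "P \<subseteq> V" "Q \<subseteq> V" "card P \<le> N" "card Q \<le> N" "0 < \<delta>" "\<delta> \<le> 1"
    and dense: "\<delta> * N\<^sup>2 \<le> (\<Sum>z\<in>Q. card (nbr z \<inter> P))"
    and large: "(4 * real s / \<delta>) ^ ((a + 1)\<^sup>2 + 2 * a + 2 * b + 3) \<le> N"
    and "0 < a" "a \<le> b"
    and L: "\<And>j. j < b \<Longrightarrow> L j \<subseteq> {..<a}" "\<And>j. j < b \<Longrightarrow> k \<le> card (L j)"
      "\<And>j j'. j < b \<Longrightarrow> j' < b \<Longrightarrow> j \<noteq> j' \<Longrightarrow> card (L j \<inter> L j') \<le> 1"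
  shows "\<exists>S T. rich_pair k S T \<and> linear_pair S T"
proof -
  let ?K = "4 * real s"
  define \<kappa> where "\<kappa> = (\<delta> / (2 * ?K ^ a)) ^ (a + 1)"
  have K: "4 \<le> ?K" "real s \<le> ?K" using assms(2) by auto
  note ar = dense_embedding_arith[OF K(1) assms(7,8) large \<open>0 < a\<close> K(2), folded \<kappa>_def]
  have fin: "finite P" "finite Q" using assms(3,4) finV finite_subset by auto
  let ?G = "{xs \<in> indep_tuples a P. \<kappa> * N / 2 \<le> card {z\<in>Q. set xs \<subseteq> nbr z}}"
  let ?B = "\<lambda>R j. {xs. length xs = a \<and> set xs \<subseteq> P \<and> 4 * s \<le> card (pattern_class Q xs R j) \<and>
      xs ! j \<in> dominators s (pattern_class Q xs R j)}"
  let ?I = "{(R, j). R \<subseteq> {..<a} \<and> j < a \<and> j \<notin> R}"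
  have I: "?I \<subseteq> Pow {..<a} \<times> {..<a}" by auto
  then have finI: "finite ?I" by (rule finite_subset) auto
  have cardI: "card ?I \<le> 2 ^ a * a"
    using card_mono[OF _ I] by (simp add: card_cartesian_product card_Pow)
  have G: "\<kappa> * N ^ a / 2 \<le> card ?G"
    unfolding \<kappa>_def using assms ar(1,2) fin by (intro dense_pair_tuple) auto
  have "card (\<Union>p\<in>?I. ?B (fst p) (snd p)) \<le> (\<Sum>p\<in>?I. card (?B (fst p) (snd p)))"
    using finI by (rule card_UN_le)
  also have "\<dots> \<le> (\<Sum>p\<in>?I. s * card P ^ (a - 1))"
    using assms(1,2) fin by (intro sum_mono card_bad_tuples) auto
  also have "\<dots> = card ?I * (s * card P ^ (a - 1))" by simp
  also have "\<dots> \<le> 2 ^ a * a * (s * card P ^ (a - 1))"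
    using cardI by (intro mult_right_mono) auto
  finally have "real (card (\<Union>p\<in>?I. ?B (fst p) (snd p))) \<le> real (2 ^ a * a * (s * card P ^ (a - 1)))"
    by (rule of_nat_mono)
  also have "\<dots> = 2 ^ a * real a * real s * real (card P) ^ (a - 1)" by simp
  also have "\<dots> \<le> 2 ^ a * real a * real s * N ^ (a - 1)"
    using assms(5) by (intro mult_left_mono power_mono) auto
  also have "\<dots> < card ?G" using ar(4) G by linarith
  finally have less: "card (\<Union>p\<in>?I. ?B (fst p) (snd p)) < card ?G" by simp
  have "?B R j \<subseteq> {xs. set xs \<subseteq> P \<and> length xs = a}" for R j by auto
  then have "finite (?B R j)" for R j
    using finite_lists_length_eq[OF fin(1)] by (rule finite_subset)
  then have "finite (\<Union>p\<in>?I. ?B (fst p) (snd p))" using finI by (intro finite_UN_I) auto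
  from card_mono[OF this, of ?G] have "\<not> ?G \<subseteq> (\<Union>p\<in>?I. ?B (fst p) (snd p))"
    using less by linarith
  then obtain xs where xs: "xs \<in> ?G" "xs \<notin> (\<Union>p\<in>?I. ?B (fst p) (snd p))" by (meson subsetI)
  have xs': "xs \<notin> ?B R j" if "R \<subseteq> {..<a}" "j < a" "j \<notin> R" for R j
  proof
    assume "xs \<in> ?B R j"
    then have "xs \<in> ?B (fst (R, j)) (snd (R, j))" by (simp only: fst_conv snd_conv)
    moreover have "(R, j) \<in> ?I" using that by simp
    ultimately show False using xs(2) by blast
  qed
  from xs have len: "length xs = a" "set xs \<subseteq> P" "distinct xs" "indep (set xs)"
    by (auto simp: indep_tuples_def)
  have big: "b * ?K ^ b \<le> card (pattern_class Q xs R a)" if R: "R \<subseteq> {..<a}" for R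
  proof -
    have "\<kappa> * N / 2 / ?K ^ a \<le> card (pattern_class Q xs R a)"
      
    proof (rule card_pattern_class_ge[OF assms(2) fin(2) R len(1) _ ar(3)])
      show "xs ! j \<notin> dominators s (pattern_class Q xs R j)"
        if "j < a" "j \<notin> R" "4 * s \<le> card (pattern_class Q xs R j)" for j
        using xs'[OF R that(1,2)] that(3) len by blast
    qed (use xs in auto)
    then show ?thesis using ar(5) by linarith
  qed
  let ?Qs = "map (\<lambda>j. pattern_class Q xs (L j) a) [0..<b]"
  have "finite Q' \<and> length ?Qs * (4 * s) ^ length ?Qs \<le> card Q'" if Q': "Q' \<in> set ?Qs" for Q'
  proof -
    obtain j where j: "j < b" "Q' = pattern_class Q xs (L j) a" using Q' by auto
    then have "real (b * (4 * s) ^ b) \<le> card Q'" using big[OF L(1)[OF j(1)]] by simp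
    then have "b * (4 * s) ^ b \<le> card Q'" by (simp only: of_nat_le_iff)
    then show ?thesis using j fin by (simp add: pattern_class_def)
  qed
  from independent_representatives[OF assms(1,2), of ?Qs, OF this] obtain ys where
    ys: "length ys = b" "\<And>j. j < b \<Longrightarrow> ys ! j \<in> pattern_class Q xs (L j) a" "distinct ys" "indep (set ys)"
    by auto
  have adj: "nbr (ys ! j) \<inter> set xs = (!) xs ` L j" if j: "j < b" for j
  proof -
    have "xs ! i \<in> nbr (ys ! j) \<longleftrightarrow> i \<in> L j" if "i < a" for i
      using ys(2)[OF j] that nbr_sym by (auto simp: pattern_class_def cnbr_def)
    then show ?thesis using L(1)[OF j] len(1) by (auto simp: in_set_conv_nth) blast+
  qed
  have inj: "inj_on ((!) xs) X" if "X \<subseteq> {..<a}" for X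
    using that len(1,3) by (intro inj_on_nth) auto
  \<comment> \<open>An entry of \<open>xs\<close> is kept out of a pattern class by irreflexivity if
    it should be a neighbour, and by the closed neighbourhood otherwise.\<close>
  have disj: "ys ! j \<noteq> xs ! i" if "j < b" "i < a" for i j
    using ys(2)[OF that(1)] that(2) by (cases "i \<in> L j") (auto simp: pattern_class_def cnbr_def)
  have "rich_pair k (set xs) (set ys)"
    unfolding rich_pair_def
  proof (intro conjI ballI)
    show "set xs \<subseteq> V" using len assms(3) by auto
    have "set ys \<subseteq> Q" using ys(1,2) by (auto simp: in_set_conv_nth pattern_class_def)
    then show "set ys \<subseteq> V" using assms(4) by auto
    show "set xs \<inter> set ys = {}"
      using disj len(1) ys(1) by (auto simp: in_set_conv_nth)
    show "set ys \<noteq> {}" using ys(1) assms(11,12) by auto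
    show "card (set xs) \<le> card (set ys)"
      using len(1,3) ys(1,3) assms(12) by (simp add: distinct_card)
    fix v assume "v \<in> set ys"
    then obtain j where j: "j < b" "v = ys ! j" using ys(1) by (auto simp: in_set_conv_nth)
    then show "k \<le> card (nbr v \<inter> set xs)"
      using adj[OF j(1)] L(1,2)[OF j(1)] by (simp add: card_image inj)
  qed (use len ys in auto)
  moreover have "linear_pair (set xs) (set ys)"
    unfolding linear_pair_def
  proof (intro ballI impI)
    fix u v assume "u \<in> set ys" "v \<in> set ys" "u \<noteq> v"
    then obtain j j' where j: "j < b" "u = ys ! j" "j' < b" "v = ys ! j'" "j \<noteq> j'"
      using ys(1) by (auto simp: in_set_conv_nth)
    have "nbr u \<inter> nbr v \<inter> set xs = ((!) xs ` L j) \<inter> ((!) xs ` L j')"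
      using adj[OF j(1)] adj[OF j(3)] j by auto
    also have "\<dots> = (!) xs ` (L j \<inter> L j')"
      using inj_on_image_Int[OF inj[of "{..<a}"], of "L j" "L j'"] L(1) j by auto
    finally have "card (nbr u \<inter> nbr v \<inter> set xs) = card (L j \<inter> L j')"
      using inj[of "L j \<inter> L j'"] L(1)[OF j(1)] by (metis card_image inf.coboundedI1)
    then show "card (nbr u \<inter> nbr v \<inter> set xs) \<le> 1" using L(3) j by simp
  qed
  ultimately show ?thesis by blast
qed

end

text \<open>The contrapositive of the embedding, for affine planes. The order of quantifiers
  matters: \<open>A\<close> is determined by \<open>k\<close> before the graph, \<open>s\<close>,
  \<open>\<delta>\<close> and \<open>N\<close> are given, and later enters the exponent of the final
  bound.\<close>

lemma dense_pair_bound: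
  fixes k :: nat
  obtains A :: nat where
    "\<And>V E s P Q \<delta> N. ugraph V E \<Longrightarrow> ugraph.biclique_free E s \<Longrightarrow> 1 \<le> s \<Longrightarrow>
      \<nexists>S T. ugraph.rich_pair V E k S T \<and> ugraph.linear_pair E S T \<Longrightarrow>
      P \<subseteq> V \<Longrightarrow> Q \<subseteq> V \<Longrightarrow> real (card P) \<le> N \<Longrightarrow> real (card Q) \<le> N \<Longrightarrow> 0 < \<delta> \<Longrightarrow> \<delta> \<le> 1 \<Longrightarrow>
      (4 * real s / \<delta>) ^ A \<le> N \<Longrightarrow> real (\<Sum>z\<in>Q. card (ugraph.nbr E z \<inter> P)) \<le> \<delta> * N\<^sup>2"
proof -
  obtain a :: nat and L :: "nat \<Rightarrow> nat set" where aL: "0 < a" "\<And>j. L j \<subseteq> {..<a}" "\<And>j. k \<le> card (L j)"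
    "\<And>j j'. j < a \<Longrightarrow> j' < a \<Longrightarrow> j \<noteq> j' \<Longrightarrow> card (L j \<inter> L j') \<le> 1"
    using affine_plane_lines[of k] by blast
  show thesis
  proof (rule that[of "(a + 1)\<^sup>2 + 2 * a + 2 * a + 3"])
    fix V :: "'a set" and E s P Q and \<delta> N :: real
    assume G: "ugraph V E" and *: "ugraph.biclique_free E s" "1 \<le> s"
      "\<nexists>S T. ugraph.rich_pair V E k S T \<and> ugraph.linear_pair E S T"
      "P \<subseteq> V" "Q \<subseteq> V" "real (card P) \<le> N" "real (card Q) \<le> N" "0 < \<delta>" "\<delta> \<le> 1"
      "(4 * real s / \<delta>) ^ ((a + 1)\<^sup>2 + 2 * a + 2 * a + 3) \<le> N"
    interpret ugraph V E by (rule G)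
    show "real (\<Sum>z\<in>Q. card (nbr z \<inter> P)) \<le> \<delta> * N\<^sup>2"
    proof (rule ccontr)
      assume "\<not> ?thesis"
      then have "\<delta> * N\<^sup>2 \<le> real (\<Sum>z\<in>Q. card (nbr z \<inter> P))" by simp
      then have "\<exists>S T. rich_pair k S T \<and> linear_pair S T"
        using * aL by (intro pattern_embedding[where a = a and b = a and L = L]) auto
      with *(3) show False by blast
    qed
  qed
qed


section \<open>Pairs of comparable degrees\<close>

lemma card_subsets_containing:
  assumes "finite N" "F \<subseteq> N" "card F \<le> k"
  shows "card {M. F \<subseteq> M \<and> M \<subseteq> N \<and> card M = k} = (card N - card F) choose (k - card F)"
proof -
  have finF: "finite F" using assms finite_subset by auto
  have "bij_betw (\<lambda>M. M - F) {M. F \<subseteq> M \<and> M \<subseteq> N \<and> card M = k} {M. M \<subseteq> N - F \<and> card M = k - card F}"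
  proof (rule bij_betw_byWitness[where f' = "\<lambda>M. M \<union> F"])
    show "(\<lambda>M. M - F) ` {M. F \<subseteq> M \<and> M \<subseteq> N \<and> card M = k} \<subseteq> {M. M \<subseteq> N - F \<and> card M = k - card F}"
      using finF by (auto simp: card_Diff_subset)
    show "(\<lambda>M. M \<union> F) ` {M. M \<subseteq> N - F \<and> card M = k - card F} \<subseteq> {M. F \<subseteq> M \<and> M \<subseteq> N \<and> card M = k}"
    proof clarify
      fix M assume M: "M \<subseteq> N - F" "card M = k - card F"
      then have "finite M" using assms(1) by (auto dest: finite_subset)
      moreover have "M \<inter> F = {}" using M by auto
      ultimately have "card (M \<union> F) = k" using M assms(3) finF by (simp add: card_Un_disjoint)
      then show "F \<subseteq> M \<union> F \<and> M \<union> F \<subseteq> N \<and> card (M \<union> F) = k" using M assms(2) by auto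
    qed
  qed auto
  then have "card {M. F \<subseteq> M \<and> M \<subseteq> N \<and> card M = k} = card {M. M \<subseteq> N - F \<and> card M = k - card F}"
    by (rule bij_betw_same_card)
  also have "\<dots> = card (N - F) choose (k - card F)" using assms(1) by (simp add: n_subsets)
  finally show ?thesis using assms finF by (simp add: card_Diff_subset)
qed

text \<open>A random \<open>k\<close>-subset contains two given elements with probability
  \<open>k * (k - 1) / (n * (n - 1))\<close>; the factor 2 comes from
  \<open>n / 2 \<le> n - 1\<close>.\<close>

lemma binomial_minus_two_le:
  assumes "2 \<le> k" "k \<le> n"
  shows "real ((n - 2) choose (k - 2)) \<le> 2 * (real k)\<^sup>2 / (real n)\<^sup>2 * real (n choose k)"
proof -
  have "k * (n choose k) = n * ((n - 1) choose (k - 1))"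
    using assms binomial_absorption[of "k - 1" n] by (simp add: numeral_2_eq_2)
  moreover have "(k - 1) * ((n - 1) choose (k - 1)) = (n - 1) * ((n - 2) choose (k - 2))"
    using assms binomial_absorption[of "k - 2" "n - 1"] by (simp add: numeral_2_eq_2 Suc_diff_Suc)
  ultimately have "(k - 1) * (k * (n choose k)) = n * ((n - 1) * ((n - 2) choose (k - 2)))"
    by (simp add: mult.left_commute)
  then have "real ((k - 1) * (k * (n choose k))) = real (n * ((n - 1) * ((n - 2) choose (k - 2))))" by simp
  then have eq: "(real k - 1) * real k * real (n choose k) = real n * (real n - 1) * real ((n - 2) choose (k - 2))"
    using assms by (simp add: of_nat_diff mult.assoc)
  have n: "2 \<le> real n" using assms by linarith
  have "(real n)\<^sup>2 / 2 * real ((n - 2) choose (k - 2)) \<le> real n * (real n - 1) * real ((n - 2) choose (k - 2))"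
    using n by (intro mult_right_mono) (auto simp: power2_eq_square field_simps)
  also have "\<dots> = (real k - 1) * real k * real (n choose k)" using eq by simp
  also have "\<dots> \<le> (real k)\<^sup>2 * real (n choose k)"
    by (intro mult_right_mono) (auto simp: power2_eq_square algebra_simps)
  finally have "(real n)\<^sup>2 * real ((n - 2) choose (k - 2)) \<le> 2 * (real k)\<^sup>2 * real (n choose k)" by simp
  moreover have "0 < (real n)\<^sup>2" using n by simp
  ultimately show ?thesis by (simp add: pos_le_divide_eq mult.commute)
qed

section \<open>Independent sets inside neighbourhoods and random sets\<close>

context ugraph
begin

text \<open>Union bound: a random \<open>k\<close>-subset contains a given edge with probability at
  most \<open>2 * k\<^sup>2 / n\<^sup>2\<close>, so \<open>sparse\<close> makes the expected number
  of ordered edges inside it at most 1/2.\<close>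

lemma card_indep_subsets_ge:
  fixes n :: nat and N :: "'a set"
  defines "n \<equiv> card N"
  assumes "finite N" "2 \<le> k" "k \<le> n"
    and sparse: "4 * (real k)\<^sup>2 * real (\<Sum>v\<in>N. card (nbr v \<inter> N)) \<le> (real n)\<^sup>2"
  shows "real (n choose k) / 2 \<le> card {M. M \<subseteq> N \<and> card M = k \<and> indep M}"
proof -
  let ?All = "{M. M \<subseteq> N \<and> card M = k}"
  let ?P = "{(u, v). u \<in> N \<and> v \<in> N \<and> E u v}"
  let ?Bad = "\<Union>p\<in>?P. {M. {fst p, snd p} \<subseteq> M \<and> M \<subseteq> N \<and> card M = k}"
  have finP: "finite ?P" by (rule finite_subset[of _ "N \<times> N"]) (use assms in auto)
  have finAll: "finite ?All" using assms(2) by simp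
  have "?All \<subseteq> {M. M \<subseteq> N \<and> card M = k \<and> indep M} \<union> ?Bad"
    by (fastforce simp: indep_def)
  then have "card ?All \<le> card ({M. M \<subseteq> N \<and> card M = k \<and> indep M} \<union> ?Bad)"
    using finAll finP assms(2) by (intro card_mono) auto
  also have "\<dots> \<le> card {M. M \<subseteq> N \<and> card M = k \<and> indep M} + card ?Bad" by (rule card_Un_le)
  finally have 1: "card ?All \<le> card {M. M \<subseteq> N \<and> card M = k \<and> indep M} + card ?Bad" .
  have "card ?Bad \<le> (\<Sum>p\<in>?P. card {M. {fst p, snd p} \<subseteq> M \<and> M \<subseteq> N \<and> card M = k})"
    using finP by (rule card_UN_le)
  also have "\<dots> = (\<Sum>p\<in>?P. (n - 2) choose (k - 2))"
  proof (intro sum.cong refl)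
    fix p assume p: "p \<in> ?P"
    then have "card {fst p, snd p} = 2" using E_irrefl by (auto simp: card_insert_if)
    then show "card {M. {fst p, snd p} \<subseteq> M \<and> M \<subseteq> N \<and> card M = k} = (n - 2) choose (k - 2)"
      using p card_subsets_containing[OF assms(2), of "{fst p, snd p}" k] assms(3) by (auto simp: n_def)
  qed
  also have "\<dots> = (\<Sum>v\<in>N. card (nbr v \<inter> N)) * ((n - 2) choose (k - 2))"
    using assms(2) by (simp add: card_ordered_edges)
  finally have "real (card ?Bad) \<le> real ((\<Sum>v\<in>N. card (nbr v \<inter> N)) * ((n - 2) choose (k - 2)))"
    by (rule of_nat_mono)
  also have "\<dots> = real (\<Sum>v\<in>N. card (nbr v \<inter> N)) * real ((n - 2) choose (k - 2))"
    by (rule of_nat_mult)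
  also have "\<dots> \<le> real (\<Sum>v\<in>N. card (nbr v \<inter> N)) * (2 * (real k)\<^sup>2 / (real n)\<^sup>2 * real (n choose k))"
    using assms(3,4) by (intro mult_left_mono binomial_minus_two_le of_nat_0_le_iff)
  also have "\<dots> = (4 * (real k)\<^sup>2 * real (\<Sum>v\<in>N. card (nbr v \<inter> N))) / (real n)\<^sup>2 * (real (n choose k) / 2)"
    by simp
  also have "\<dots> \<le> 1 * (real (n choose k) / 2)"
  proof (rule mult_right_mono)
    have "0 < (real n)\<^sup>2" using assms(3,4) by simp
    then show "4 * (real k)\<^sup>2 * real (\<Sum>v\<in>N. card (nbr v \<inter> N)) / (real n)\<^sup>2 \<le> 1"
      using sparse by (simp only: pos_divide_le_eq mult_1)
  qed simp
  finally have "real (card ?Bad) \<le> real (n choose k) / 2" by simp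
  moreover have "card ?All = n choose k" using assms(2) by (simp add: n_subsets n_def)
  ultimately show ?thesis using 1 by linarith
qed

text \<open>
  For an orientation with bounded out-neighbourhoods \<open>low\<close>, the sinks of a random set are independent, and
  a vertex stays a sink with good probability even if its degree is unbounded.
\<close>

definition sinks :: "('a \<Rightarrow> 'a set) \<Rightarrow> 'a set \<Rightarrow> 'a set" where
  "sinks low S = {x\<in>S. S \<inter> low x = {}}"

lemma indep_sinks:
  assumes "\<And>u v. E u v \<Longrightarrow> u \<in> low v \<or> v \<in> low u"
  shows "indep (sinks low S)"
  using assms by (fastforce simp: indep_def sinks_def)

text \<open>For each \<open>M\<close> in \<open>\<M>\<close>, the event that \<open>S\<close>
  contains \<open>M\<close> and avoids \<open>F M\<close> has probability at least
  \<open>q ^ k / 2\<close>, by Bernoulli's inequality and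
  \<open>card (F M) \<le> card N + k * D\<close>. It makes every element of \<open>M\<close> a sink:
  \<open>low x\<close> does not meet the independent set \<open>M\<close>, and the rest of
  \<open>low x\<close> is avoided.\<close>

lemma mean_independent_in_sinks_ge:
  fixes q D :: real
  assumes "finite A" "0 \<le> q" "q \<le> 1" "0 < k"
    and low: "\<And>v. low v \<subseteq> nbr v" "\<And>v. v \<in> A \<Longrightarrow> card (low v) \<le> D"
    and N: "N \<subseteq> A" "q * (card N + k * D) \<le> 1/2"
    and \<M>: "\<M> \<subseteq> {M. M \<subseteq> N \<and> card M = k \<and> indep M}"
  shows "card \<M> * q ^ k / 2 \<le> subset_mean q A (\<lambda>S. of_bool (k \<le> card (N \<inter> sinks low S)))"
proof -
  \<comment> \<open>Forbidding the rest of \<open>N\<close> forces \<open>S \<inter> N = M\<close>.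
    The events for different \<open>M\<close> are thus disjoint and their probabilities add
    up.\<close>
  define F where "F = (\<lambda>M. ((N \<union> (\<Union>x\<in>M. low x)) \<inter> A) - M)"
  have finN: "finite N" using assms(1) N(1) finite_subset by auto
  have fin\<M>: "finite \<M>" by (rule finite_subset[OF \<M>]) (use finN in auto)
  have each: "q ^ k / 2 \<le> subset_mean q A (\<lambda>S. of_bool (M \<subseteq> S \<and> S \<inter> F M = {}))" if "M \<in> \<M>" for M
  proof -
    have M: "M \<subseteq> N" "card M = k" using that \<M> by auto
    have fin: "finite M" "finite (F M)" using M finN assms(1) finite_subset by (auto simp: F_def)
    have finl: "finite (low x)" for x using low(1) fin_nbr finite_subset by metis
    have "card (F M) \<le> card (N \<union> (\<Union>x\<in>M. low x))"
      unfolding F_def using finN fin finl by (intro card_mono) auto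
    also have "\<dots> \<le> card N + (\<Sum>x\<in>M. card (low x))"
      using card_Un_le[of N "\<Union>x\<in>M. low x"] card_UN_le[OF fin(1), of low] by linarith
    finally have "real (card (F M)) \<le> card N + (\<Sum>x\<in>M. real (card (low x)))" by (simp flip: of_nat_sum)
    also have "\<dots> \<le> card N + (\<Sum>x\<in>M. D)"
      using M N(1) by (intro add_left_mono sum_mono low(2)) auto
    finally have "real (card (F M)) \<le> card N + k * D" using M by simp
    then have "q * card (F M) \<le> q * (card N + k * D)" using assms(2) by (rule mult_left_mono)
    then have "1/2 \<le> 1 - card (F M) * q" using N(2) by (simp add: mult.commute)
    also have "\<dots> \<le> (1 - q) ^ card (F M)"
      using Bernoulli_inequality[of "-q" "card (F M)"] assms(3) by simp
    finally have "q ^ k * (1/2) \<le> q ^ k * (1 - q) ^ card (F M)"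
      using assms(2) by (intro mult_left_mono) auto
    also have "\<dots> = subset_mean q A (\<lambda>S. of_bool (M \<subseteq> S \<and> S \<inter> F M = {}))"
      using M N(1) by (subst subset_mean_indicator[OF assms(1)]) (auto simp: F_def)
    finally show ?thesis by simp
  qed
  have "card \<M> * q ^ k / 2 = (\<Sum>M\<in>\<M>. q ^ k / 2)" by simp
  also have "\<dots> \<le> (\<Sum>M\<in>\<M>. subset_mean q A (\<lambda>S. of_bool (M \<subseteq> S \<and> S \<inter> F M = {})))"
    using each by (rule sum_mono)
  also have "\<dots> = subset_mean q A (\<lambda>S. \<Sum>M\<in>\<M>. of_bool (M \<subseteq> S \<and> S \<inter> F M = {}))"
    by (rule subset_mean_sum[symmetric])
  also have "\<dots> \<le> subset_mean q A (\<lambda>S. of_bool (k \<le> card (N \<inter> sinks low S)))"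
  proof (rule subset_mean_mono[OF assms(2,3)])
    fix S assume S: "S \<subseteq> A"
    have uniq: "M = S \<inter> N" if "M \<in> \<M>" "M \<subseteq> S \<and> S \<inter> F M = {}" for M
      using that \<M> S by (auto simp: F_def)
    show "(\<Sum>M\<in>\<M>. of_bool (M \<subseteq> S \<and> S \<inter> F M = {})) \<le> (of_bool (k \<le> card (N \<inter> sinks low S)) :: real)"
    proof (cases "\<exists>M\<in>\<M>. M \<subseteq> S \<and> S \<inter> F M = {}")
      case True
      then obtain M where M: "M \<in> \<M>" "M \<subseteq> S \<and> S \<inter> F M = {}" by blast
      have "S \<inter> low x = {}" if x: "x \<in> M" for x
      proof -
        have "indep M" using \<M> M(1) by auto
        then have "M \<inter> low x = {}" using x low(1)[of x] by (auto simp: indep_def nbr_def)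
        moreover have "S \<inter> low x \<subseteq> M" using M(2) x S by (auto simp: F_def)
        ultimately show ?thesis by auto
      qed
      then have "M \<subseteq> N \<inter> sinks low S" using M \<M> by (auto simp: sinks_def)
      moreover have "card M = k" using M \<M> by auto
      ultimately have "k \<le> card (N \<inter> sinks low S)" using finN card_mono by (metis finite_Int)
      moreover have "(\<Sum>M\<in>\<M>. of_bool (M \<subseteq> S \<and> S \<inter> F M = {})) \<le> (\<Sum>M\<in>\<M>. of_bool (M = S \<inter> N) :: real)"
        using uniq by (intro sum_mono) auto
      moreover have "(\<Sum>M\<in>\<M>. of_bool (M = S \<inter> N) :: real) \<le> 1"
        using fin\<M> by (simp add: sum.If_cases of_bool_def)
      ultimately show ?thesis by simp
    next
      case False
      then have "(\<Sum>M\<in>\<M>. of_bool (M \<subseteq> S \<and> S \<inter> F M = {})) = (0::real)" by (intro sum.neutral) auto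
      then show ?thesis by simp
    qed
  qed
  finally show ?thesis .
qed

end

text \<open>Union bound by cases. Two chosen common vertices cost
  \<open>q\<^sup>2 * \<theta> ^ (k - 2)\<close> for each of at most
  \<open>card (N1 \<inter> N2) * \<kappa>\<close> ordered pairs, where richness of one side is
  enough. For an adjacent pair, either no common vertex is chosen and the two richness events live
  on disjoint sets, or one of at most \<open>\<kappa>\<close> common vertices is chosen at cost
  \<open>q * \<theta> ^ (k - 1)\<close>.\<close>

lemma mean_conflict_le:
  fixes q \<theta> \<kappa> :: real
  assumes "finite A" "N1 \<subseteq> A" "N2 \<subseteq> A" "0 \<le> q" "q \<le> 1" "2 \<le> k"
    and \<theta>: "card N1 * q \<le> \<theta>" "card N2 * q \<le> \<theta>"
    and small: "card (N1 \<inter> N2) \<le> \<kappa>"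
  shows "subset_mean q A (\<lambda>S. of_bool (k \<le> card (N1 \<inter> S) \<and> k \<le> card (N2 \<inter> S) \<and>
      (adjacent \<or> 2 \<le> card (N1 \<inter> N2 \<inter> S))))
    \<le> of_bool adjacent * (\<theta> ^ (2 * k) + \<kappa> * q * \<theta> ^ (k - 1)) + card (N1 \<inter> N2) * \<kappa> * q\<^sup>2 * \<theta> ^ (k - 2)"
proof -
  let ?I = "N1 \<inter> N2"
  have fin: "finite N1" "finite N2" "finite ?I" using assms(1-3) by (auto dest: finite_subset)
  have \<theta>0: "0 \<le> \<theta>" using \<theta>(1) assms(4) by (meson order_trans mult_nonneg_nonneg of_nat_0_le_iff)
  have up: "subset_mean q A (\<lambda>S. of_bool (F \<subseteq> S \<and> k \<le> card (N1 \<inter> S))) \<le> q ^ card F * \<theta> ^ (k - card F)"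
    if F: "F \<subseteq> ?I" "card F \<le> 2" for F
  proof -
    have "subset_mean q A (\<lambda>S. of_bool (F \<subseteq> S \<and> k \<le> card (N1 \<inter> S))) \<le> q ^ card F * (card N1 * q) ^ (k - card F)"
      using F assms by (intro subset_mean_many_le) auto
    also have "\<dots> \<le> q ^ card F * \<theta> ^ (k - card F)"
      using assms \<theta> by (intro mult_left_mono power_mono) auto
    finally show ?thesis .
  qed
  let ?f1 = "\<lambda>S. of_bool (k \<le> card ((N1 - ?I) \<inter> S) \<and> k \<le> card ((N2 - ?I) \<inter> S)) :: real"
  let ?f2 = "\<lambda>S. \<Sum>x\<in>?I. of_bool ({x} \<subseteq> S \<and> k \<le> card (N1 \<inter> S)) :: real"
  let ?f3 = "\<lambda>S. \<Sum>x\<in>?I. \<Sum>y\<in>?I - {x}. of_bool ({x, y} \<subseteq> S \<and> k \<le> card (N1 \<inter> S)) :: real"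
  have "subset_mean q A (\<lambda>S. of_bool (k \<le> card (N1 \<inter> S) \<and> k \<le> card (N2 \<inter> S) \<and>
      (adjacent \<or> 2 \<le> card (?I \<inter> S))))
    \<le> subset_mean q A (\<lambda>S. of_bool adjacent * (?f1 S + ?f2 S) + ?f3 S)"
  proof (rule subset_mean_mono[OF assms(4,5)])
    fix S assume "S \<subseteq> A"
    have of_bool_nonneg: "0 \<le> (of_bool b :: real)" for b by simp
    have nn: "0 \<le> ?f1 S" "0 \<le> ?f2 S" "0 \<le> ?f3 S" by (auto intro!: sum_nonneg)
    then have tot: "0 \<le> of_bool adjacent * (?f1 S + ?f2 S) + ?f3 S"
      by (intro add_nonneg_nonneg mult_nonneg_nonneg of_bool_nonneg)
    have le1: "of_bool b \<le> (1::real)" for b by simp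
    consider "\<not> (k \<le> card (N1 \<inter> S) \<and> k \<le> card (N2 \<inter> S) \<and> (adjacent \<or> 2 \<le> card (?I \<inter> S)))"
      | "k \<le> card (N1 \<inter> S)" "2 \<le> card (?I \<inter> S)"
      | "k \<le> card (N1 \<inter> S)" "k \<le> card (N2 \<inter> S)" adjacent "?I \<inter> S = {}"
      | x where "k \<le> card (N1 \<inter> S)" adjacent "x \<in> ?I \<inter> S" by blast
    then show "of_bool (k \<le> card (N1 \<inter> S) \<and> k \<le> card (N2 \<inter> S) \<and> (adjacent \<or> 2 \<le> card (?I \<inter> S)))
      \<le> of_bool adjacent * (?f1 S + ?f2 S) + ?f3 S"
    proof cases
      case 1
      then have "(k \<le> card (N1 \<inter> S) \<and> k \<le> card (N2 \<inter> S) \<and> (adjacent \<or> 2 \<le> card (?I \<inter> S))) = False"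
        by (rule Eq_FalseI[THEN meta_eq_to_obj_eq])
      then show ?thesis using tot by (simp only: of_bool_eq)
    next
      case 2
      obtain x y where xy: "x \<in> ?I \<inter> S" "y \<in> ?I \<inter> S" "x \<noteq> y"
        using 2(2) by (metis card_le_Suc0_iff_eq fin(3) finite_Int not_less_eq_eq numeral_2_eq_2)
      have "1 = (of_bool ({x, y} \<subseteq> S \<and> k \<le> card (N1 \<inter> S)) :: real)" using xy 2 by simp
      also have "\<dots> \<le> (\<Sum>y\<in>?I - {x}. of_bool ({x, y} \<subseteq> S \<and> k \<le> card (N1 \<inter> S)))"
        using xy fin by (intro member_le_sum) auto
      also have "\<dots> \<le> ?f3 S"
        using xy fin by (intro member_le_sum[where f = "\<lambda>x. \<Sum>y\<in>?I - {x}. of_bool ({x, y} \<subseteq> S \<and> k \<le> card (N1 \<inter> S))"])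
          (auto intro!: sum_nonneg)
      finally have "1 \<le> ?f3 S" .
      moreover have "0 \<le> of_bool adjacent * (?f1 S + ?f2 S)"
        using nn by (intro add_nonneg_nonneg mult_nonneg_nonneg of_bool_nonneg)
      ultimately show ?thesis using le1 order_trans by (smt (verit))
    next
      case 3
      then have "(N1 - ?I) \<inter> S = N1 \<inter> S" "(N2 - ?I) \<inter> S = N2 \<inter> S" by auto
      then have "?f1 S = 1" using 3 by simp
      moreover have "of_bool adjacent = (1::real)" using 3(3) by simp
      ultimately show ?thesis using nn le1 by (simp only: mult_1) (smt (verit))
    next
      case 4
      have "1 = (of_bool ({x} \<subseteq> S \<and> k \<le> card (N1 \<inter> S)) :: real)" using 4 by simp
      also have "\<dots> \<le> ?f2 S"
        using 4 fin by (intro member_le_sum) auto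
      finally have "1 \<le> ?f2 S" .
      moreover have "of_bool adjacent = (1::real)" using 4(2) by simp
      ultimately show ?thesis using nn le1 by (simp only: mult_1) (smt (verit))
    qed
  qed
  also have "\<dots> = of_bool adjacent * (subset_mean q A ?f1 + (\<Sum>x\<in>?I. subset_mean q A (\<lambda>S. of_bool ({x} \<subseteq> S \<and> k \<le> card (N1 \<inter> S)))))
     + (\<Sum>x\<in>?I. \<Sum>y\<in>?I - {x}. subset_mean q A (\<lambda>S. of_bool ({x, y} \<subseteq> S \<and> k \<le> card (N1 \<inter> S))))"
    by (simp only: subset_mean_add subset_mean_cmult subset_mean_sum)
  also have "\<dots> \<le> of_bool adjacent * (\<theta> ^ (2 * k) + (\<Sum>x\<in>?I. q * \<theta> ^ (k - 1))) + (\<Sum>x\<in>?I. \<Sum>y\<in>?I - {x}. q\<^sup>2 * \<theta> ^ (k - 2))"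
  proof (intro add_mono mult_left_mono sum_mono)
    have "subset_mean q A ?f1 \<le> (card (N1 - ?I) * q) ^ k * (card (N2 - ?I) * q) ^ k"
      using assms by (intro subset_mean_many_disjoint_le) auto
    also have "\<dots> \<le> \<theta> ^ k * \<theta> ^ k"
    proof (intro mult_mono power_mono)
      have "card (N1 - ?I) \<le> card N1" "card (N2 - ?I) \<le> card N2" using fin by (auto intro: card_mono)
      then have "card (N1 - ?I) * q \<le> card N1 * q" "card (N2 - ?I) * q \<le> card N2 * q"
        using assms(4) by (auto intro: mult_right_mono)
      then show "card (N1 - ?I) * q \<le> \<theta>" "card (N2 - ?I) * q \<le> \<theta>" using \<theta> by linarith+
    qed (use assms(4) \<theta>0 in auto)
    finally show "subset_mean q A ?f1 \<le> \<theta> ^ (2 * k)" by (simp add: mult_2 power_add)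
    show "subset_mean q A (\<lambda>S. of_bool ({x} \<subseteq> S \<and> k \<le> card (N1 \<inter> S))) \<le> q * \<theta> ^ (k - 1)"
      if "x \<in> ?I" for x using up[of "{x}"] that by simp
    show "subset_mean q A (\<lambda>S. of_bool ({x, y} \<subseteq> S \<and> k \<le> card (N1 \<inter> S))) \<le> q\<^sup>2 * \<theta> ^ (k - 2)"
      if "x \<in> ?I" "y \<in> ?I - {x}" for x y
    proof -
      have "card {x, y} = 2" using that by auto
      then show ?thesis using up[of "{x, y}"] that by simp
    qed
  qed simp
  also have "(\<Sum>x\<in>?I. q * \<theta> ^ (k - 1)) \<le> \<kappa> * (q * \<theta> ^ (k - 1))"
    using small assms(4) \<theta>0 by (simp add: mult_right_mono)
  also have "(\<Sum>x\<in>?I. \<Sum>y\<in>?I - {x}. q\<^sup>2 * \<theta> ^ (k - 2)) \<le> (\<Sum>x\<in>?I. \<kappa> * (q\<^sup>2 * \<theta> ^ (k - 2)))"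
  proof (rule sum_mono)
    fix x
    have "card (?I - {x}) \<le> card ?I" using fin by (intro card_mono) auto
    then have "real (card (?I - {x})) \<le> \<kappa>" using small by linarith
    then show "(\<Sum>y\<in>?I - {x}. q\<^sup>2 * \<theta> ^ (k - 2)) \<le> \<kappa> * (q\<^sup>2 * \<theta> ^ (k - 2))"
      using \<theta>0 by (simp only: sum_constant) (intro mult_right_mono; simp)
  qed
  also have "\<dots> = card ?I * \<kappa> * q\<^sup>2 * \<theta> ^ (k - 2)" by (simp add: mult.assoc)
  finally show ?thesis by (simp add: mult.assoc mult_left_mono)
qed


text \<open>Here \<open>a\<close> and \<open>b\<close> are the sizes of the two sides and
  \<open>\<pi>\<close> bounds from below the probability that a vertex is rich. The three terms of
  the conclusion stand for the rich vertices kept at rate \<open>\<sigma>\<close>, the surviving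
  conflicts, and the expected size of the random set.\<close>

lemma regular_pair_arith:
  fixes L D \<theta> a b \<Delta> :: real and k :: nat
  assumes k: "2 \<le> k" and L: "256 * real k ^ (2 * k) < L" and \<theta>: "\<theta> = 1 / L ^ (4 * k + 2)"
    and D: "L ^ ((4 * k + 2) * k) \<le> D" and ab: "0 < a" "0 < b" "a * \<Delta> \<le> D * L ^ 3 * b" "a \<le> L\<^sup>2 * b"
    and \<pi>: "\<pi> = (\<theta> / (L\<^sup>2 * k)) ^ k / 4"
  obtains \<sigma> where "0 \<le> \<sigma>" "\<sigma> \<le> 1"
    "0 < \<sigma> * (\<pi> * b) - \<sigma>\<^sup>2 * (b * \<theta> ^ (2 * k) * (3 * D + \<Delta> / L)) - \<theta> / (D * L) * a"
proof
  \<comment> \<open>With \<open>X\<close> from below as an upper bound for the conflicts, this is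
    \<open>\<pi> * b / (2 * X)\<close>, the maximiser of
    \<open>\<sigma> * (\<pi> * b) - \<sigma>\<^sup>2 * X\<close>.\<close>
  define \<sigma> where "\<sigma> = \<pi> * a / (8 * b * \<theta> ^ (2 * k) * D * L\<^sup>2)"
  have k1: "1 \<le> real k ^ (2 * k)" using k by (intro one_le_power) auto
  then have L1: "256 < L" using L by linarith
  have \<theta>0: "0 < \<theta>" using \<theta> L1 by simp
  have D0: "0 < D" using D L1 by (smt (verit) zero_less_power)
  have \<pi>0: "0 < \<pi>" 
    unfolding \<pi> using \<theta>0 L1 k by (intro divide_pos_pos zero_less_power mult_pos_pos) auto
  \<comment> \<open>This is the bound on \<open>D\<close> that makes \<open>\<sigma>\<close> a
    probability.\<close>
  have \<theta>D: "1 \<le> \<theta> ^ k * D"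
  proof -
    have "\<theta> ^ k = 1 / L ^ ((4 * k + 2) * k)" by (simp only: \<theta> power_one_over power_mult)
    then have "\<theta> ^ k * L ^ ((4 * k + 2) * k) = 1" using L1 by simp
    moreover have "\<theta> ^ k * L ^ ((4 * k + 2) * k) \<le> \<theta> ^ k * D" using D \<theta>0 by (intro mult_left_mono) auto
    ultimately show ?thesis by simp
  qed
  have t2: "\<theta> ^ (2 * k) = \<theta> ^ k * \<theta> ^ k" by (simp only: mult_2 power_add)
  show "0 \<le> \<sigma>" using \<pi>0 ab \<theta>0 D0 L1 by (simp add: \<sigma>_def)
  have "\<pi> * a \<le> \<theta> ^ k * (L\<^sup>2 * b)"
  proof (intro mult_mono ab)
    have "1 * 1 \<le> L\<^sup>2 * real k" using L1 k by (intro mult_mono) (auto simp: one_le_power)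
    then have "\<theta> / (L\<^sup>2 * k) \<le> \<theta>" using \<theta>0 by (simp add: divide_le_eq mult_le_cancel_left1)
    then have "(\<theta> / (L\<^sup>2 * k)) ^ k \<le> \<theta> ^ k" using \<theta>0 by (intro power_mono) auto
    moreover have "0 \<le> (\<theta> / (L\<^sup>2 * k)) ^ k" using \<theta>0 by simp
    ultimately show "\<pi> \<le> \<theta> ^ k" unfolding \<pi> by linarith
  qed (use \<theta>0 ab in auto)
  also have "\<dots> \<le> \<theta> ^ k * (L\<^sup>2 * b) * (\<theta> ^ k * D)"
    using mult_left_mono[OF \<theta>D, of "\<theta> ^ k * (L\<^sup>2 * b)"] \<theta>0 ab by simp
  also have "\<dots> = b * \<theta> ^ (2 * k) * D * L\<^sup>2" unfolding t2 by (simp only: mult_ac)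
  also have "\<dots> \<le> 8 * b * \<theta> ^ (2 * k) * D * L\<^sup>2" using ab \<theta>0 D0 by simp
  finally show "\<sigma> \<le> 1" using ab \<theta>0 D0 L1 by (simp add: \<sigma>_def)
  define X where "X = 4 * b\<^sup>2 * \<theta> ^ (2 * k) * D * L\<^sup>2 / a"
  have "a * (b * \<theta> ^ (2 * k) * (3 * D + \<Delta> / L)) = b * \<theta> ^ (2 * k) * (3 * D * a + a * \<Delta> / L)"
    by (simp add: algebra_simps)
  also have "\<dots> \<le> b * \<theta> ^ (2 * k) * (3 * D * (L\<^sup>2 * b) + D * L\<^sup>2 * b)"
  proof (intro mult_left_mono add_mono)
    have "a * \<Delta> / L \<le> D * L ^ 3 * b / L" using ab L1 by (intro divide_right_mono) auto
    also have "\<dots> = D * L\<^sup>2 * b" using L1 by (simp add: power3_eq_cube power2_eq_square)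
    finally show "a * \<Delta> / L \<le> D * L\<^sup>2 * b" .
  qed (use ab \<theta>0 D0 in auto)
  also have "\<dots> = a * X" using ab by (simp add: X_def power2_eq_square algebra_simps)
  finally have E: "b * \<theta> ^ (2 * k) * (3 * D + \<Delta> / L) \<le> X" using ab by simp
  have "\<sigma> * X = \<pi> * b / 2" using ab \<theta>0 D0 L1 by (simp add: \<sigma>_def X_def power2_eq_square field_simps)
  then have "\<sigma>\<^sup>2 * X = \<sigma> * (\<pi> * b) / 2" by (simp add: power2_eq_square mult.assoc)
  then have 1: "\<sigma> * (\<pi> * b) / 2 \<le> \<sigma> * (\<pi> * b) - \<sigma>\<^sup>2 * (b * \<theta> ^ (2 * k) * (3 * D + \<Delta> / L))"
    using mult_left_mono[OF E zero_le_power2[of \<sigma>]] by linarith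
  have 2: "\<sigma> * (\<pi> * b) / 2 = \<pi>\<^sup>2 / \<theta> ^ (2 * k) / (16 * L) * (a / (D * L))"
    using ab \<theta>0 D0 L1 by (simp add: \<sigma>_def power2_eq_square field_simps)
  \<comment> \<open>All powers of \<open>\<theta>\<close> cancel, so the yield does not shrink with
    \<open>\<theta>\<close>. The exponent \<open>4 * k + 2\<close> in \<open>\<theta>\<close>
    consists of \<open>4 * k\<close> from this quotient, 1 for the factor \<open>L\<close> in
    \<open>16 * L\<close>, and 1 to absorb the constant \<open>256 * k ^ (2 * k)\<close>.\<close>
  have "\<pi>\<^sup>2 / \<theta> ^ (2 * k) = 1 / (16 * (L ^ (4 * k) * real k ^ (2 * k)))"
    using \<theta>0 L1 k by (simp add: \<pi> power_divide power_mult_distrib flip: power_mult) (simp add: mult_ac power2_eq_square)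
  moreover have "\<theta> < 1 / (16 * (L ^ (4 * k) * real k ^ (2 * k))) / (16 * L)"
  proof -
    have "256 * real k ^ (2 * k) * L ^ (4 * k + 1) < L * L ^ (4 * k + 1)"
      using L L1 by (intro mult_strict_right_mono) auto
    then show ?thesis using L1 k by (simp add: \<theta> field_simps)
  qed
  ultimately have "\<theta> < \<pi>\<^sup>2 / \<theta> ^ (2 * k) / (16 * L)" by simp
  then have "\<theta> * (a / (D * L)) < \<pi>\<^sup>2 / \<theta> ^ (2 * k) / (16 * L) * (a / (D * L))"
    using ab D0 L1 by (intro mult_strict_right_mono) auto
  then show "0 < \<sigma> * (\<pi> * b) - \<sigma>\<^sup>2 * (b * \<theta> ^ (2 * k) * (3 * D + \<Delta> / L)) - \<theta> / (D * L) * a"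
    using 1 2 by simp
qed

section \<open>The regular case\<close>

context ugraph
begin

text \<open>Rich vertices, conflicts and the size of \<open>S\<close> are combined into one function
  of \<open>S\<close>, so that one choice of \<open>S\<close> serves for all three. Conflicts are
  bounded in three groups: pairs with more than \<open>\<kappa>\<close> common neighbours in
  \<open>A\<close>, adjacent pairs, and pairs with two chosen common neighbours.\<close>

lemma regular_pair:
  fixes D L \<Delta> :: real and k :: nat
  defines "g \<equiv> (4 * k + 2) * k"
  assumes k: "2 \<le> k" and L: "256 * real k ^ (2 * k) < L" and D: "L ^ (g + 1) \<le> D"
    and dens: "\<And>W. W \<subseteq> V \<Longrightarrow> real (\<Sum>v\<in>W. card (nbr v \<inter> W)) \<le> D * card W"
    and sparse: "\<And>P Q. P \<subseteq> V \<Longrightarrow> Q \<subseteq> V \<Longrightarrow> card P \<le> D * L \<Longrightarrow> card Q \<le> D * L \<Longrightarrow>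
      real (\<Sum>z\<in>Q. card (nbr z \<inter> P)) \<le> (D / L ^ g)\<^sup>2"
    and AB: "A \<subseteq> V" "B \<subseteq> V" "B \<noteq> {}"
    and lowB: "\<And>b. b \<in> B \<Longrightarrow> D / L \<le> card (nbr b \<inter> A)"
    and upB: "\<And>b. b \<in> B \<Longrightarrow> card (nbr b) \<le> D * L"
    and upA: "\<And>a. a \<in> A \<Longrightarrow> card (nbr a \<inter> B) \<le> \<Delta>"
    and card_AB: "card A * \<Delta> \<le> D * L ^ 3 * card B" "card A \<le> L\<^sup>2 * card B"
  shows "\<exists>S T. rich_pair k S T \<and> linear_pair S T"
proof -
  have k1: "1 \<le> real k ^ (2 * k)" using k by (intro one_le_power) auto
  then have L1: "256 < L" using L by linarith
  have L_ge: "L \<le> L ^ n" if "0 < n" for n using L1 that by (intro self_le_power) auto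
  have k_le: "4 * (real k)\<^sup>2 \<le> L" "real k \<le> L"
  proof -
    have k2: "(real k)\<^sup>2 \<le> real k ^ (2 * k)" using k by (intro power_increasing) auto
    then show "4 * (real k)\<^sup>2 \<le> L" using L k1 by linarith
    have "real k \<le> (real k)\<^sup>2" using k by (intro self_le_power) auto
    then show "real k \<le> L" using k2 L k1 by linarith
  qed
  define \<theta> where "\<theta> = 1 / L ^ (4 * k + 2)"
  define q where "q = \<theta> / (D * L)"
  \<comment> \<open>The square root of the bound in \<open>sparse\<close>, so that a vertex has at
    most \<open>\<kappa>\<close> partners with which it shares more than \<open>\<kappa>\<close>
    neighbours. It equals \<open>D * \<theta> ^ k\<close>, which lets even the trivial bound
    \<open>\<theta> ^ k\<close> for these partners contribute only
    \<open>D * \<theta> ^ (2 * k)\<close>.\<close>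
  define \<kappa> where "\<kappa> = D / L ^ g"
  \<comment> \<open>This is \<open>(D / L / k) ^ k * q ^ k\<close> with one factor 1/2 for the
    restriction to independent sets and another one for being sinks.\<close>
  define \<pi> where "\<pi> = (\<theta> / (L\<^sup>2 * k)) ^ k / 4"
  have g: "2 \<le> g" using k by (simp add: g_def)
  have Lg: "L ^ g \<le> D" using D L1 power_increasing[of g "g + 1" L] by linarith
  have D1: "256 < D" using Lg L_ge[of g] g L1 by linarith
  have \<kappa>L: "L \<le> \<kappa>" using D L1 by (simp add: \<kappa>_def le_divide_eq)
  have \<kappa>D: "\<kappa> \<le> D" using D1 L1 by (simp add: \<kappa>_def divide_le_eq mult_le_cancel_left1 one_le_power)
  have "\<theta> ^ k = 1 / L ^ g" by (simp only: \<theta>_def g_def power_one_over power_mult)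
  then have \<theta>k: "\<kappa> = D * \<theta> ^ k" by (simp add: \<kappa>_def)
  have t2: "\<theta> ^ (2 * k) = \<theta> ^ k * \<theta> ^ k" by (simp only: mult_2 power_add)
  have \<theta>0: "0 < \<theta>" "\<theta> \<le> 1 / 4"
  proof -
    show "0 < \<theta>" using L1 by (simp add: \<theta>_def)
    have "4 \<le> L ^ (4 * k + 2)" using L_ge[of "4 * k + 2"] L1 by linarith
    then show "\<theta> \<le> 1 / 4" unfolding \<theta>_def by (intro divide_left_mono) auto
  qed
  have DL0: "0 < D * L" using D1 L1 by simp
  have q0: "0 < q" using \<theta>0 D1 L1 by (simp add: q_def)
  have qDL: "q * (D * L) = \<theta>" using D1 L1 by (simp add: q_def)
  have DDL: "D \<le> D * L" using D1 L1 mult_left_mono[of 1 L D] by simp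
  then have DDL1: "1 \<le> D * L" using D1 by linarith
  have q1: "q \<le> 1"
  proof -
    have "\<theta> \<le> 1 * (D * L)" using \<theta>0 DDL1 by linarith
    then show ?thesis using DL0 by (simp only: q_def pos_divide_le_eq)
  qed
  have finA: "finite A" and finB: "finite B" using AB finV finite_subset by auto
  define N where "N = (\<lambda>b. nbr b \<inter> A)"
  have NA: "N b \<subseteq> A" and NV: "N b \<subseteq> V" and finN: "finite (N b)" for b
    using AB(1) by (auto simp: N_def)
  have cardN: "card (N b) \<le> D * L" if "b \<in> B" for b
  proof -
    have "card (N b) \<le> card (nbr b)" unfolding N_def by (intro card_mono) auto
    then show ?thesis using upB[OF that] by linarith
  qed
  have \<theta>N: "card (N b) * q \<le> \<theta>" if "b \<in> B" for b
    using mult_right_mono[OF cardN[OF that], of q] q0 qDL by (simp add: mult.commute)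
  obtain low where low: "\<And>v. low v \<subseteq> nbr v" "\<And>v. v \<in> V \<Longrightarrow> card (low v) \<le> D"
    "\<And>u v. E u v \<Longrightarrow> u \<in> low v \<or> v \<in> low u"
    using orientation[OF dens] by blast
  have mean_rich: "\<pi> \<le> subset_mean q A (\<lambda>S. of_bool (k \<le> card (N b \<inter> sinks low S)))" if b: "b \<in> B" for b
  proof -
    let ?n = "card (N b)"
    let ?\<M> = "{M. M \<subseteq> N b \<and> card M = k \<and> indep M}"
    have n: "D / L \<le> ?n" using lowB[OF b] by (simp add: N_def)
    have "L ^ g * L \<le> D" using D by (simp add: mult.commute)
    then have "L ^ g \<le> D / L" using L1 by (simp add: le_divide_eq)
    then have "real k \<le> ?n" using n k_le L_ge[of g] g by linarith
    then have kn: "k \<le> ?n" by simp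
    have "real (\<Sum>v\<in>N b. card (nbr v \<inter> N b)) \<le> (D / L ^ g)\<^sup>2"
      using NV cardN[OF b] by (intro sparse) auto
    then have "4 * (real k)\<^sup>2 * real (\<Sum>v\<in>N b. card (nbr v \<inter> N b)) \<le> L * (D / L ^ g)\<^sup>2"
      using k_le(1) L1 by (intro mult_mono of_nat_0_le_iff) auto
    also have "\<dots> \<le> (D / L)\<^sup>2"
    proof -
      have "L ^ 3 \<le> L ^ (g * 2)" using g L1 by (intro power_increasing) auto
      then have "D\<^sup>2 * L ^ 3 \<le> D\<^sup>2 * L ^ (g * 2)" by (intro mult_left_mono) auto
      then have "D\<^sup>2 * L ^ 3 \<le> D\<^sup>2 * (L ^ g * L ^ g)" by (simp only: power_add[symmetric] mult_2_right)
      then show ?thesis using L1 by (simp add: power_divide field_simps power2_eq_square power3_eq_cube)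
    qed
    also have "\<dots> \<le> (real ?n)\<^sup>2" using n D1 L1 by (intro power_mono) auto
    finally have "real (?n choose k) / 2 \<le> card ?\<M>"
      using kn k finN by (intro card_indep_subsets_ge) auto
    moreover have "(real ?n / k) ^ k \<le> real (?n choose k)" using kn by (rule binomial_ge_n_over_k_pow_k)
    moreover have "(D / L / k) ^ k \<le> (real ?n / k) ^ k"
      using n D1 L1 by (intro power_mono divide_right_mono) auto
    ultimately have "(D / L / k) ^ k / 2 \<le> card ?\<M>" by linarith
    then have "(D / L / k) ^ k / 2 * (q ^ k / 2) \<le> card ?\<M> * (q ^ k / 2)"
      using q0 by (intro mult_right_mono) auto
    moreover have "(D / L / k) ^ k / 2 * (q ^ k / 2) = \<pi>"
    proof -
      have "D / L / k * q = \<theta> / (L\<^sup>2 * k)" using D1 L1 by (simp add: q_def power2_eq_square)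
      then show ?thesis by (simp add: \<pi>_def flip: power_mult_distrib)
    qed
    moreover have "card ?\<M> * q ^ k / 2 \<le> subset_mean q A (\<lambda>S. of_bool (k \<le> card (N b \<inter> sinks low S)))"
    proof (rule mean_independent_in_sinks_ge[where D = D])
      have "real k * D \<le> L * D" using k_le D1 by (intro mult_right_mono) auto
      then have "q * (?n + k * D) \<le> q * (2 * (D * L))"
        using cardN[OF b] q0 by (intro mult_left_mono) (auto simp: mult.commute)
      also have "\<dots> = 2 * \<theta>" using qDL by simp
      finally show "q * (?n + k * D) \<le> 1/2" using \<theta>0 by simp
    qed (use finA q0 q1 k low AB NA in auto)
    ultimately show ?thesis by linarith
  qed
  define Z where "Z = (\<lambda>u. {v\<in>B. \<kappa> < card (N u \<inter> N v)})"
  have ZB: "Z u \<subseteq> B" for u by (auto simp: Z_def)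
  have cardZ: "card (Z u) \<le> \<kappa>" if u: "u \<in> B" for u
  proof (rule ccontr)
    assume "\<not> ?thesis"
    then have "nat \<lfloor>\<kappa>\<rfloor> + 1 \<le> card (Z u)" using \<kappa>L L1 by linarith
    \<comment> \<open>Trimmed to just above \<open>\<kappa>\<close> elements, the set is small
      enough for \<open>sparse\<close> and still sends more than \<open>\<kappa> * \<kappa>\<close>
      edges to \<open>N u\<close>.\<close>
    then obtain Z' where Z': "Z' \<subseteq> Z u" "card Z' = nat \<lfloor>\<kappa>\<rfloor> + 1" by (meson obtain_subset_with_card_n)
    have cZ: "\<kappa> < card Z'" "card Z' \<le> \<kappa> + 1" using Z'(2) \<kappa>L L1 by linarith+
    have "2 * D \<le> D * L" using D1 L1 by simp
    then have cZ': "card Z' \<le> D * L" using cZ \<kappa>D D1 by linarith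
    have "Z' \<subseteq> V" using Z'(1) ZB AB(2) by (meson order_trans)
    then have "real (\<Sum>z\<in>Z'. card (nbr z \<inter> N u)) \<le> (D / L ^ g)\<^sup>2"
      using NV cardN[OF u] cZ' by (intro sparse) auto
    moreover have "(\<Sum>z\<in>Z'. \<kappa>) \<le> (\<Sum>z\<in>Z'. real (card (nbr z \<inter> N u)))"
    proof (rule sum_mono)
      fix z assume "z \<in> Z'"
      then have "\<kappa> < card (N u \<inter> N z)" using Z'(1) by (auto simp: Z_def)
      moreover have "N u \<inter> N z = nbr z \<inter> N u" by (auto simp: N_def)
      ultimately show "\<kappa> \<le> real (card (nbr z \<inter> N u))" by simp
    qed
    moreover have "\<kappa> * \<kappa> < card Z' * \<kappa>" using cZ \<kappa>L L1 by (intro mult_strict_right_mono) auto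
    ultimately show False by (simp add: \<kappa>_def power2_eq_square)
  qed
  define conf where "conf = (\<lambda>S u v. u \<noteq> v \<and> (E u v \<or> 2 \<le> card (N u \<inter> N v \<inter> S)))"
  define T where "T = (\<lambda>S. {b\<in>B. k \<le> card (N b \<inter> sinks low S)})"
  define C where "C = (\<lambda>S. {(u, v). u \<in> T S \<and> v \<in> T S \<and> conf S u v})"
  \<comment> \<open>Richness is relaxed from \<open>sinks low S\<close> to \<open>S\<close>, and the
    diagonal is included; both only enlarge the count of conflicts.\<close>
  define f where "f = (\<lambda>u v S. of_bool (k \<le> card (N u \<inter> S) \<and> k \<le> card (N v \<inter> S) \<and> (E u v \<or> 2 \<le> card (N u \<inter> N v \<inter> S))) :: real)"
  let ?p = "\<theta> ^ (2 * k) + \<kappa> * q * \<theta> ^ (k - 1)"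
  let ?r = "\<kappa> * q\<^sup>2 * \<theta> ^ (k - 2)"
  have mean_f: "subset_mean q A (f u v) \<le> of_bool (v \<in> Z u) * \<theta> ^ k + of_bool (E u v) * ?p + card (nbr v \<inter> N u) * ?r"
    if u: "u \<in> B" and v: "v \<in> B" for u v
  proof (cases "v \<in> Z u")
    case True
    have "subset_mean q A (f u v) \<le> subset_mean q A (\<lambda>S. of_bool ({} \<subseteq> S \<and> k \<le> card (N u \<inter> S)))"
      unfolding f_def using q0 q1 by (intro subset_mean_mono) auto
    also have "\<dots> \<le> q ^ card ({} :: 'a set) * (card (N u) * q) ^ (k - card ({} :: 'a set))"
      using finA NA q0 q1 by (intro subset_mean_many_le) auto
    also have "\<dots> \<le> \<theta> ^ k" using \<theta>N[OF u] q0 by (simp add: power_mono)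
    also have "\<dots> \<le> of_bool (v \<in> Z u) * \<theta> ^ k + of_bool (E u v) * ?p + card (nbr v \<inter> N u) * ?r"
      using True \<theta>0 q0 \<kappa>L L1 by simp
    finally show ?thesis .
  next
    case False
    have eq: "N u \<inter> N v = nbr v \<inter> N u" by (auto simp: N_def)
    have "subset_mean q A (f u v) \<le> of_bool (E u v) * ?p + card (N u \<inter> N v) * \<kappa> * q\<^sup>2 * \<theta> ^ (k - 2)"
      unfolding f_def using False finA NA q0 q1 k \<theta>N u v
      by (intro mean_conflict_le) (auto simp: Z_def not_less)
    then show ?thesis using False by (simp add: eq mult.assoc)
  qed
  \<comment> \<open>On average per vertex of \<open>B\<close>, and up to the factor
    \<open>\<theta> ^ (2 * k)\<close>: \<open>D\<close> from the exceptional pairs in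
    \<open>Z u\<close>, \<open>2 * D\<close> from the edges, and \<open>\<Delta> / L\<close> from
    the paths of length two through \<open>A\<close>.\<close>
  let ?E0 = "card B * \<theta> ^ (2 * k) * (3 * D + \<Delta> / L)"
  have sum_f: "(\<Sum>u\<in>B. \<Sum>v\<in>B. subset_mean q A (f u v)) \<le> ?E0"
  proof -
    have p0: "0 \<le> ?p" and r0: "0 \<le> ?r" using \<theta>0 q0 \<kappa>L L1 by auto
    have kk: "\<kappa> * \<theta> ^ k = D * \<theta> ^ (2 * k)" by (simp only: \<theta>k t2 mult.assoc)
    have pD: "D * ?p \<le> 2 * D * \<theta> ^ (2 * k)"
    proof -
      have "D * (\<kappa> * q * \<theta> ^ (k - 1)) = \<kappa> / L * (\<theta> * \<theta> ^ (k - 1))" using D1 L1 by (simp add: q_def)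
      also have "\<theta> * \<theta> ^ (k - 1) = \<theta> ^ k" using k by (simp add: power_eq_if)
      also have "\<kappa> / L * \<theta> ^ k \<le> \<kappa> * \<theta> ^ k" using L1 \<kappa>L \<theta>0 by (intro mult_right_mono) (auto simp: divide_le_eq)
      also have "\<dots> = D * \<theta> ^ (2 * k)" by (simp only: \<theta>k t2 mult.assoc)
      finally show ?thesis by (simp add: distrib_left)
    qed
    have rD: "D * L * \<Delta> * ?r = \<theta> ^ (2 * k) * \<Delta> / L"
    proof -
      have "D * L * \<Delta> * ?r = (q * (D * L)) * \<Delta> * \<kappa> * q * \<theta> ^ (k - 2)" by (simp add: power2_eq_square)
      also have "\<dots> = \<theta> * \<Delta> * (D * \<theta> ^ k) * (\<theta> / (D * L)) * \<theta> ^ (k - 2)"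
        unfolding qDL \<theta>k by (simp only: q_def)
      also have "\<dots> = \<Delta> * \<theta> ^ k * (\<theta> * \<theta> * \<theta> ^ (k - 2)) / L" using D1 by simp
      also have "\<theta> * \<theta> * \<theta> ^ (k - 2) = \<theta> ^ (2 + (k - 2))" by (simp only: power_add power2_eq_square)
      also have "2 + (k - 2) = k" using k by simp
      finally show ?thesis unfolding t2 by (simp add: mult_ac)
    qed
    have "(\<Sum>u\<in>B. \<Sum>v\<in>B. subset_mean q A (f u v))
      \<le> (\<Sum>u\<in>B. \<Sum>v\<in>B. of_bool (v \<in> Z u) * \<theta> ^ k + of_bool (E u v) * ?p + card (nbr v \<inter> N u) * ?r)"
      using mean_f by (intro sum_mono) auto
    also have "\<dots> = (\<Sum>u\<in>B. card (Z u) * \<theta> ^ k + card (nbr u \<inter> B) * ?p + (\<Sum>v\<in>B. card (nbr v \<inter> N u)) * ?r)"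
    proof (intro sum.cong refl)
      fix u
      have "(\<Sum>v\<in>B. of_bool (v \<in> Z u)) = real (card (Z u))" using finB ZB[of u] by (simp add: Int_absorb1)
      moreover have "(\<Sum>v\<in>B. of_bool (E u v)) = real (card (nbr u \<inter> B))"
        using finB by (simp add: nbr_def Int_commute)
      ultimately show "(\<Sum>v\<in>B. of_bool (v \<in> Z u) * \<theta> ^ k + of_bool (E u v) * ?p + card (nbr v \<inter> N u) * ?r)
        = card (Z u) * \<theta> ^ k + card (nbr u \<inter> B) * ?p + (\<Sum>v\<in>B. card (nbr v \<inter> N u)) * ?r"
        by (simp only: sum.distrib flip: sum_distrib_right) simp
    qed
    also have "\<dots> \<le> (\<Sum>u\<in>B. \<kappa> * \<theta> ^ k + card (nbr u \<inter> B) * ?p + D * L * \<Delta> * ?r)"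
    proof (intro sum_mono add_mono order_refl mult_right_mono)
      fix u assume u: "u \<in> B"
      show "card (Z u) \<le> \<kappa>" using cardZ[OF u] .
      have "(\<Sum>v\<in>B. card (nbr v \<inter> N u)) = (\<Sum>x\<in>N u. card (nbr x \<inter> B))"
        using finB finN by (rule sum_card_nbr_swap)
      then have "real (\<Sum>v\<in>B. card (nbr v \<inter> N u)) = (\<Sum>x\<in>N u. real (card (nbr x \<inter> B)))" by simp
      also have "\<dots> \<le> (\<Sum>x\<in>N u. \<Delta>)" using NA upA by (intro sum_mono) blast
      also have "\<dots> = card (N u) * \<Delta>" by simp
      also have "\<dots> \<le> D * L * \<Delta>"
      proof (rule mult_right_mono[OF cardN[OF u]])
        have "0 < card (nbr u \<inter> A)" using lowB[OF u] D1 L1 by (smt (verit) divide_pos_pos of_nat_0_less_iff)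
        then obtain a where "a \<in> A" by (metis Int_iff card_gt_0_iff ex_in_conv)
        then show "0 \<le> \<Delta>" using upA by (meson of_nat_0_le_iff order_trans)
      qed
      finally show "real (\<Sum>v\<in>B. card (nbr v \<inter> N u)) \<le> D * L * \<Delta>" .
    qed (use \<theta>0 r0 in auto)
    also have "\<dots> = card B * (\<kappa> * \<theta> ^ k) + real (\<Sum>u\<in>B. card (nbr u \<inter> B)) * ?p + card B * (D * L * \<Delta> * ?r)"
      by (simp only: sum.distrib sum_constant of_nat_sum sum_distrib_right)
    also have "\<dots> \<le> card B * (\<kappa> * \<theta> ^ k) + D * card B * ?p + card B * (D * L * \<Delta> * ?r)"
      using dens[OF AB(2)] p0 by (intro add_mono order_refl mult_right_mono)
    also have "\<dots> = card B * (D * \<theta> ^ (2 * k) + D * ?p + \<theta> ^ (2 * k) * \<Delta> / L)"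
      unfolding rD kk by (simp add: algebra_simps)
    also have "\<dots> \<le> card B * (D * \<theta> ^ (2 * k) + 2 * D * \<theta> ^ (2 * k) + \<theta> ^ (2 * k) * \<Delta> / L)"
      using pD by (intro mult_left_mono) auto
    also have "\<dots> = ?E0" by (simp add: algebra_simps)
    finally show ?thesis .
  qed
  have A0: "0 < card A" 
  proof -
    obtain b where "b \<in> B" using AB by blast
    then have "0 < card (nbr b \<inter> A)" using lowB[of b] D1 L1 by (smt (verit) divide_pos_pos of_nat_0_less_iff)
    then show ?thesis using finA by (metis Int_empty_right card.empty card_gt_0_iff less_irrefl)
  qed
  have B0: "0 < card B" using AB finB by (simp add: card_gt_0_iff)
  obtain \<sigma> where \<sigma>: "0 \<le> \<sigma>" "\<sigma> \<le> 1"
    "0 < \<sigma> * (\<pi> * card B) - \<sigma>\<^sup>2 * ?E0 - \<theta> / (D * L) * card A"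
    using regular_pair_arith[OF k L \<theta>_def Lg[unfolded g_def] _ _ card_AB \<pi>_def] A0 B0 by auto
  \<comment> \<open>Where this is positive, alteration at rate \<open>\<sigma>\<close> inside
    \<open>T S\<close> leaves more than \<open>card S\<close> vertices.\<close>
  let ?\<Phi> = "\<lambda>S. \<sigma> * real (card (T S)) - \<sigma>\<^sup>2 * (\<Sum>u\<in>B. \<Sum>v\<in>B. f u v S) - real (card S)"
  have "\<sigma> * (\<pi> * card B) - \<sigma>\<^sup>2 * ?E0 - \<theta> / (D * L) * card A \<le> subset_mean q A ?\<Phi>"
  proof -
    have "(\<lambda>S. real (card (T S))) = (\<lambda>S. \<Sum>b\<in>B. of_bool (k \<le> card (N b \<inter> sinks low S)))"
      using finB by (auto simp: T_def Int_def)
    then have "subset_mean q A (\<lambda>S. real (card (T S))) = (\<Sum>b\<in>B. subset_mean q A (\<lambda>S. of_bool (k \<le> card (N b \<inter> sinks low S))))"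
      by (simp only: subset_mean_sum)
    also have "\<dots> \<ge> (\<Sum>b\<in>B. \<pi>)" using mean_rich by (intro sum_mono)
    finally have 1: "\<sigma> * (\<pi> * card B) \<le> \<sigma> * subset_mean q A (\<lambda>S. real (card (T S)))"
      using \<sigma>(1) by (intro mult_left_mono) (auto simp: mult.commute)
    have 2: "\<sigma>\<^sup>2 * (\<Sum>u\<in>B. \<Sum>v\<in>B. subset_mean q A (f u v)) \<le> \<sigma>\<^sup>2 * ?E0"
      using sum_f by (intro mult_left_mono) auto
    have "subset_mean q A ?\<Phi> = \<sigma> * subset_mean q A (\<lambda>S. real (card (T S)))
      - \<sigma>\<^sup>2 * (\<Sum>u\<in>B. \<Sum>v\<in>B. subset_mean q A (f u v)) - q * card A"
      by (simp only: subset_mean_diff subset_mean_cmult subset_mean_sum subset_mean_card[OF finA])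
    then show ?thesis using 1 2 by (simp add: q_def)
  qed
  with \<sigma>(3) have mean0: "0 < subset_mean q A ?\<Phi>" by linarith
  obtain S where S: "S \<subseteq> A" "subset_mean q A ?\<Phi> \<le> ?\<Phi> S"
    using subset_mean_obtain[OF finA, of q ?\<Phi>] q0 q1 by auto
  have finS: "finite S" using S finA finite_subset by auto
  have TB: "T S \<subseteq> B" and finT: "finite (T S)" using finB by (auto simp: T_def)
  have sub: "sinks low S \<subseteq> S" by (auto simp: sinks_def)
  have "real (card (C S)) \<le> (\<Sum>u\<in>B. \<Sum>v\<in>B. f u v S)"
  proof -
    have "C S \<subseteq> {p\<in>B \<times> B. f (fst p) (snd p) S = 1}"
    proof clarify
      fix u v assume uv: "(u, v) \<in> C S"
      then have "u \<in> T S" "v \<in> T S" "conf S u v" by (auto simp: C_def)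
      moreover have "k \<le> card (N b \<inter> S)" if "b \<in> T S" for b
      proof -
        have "card (N b \<inter> sinks low S) \<le> card (N b \<inter> S)"
          using sub finN by (intro card_mono) auto
        then show ?thesis using that by (auto simp: T_def)
      qed
      ultimately show "(u, v) \<in> B \<times> B \<and> f (fst (u, v)) (snd (u, v)) S = 1"
        using TB by (auto simp: f_def conf_def)
    qed
    then have "card (C S) \<le> card {p\<in>B \<times> B. f (fst p) (snd p) S = 1}"
      using finB by (intro card_mono) auto
    then have "real (card (C S)) \<le> (\<Sum>p\<in>{p\<in>B \<times> B. f (fst p) (snd p) S = 1}. f (fst p) (snd p) S)" by simp
    also have "\<dots> \<le> (\<Sum>p\<in>B \<times> B. f (fst p) (snd p) S)"
      using finB by (intro sum_mono2) (auto simp: f_def)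
    finally show ?thesis by (simp add: sum.cartesian_product case_prod_beta)
  qed
  then obtain T' where T': "T' \<subseteq> T S" "\<forall>u\<in>T'. \<forall>v\<in>T'. \<not> conf S u v"
    "\<sigma> * card (T S) - \<sigma>\<^sup>2 * (\<Sum>u\<in>B. \<Sum>v\<in>B. f u v S) \<le> card T'"
    using conflict_free_subset[OF finT \<sigma>(1,2), of "conf S" "\<Sum>u\<in>B. \<Sum>v\<in>B. f u v S"]
    by (auto simp: conf_def C_def)
  have cardST: "card S < card T'" using T'(3) S(2) mean0 by linarith
  have indS: "indep (sinks low S)" using indep_sinks low(3) by blast
  have rich: "k \<le> card (nbr v \<inter> sinks low S)" if "v \<in> T'" for v
  proof -
    have "N v \<inter> sinks low S = nbr v \<inter> sinks low S" using S sub by (auto simp: N_def)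
    then show ?thesis using that T'(1) by (auto simp: T_def)
  qed
  have "rich_pair k (sinks low S) T'"
    unfolding rich_pair_def
  proof (intro conjI ballI)
    show "sinks low S \<subseteq> V" "T' \<subseteq> V" using sub S AB T' TB by auto
    \<comment> \<open>\<open>A\<close> and \<open>B\<close> may overlap. The sets are disjoint
      because a sink has no neighbour among the sinks, while each vertex of \<open>T'\<close> has at
      least \<open>k\<close> of them.\<close>
    show "sinks low S \<inter> T' = {}"
    proof (rule ccontr)
      assume "\<not> ?thesis"
      then obtain v where v: "v \<in> sinks low S" "v \<in> T'" by blast
      then have "nbr v \<inter> sinks low S = {}" using indS by (auto simp: indep_def nbr_def)
      then show False using rich[OF v(2)] k by simp
    qed
    show "indep T'" using T'(2) E_irrefl unfolding indep_def conf_def by metis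
    show "T' \<noteq> {}" using cardST by auto
    have "card (sinks low S) \<le> card S" using sub finS by (rule card_mono[rotated])
    then show "card (sinks low S) \<le> card T'" using cardST by linarith
  qed (use indS rich in auto)
  moreover have "linear_pair (sinks low S) T'"
    unfolding linear_pair_def
  proof (intro ballI impI)
    fix u v assume uv: "u \<in> T'" "v \<in> T'" "u \<noteq> v"
    then have "card (N u \<inter> N v \<inter> S) \<le> 1" using T'(2) by (force simp: conf_def)
    moreover have "card (nbr u \<inter> nbr v \<inter> sinks low S) \<le> card (N u \<inter> N v \<inter> S)"
      using sub S finN by (intro card_mono) (auto simp: N_def)
    ultimately show "card (nbr u \<inter> nbr v \<inter> sinks low S) \<le> 1" by linarith
  qed
  ultimately show ?thesis by blast
qed


section \<open>Unbalanced pairs and degree scales\<close>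

text \<open>Each \<open>b\<close> commits to one independent \<open>m\<close>-set
  \<open>f b\<close>, which lies among the sinks with probability at least \<open>q ^ m / 2\<close>
  for \<open>q = 1 / (4 * m * D)\<close>. By \<open>card_AB\<close>, even this fraction of
  \<open>B\<close>, divided by \<open>4 * D\<close> for the removal of edges, exceeds
  \<open>card A\<close>.\<close>

lemma unbalanced_pair:
  fixes D :: real and m :: nat
  assumes "1 \<le> m" "1 \<le> D"
    and dens: "\<And>W. W \<subseteq> V \<Longrightarrow> real (\<Sum>v\<in>W. card (nbr v \<inter> W)) \<le> D * card W"
    and AB: "A \<subseteq> V" "B \<subseteq> V"
    and M: "\<And>b. b \<in> B \<Longrightarrow> \<exists>M. M \<subseteq> nbr b \<inter> A \<and> card M = m \<and> indep M"
    and card_AB: "8 * D * (4 * m * D) ^ m * card A < card B"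
  shows "\<exists>S T. rich_pair m S T"
proof -
  define q where "q = 1 / (4 * m * D)"
  have mD: "1 \<le> m * D" using mult_mono[of 1 "real m" 1 D] assms(1,2) by simp
  have q: "0 < q" "q \<le> 1" using mD by (auto simp: q_def divide_le_eq mult.assoc)
  have finA: "finite A" and finB: "finite B" using AB finV finite_subset by auto
  obtain low where low: "\<And>v. low v \<subseteq> nbr v" "\<And>v. v \<in> V \<Longrightarrow> card (low v) \<le> D"
    "\<And>u v. E u v \<Longrightarrow> u \<in> low v \<or> v \<in> low u"
    using orientation[OF dens] by blast
  define f where "f = (\<lambda>b. SOME M. M \<subseteq> nbr b \<inter> A \<and> card M = m \<and> indep M)"
  have f: "f b \<subseteq> nbr b \<inter> A" "card (f b) = m" "indep (f b)" if "b \<in> B" for b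
    using someI_ex[OF M[OF that]] by (auto simp: f_def)
  define T where "T = (\<lambda>S. {b\<in>B. m \<le> card (f b \<inter> sinks low S)})"
  have mean: "q ^ m / 2 \<le> subset_mean q A (\<lambda>S. of_bool (m \<le> card (f b \<inter> sinks low S)))" if b: "b \<in> B" for b
  proof -
    have "real (card {f b}) * q ^ m / 2 \<le> subset_mean q A (\<lambda>S. of_bool (m \<le> card (f b \<inter> sinks low S)))"
    proof (rule mean_independent_in_sinks_ge[where D = D])
      have "real m \<le> m * D" using assms(2) mult_left_mono[of 1 D "real m"] by simp
      then have "real (card (f b)) + m * D \<le> 2 * (m * D)" unfolding f(2)[OF b] by linarith
      then have "q * (card (f b) + m * D) \<le> q * (2 * (m * D))" using q by (intro mult_left_mono) auto
      also have "\<dots> = 1/2" using mD assms(1,2) by (simp add: q_def)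
      finally show "q * (card (f b) + m * D) \<le> 1/2" .
    qed (use finA q assms(1) low AB f[OF b] in auto)
    then show ?thesis by simp
  qed
  let ?\<Phi> = "\<lambda>S. 1 / (4 * D) * real (card (T S)) - real (card S)"
  have "0 < subset_mean q A ?\<Phi>"
  proof -
    have "(\<lambda>S. real (card (T S))) = (\<lambda>S. \<Sum>b\<in>B. of_bool (m \<le> card (f b \<inter> sinks low S)))"
      using finB by (auto simp: T_def Int_def)
    then have "subset_mean q A (\<lambda>S. real (card (T S))) = (\<Sum>b\<in>B. subset_mean q A (\<lambda>S. of_bool (m \<le> card (f b \<inter> sinks low S))))"
      by (simp only: subset_mean_sum)
    also have "\<dots> \<ge> (\<Sum>b\<in>B. q ^ m / 2)" using mean by (intro sum_mono)
    finally have "1 / (4 * D) * (card B * (q ^ m / 2)) \<le> 1 / (4 * D) * subset_mean q A (\<lambda>S. real (card (T S)))"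
      using assms(2) by (intro mult_left_mono) auto
    moreover have "q * card A < 1 / (4 * D) * (card B * (q ^ m / 2))"
    proof -
      have "q * real (card A) \<le> 1 * real (card A)" using q by (intro mult_right_mono) auto
      also have "\<dots> = 8 * D * (4 * m * D) ^ m * card A * q ^ m / (8 * D)"
        using mD assms(1,2) by (simp add: q_def power_one_over)
      also have "\<dots> < card B * q ^ m / (8 * D)"
        using card_AB q assms(2) by (intro divide_strict_right_mono mult_strict_right_mono) auto
      finally show ?thesis by simp
    qed
    ultimately show ?thesis
      by (simp only: subset_mean_diff subset_mean_cmult subset_mean_card[OF finA])
  qed
  then obtain S where S: "S \<subseteq> A" "0 < ?\<Phi> S"
    using subset_mean_obtain[OF finA, of q ?\<Phi>] q by (smt (verit))
  have TB: "T S \<subseteq> B" and finT: "finite (T S)" using finB by (auto simp: T_def)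
  have "real (card {(u, v). u \<in> T S \<and> v \<in> T S \<and> E u v}) \<le> D * card (T S)"
    using dens[of "T S"] TB AB(2) card_ordered_edges[OF finT finT] by auto
  \<comment> \<open>The rate \<open>1 / (2 * D)\<close> is optimal against
    \<open>D * card (T S)\<close> ordered edges and leaves \<open>card (T S) / (4 * D)\<close>
    vertices.\<close>
  then obtain T' where T': "T' \<subseteq> T S" "\<forall>u\<in>T'. \<forall>v\<in>T'. \<not> E u v"
    "1 / (2 * D) * card (T S) - (1 / (2 * D))\<^sup>2 * (D * card (T S)) \<le> card T'"
    using conflict_free_subset[OF finT, of "1 / (2 * D)" E "D * card (T S)"] assms(2) E_irrefl by auto
  have "1 / (2 * D) * card (T S) - (1 / (2 * D))\<^sup>2 * (D * card (T S)) = 1 / (4 * D) * card (T S)"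
    using assms(2) by (simp add: power2_eq_square field_simps)
  then have cardST: "card S < card T'" using T'(3) S(2) by linarith
  have sub: "sinks low S \<subseteq> S" and finS: "finite S" using S finA finite_subset by (auto simp: sinks_def)
  have indS: "indep (sinks low S)" using indep_sinks low(3) by blast
  have rich: "m \<le> card (nbr v \<inter> sinks low S)" if "v \<in> T'" for v
  proof -
    have "v \<in> B" "m \<le> card (f v \<inter> sinks low S)" using that T'(1) by (auto simp: T_def)
    moreover have "card (f v \<inter> sinks low S) \<le> card (nbr v \<inter> sinks low S)"
      using f(1)[OF \<open>v \<in> B\<close>] by (intro card_mono) auto
    ultimately show ?thesis by linarith
  qed
  have "rich_pair m (sinks low S) T'"
    unfolding rich_pair_def
  proof (intro conjI ballI)
    show "sinks low S \<subseteq> V" "T' \<subseteq> V" using sub S AB T' TB by auto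
    show "sinks low S \<inter> T' = {}"
    proof (rule ccontr)
      assume "\<not> ?thesis"
      then obtain v where v: "v \<in> sinks low S" "v \<in> T'" by blast
      then have "nbr v \<inter> sinks low S = {}" using indS by (auto simp: indep_def nbr_def)
      then show False using rich[OF v(2)] assms(1) by simp
    qed
    show "indep T'" using T'(2) by (auto simp: indep_def)
    show "T' \<noteq> {}" using cardST by auto
    have "card (sinks low S) \<le> card S" using sub finS by (rule card_mono[rotated])
    then show "card (sinks low S) \<le> card T'" using cardST by linarith
  qed (use indS rich in auto)
  then show ?thesis by blast
qed

text \<open>By Markov's inequality, at most \<open>card V / L ^ i\<close> vertices have degree above
  \<open>D * L ^ i\<close>. Those above \<open>D * L\<close> span little among themselves, so the
  remaining vertices carry a quarter of the degree sum, and pigeonhole over \<open>R + 1\<close>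
  scales selects \<open>A\<close>. The condition \<open>16 * R \<le> L\<close> turns the pigeonhole
  loss into one factor \<open>L\<close>.\<close>

lemma degree_levels:
  fixes D L :: real and R :: nat
  assumes "0 < D" "2 \<le> L" "1 \<le> R" "16 * R \<le> L" "V \<noteq> {}"
    and avg: "real (\<Sum>v\<in>V. card (nbr v)) = D * card V"
    and dens: "\<And>W. W \<subseteq> V \<Longrightarrow> real (\<Sum>v\<in>W. card (nbr v \<inter> W)) \<le> D * card W"
  obtains A B i where "A \<subseteq> V" "B \<subseteq> V" "B \<noteq> {}"
    "\<And>b. b \<in> B \<Longrightarrow> D / L \<le> card (nbr b \<inter> A)" "\<And>b. b \<in> B \<Longrightarrow> card (nbr b) \<le> D * L"
    "card A * L ^ i \<le> L\<^sup>2 * card B" "(\<forall>a\<in>A. card (nbr a) \<le> D * L ^ (i + 1)) \<or> i = R"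
proof -
  let ?n = "real (card V)"
  let ?deg = "\<lambda>v. real (card (nbr v))"
  define lev where "lev = (\<lambda>i. {v\<in>V. D * L ^ i < ?deg v})"
  \<comment> \<open>Scale 0 takes all degrees up to \<open>D * L\<close> and scale \<open>R\<close>
    all degrees above \<open>D * L ^ R\<close>, so the scales cover \<open>V\<close>.\<close>
  define Cl where "Cl = (\<lambda>i. if i = R then lev R else {v\<in>V. (i = 0 \<or> D * L ^ i < ?deg v) \<and> ?deg v \<le> D * L ^ (i + 1)})"
  define B0 where "B0 = {v\<in>V. ?deg v \<le> D * L}"
  have n0: "0 < ?n" using assms(5) finV by (simp add: card_gt_0_iff)
  have finlev: "finite (lev i)" for i using finV by (auto simp: lev_def)
  have finB0: "finite B0" using finV by (auto simp: B0_def)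
  have lev: "card (lev i) * L ^ i \<le> ?n" for i
  proof -
    have "card (lev i) * (D * L ^ i) = (\<Sum>v\<in>lev i. D * L ^ i)" by simp
    also have "\<dots> \<le> (\<Sum>v\<in>lev i. ?deg v)" by (intro sum_mono) (auto simp: lev_def)
    also have "\<dots> \<le> (\<Sum>v\<in>V. ?deg v)" using finV by (intro sum_mono2) (auto simp: lev_def)
    also have "\<dots> = D * ?n" using avg by simp
    finally have "D * (card (lev i) * L ^ i) \<le> D * ?n" by (simp add: mult.left_commute)
    then show ?thesis using assms(1) by simp
  qed
  \<comment> \<open>Edges between \<open>B0\<close> and \<open>lev 1\<close> are counted a second
    time at \<open>B0\<close>, and \<open>lev 1\<close>, having at most half of the vertices, spans
    at most \<open>D * ?n / 2\<close>.\<close>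
  have degB0: "D * ?n / 4 \<le> (\<Sum>v\<in>B0. ?deg v)"
  proof -
    have V: "V = B0 \<union> lev 1" "B0 \<inter> lev 1 = {}" by (auto simp: B0_def lev_def)
    have split: "?deg v = real (card (nbr v \<inter> B0)) + real (card (nbr v \<inter> lev 1))" for v
    proof -
      have "nbr v = (nbr v \<inter> B0) \<union> (nbr v \<inter> lev 1)" using nbr_V V by blast
      moreover have "(nbr v \<inter> B0) \<inter> (nbr v \<inter> lev 1) = {}" using V by blast
      ultimately have "card (nbr v) = card (nbr v \<inter> B0) + card (nbr v \<inter> lev 1)"
        by (metis card_Un_disjoint fin_nbr finite_Int)
      then show ?thesis by simp
    qed
    have "D * ?n = (\<Sum>v\<in>B0. ?deg v) + (\<Sum>v\<in>lev 1. ?deg v)"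
      using avg V sum.union_disjoint[OF finB0 finlev V(2), of ?deg] by simp
    also have "(\<Sum>v\<in>lev 1. ?deg v) = real (\<Sum>v\<in>lev 1. card (nbr v \<inter> B0)) + real (\<Sum>v\<in>lev 1. card (nbr v \<inter> lev 1))"
      by (simp add: split sum.distrib)
    also have "(\<Sum>v\<in>lev 1. card (nbr v \<inter> B0)) = (\<Sum>v\<in>B0. card (nbr v \<inter> lev 1))"
      using finlev finB0 by (rule sum_card_nbr_swap)
    also have "real (\<Sum>v\<in>B0. card (nbr v \<inter> lev 1)) \<le> (\<Sum>v\<in>B0. ?deg v)"
      by (simp, intro sum_mono) (simp add: split)
    also have "real (\<Sum>v\<in>lev 1. card (nbr v \<inter> lev 1)) \<le> D * card (lev 1)"
      using V by (intro dens) auto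
    also have "D * card (lev 1) \<le> D * (?n / 2)"
    proof (intro mult_left_mono)
      have "real (card (lev 1)) * 2 \<le> real (card (lev 1)) * L" using assms(2) by (intro mult_left_mono) auto
      then show "card (lev 1) \<le> ?n / 2" using lev[of 1] by simp
    qed (use assms in auto)
    finally show ?thesis by simp
  qed
  have cover: "nbr b \<subseteq> (\<Union>i\<le>R. Cl i)" for b
  proof
    fix v assume "v \<in> nbr b"
    then have v: "v \<in> V" using nbr_V by auto
    show "v \<in> (\<Union>i\<le>R. Cl i)"
    proof (cases "v \<in> lev R")
      case True
      then show ?thesis by (auto simp: Cl_def)
    next
      case False
      define i where "i = (LEAST i. ?deg v \<le> D * L ^ (i + 1))"
      have ex: "?deg v \<le> D * L ^ (R - 1 + 1)" using False v assms(3) by (auto simp: lev_def)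
      have i: "?deg v \<le> D * L ^ (i + 1)" unfolding i_def using LeastI[of "\<lambda>i. ?deg v \<le> D * L ^ (i + 1)", OF ex] .
      have "i \<le> R - 1" unfolding i_def using Least_le[of "\<lambda>i. ?deg v \<le> D * L ^ (i + 1)", OF ex] .
      then have iR: "i < R" using assms(3) by linarith
      have "i = 0 \<or> D * L ^ i < ?deg v"
      proof (cases i)
        case (Suc j)
        then have "\<not> ?deg v \<le> D * L ^ (j + 1)" using not_less_Least[of j "\<lambda>i. ?deg v \<le> D * L ^ (i + 1)"] by (simp add: i_def)
        then show ?thesis using Suc by simp
      qed simp
      then have "v \<in> Cl i" using i iR v by (auto simp: Cl_def)
      then show ?thesis using iR by auto
    qed
  qed
  have finCl: "finite (Cl i)" for i using finV finlev by (auto simp: Cl_def)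
  have "\<exists>i\<le>R. D * ?n / (8 * R) \<le> (\<Sum>b\<in>B0. real (card (nbr b \<inter> Cl i)))"
  proof (rule ccontr)
    assume "\<not> ?thesis"
    then have small: "(\<Sum>b\<in>B0. real (card (nbr b \<inter> Cl i))) < D * ?n / (8 * R)" if "i \<le> R" for i
      using that by (meson not_le)
    have "(\<Sum>b\<in>B0. ?deg b) \<le> (\<Sum>b\<in>B0. \<Sum>i\<le>R. real (card (nbr b \<inter> Cl i)))"
    proof (rule sum_mono)
      fix b
      have "nbr b = (\<Union>i\<le>R. nbr b \<inter> Cl i)" using cover[of b] by blast
      then have "card (nbr b) \<le> (\<Sum>i\<le>R. card (nbr b \<inter> Cl i))"
        using card_UN_le[of "{..R}" "\<lambda>i. nbr b \<inter> Cl i"] by simp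
      then show "?deg b \<le> (\<Sum>i\<le>R. real (card (nbr b \<inter> Cl i)))" by (simp flip: of_nat_sum)
    qed
    also have "\<dots> = (\<Sum>i\<le>R. \<Sum>b\<in>B0. real (card (nbr b \<inter> Cl i)))" by (rule sum.swap)
    also have "\<dots> < (\<Sum>i\<le>R. D * ?n / (8 * R))" using small by (intro sum_strict_mono) auto
    also have "\<dots> = (real R + 1) / R * (D * ?n / 8)" by (simp add: add.commute mult.commute)
    also have "\<dots> \<le> 2 * (D * ?n / 8)"
      using assms(1,3) n0 by (intro mult_right_mono) (auto simp: divide_le_eq)
    finally show False using degB0 by simp
  qed
  then obtain i where i: "i \<le> R" "D * ?n / (8 * R) \<le> (\<Sum>b\<in>B0. real (card (nbr b \<inter> Cl i)))" by blast
  \<comment> \<open>The vertices of \<open>B0\<close> below this threshold account for at most half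
    of the bound in \<open>i(2)\<close>, and each of the others for at most \<open>D * L\<close>; so
    \<open>B\<close> is at least a \<open>1 / (16 * R * L)\<close> part of \<open>V\<close>.\<close>
  define B where "B = {b\<in>B0. D / (16 * R) \<le> card (nbr b \<inter> Cl i)}"
  have finB: "finite B" using finB0 by (auto simp: B_def)
  have R0: "0 < real R" using assms(3) by simp
  have "D * ?n / (8 * R) \<le> (\<Sum>b\<in>B0. (if b \<in> B then D * L else 0) + D / (16 * R))"
  proof (rule order_trans[OF i(2)], rule sum_mono)
    fix b assume b: "b \<in> B0"
    have "card (nbr b \<inter> Cl i) \<le> card (nbr b)" by (intro card_mono) auto
    then have "real (card (nbr b \<inter> Cl i)) \<le> D * L" using b by (auto simp: B0_def)
    moreover have "0 \<le> D / (16 * R)" using assms(1) by simp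
    ultimately show "real (card (nbr b \<inter> Cl i)) \<le> (if b \<in> B then D * L else 0) + D / (16 * R)"
      using b by (auto simp: B_def)
  qed
  also have "\<dots> = card B * (D * L) + card B0 * (D / (16 * R))"
  proof -
    have "B0 \<inter> {b. b \<in> B} = B" by (auto simp: B_def)
    then show ?thesis using finB0 by (simp add: sum.distrib sum.If_cases)
  qed
  also have "\<dots> \<le> card B * (D * L) + ?n * (D / (16 * R))"
  proof (intro add_left_mono mult_right_mono)
    show "real (card B0) \<le> ?n" using finV by (auto simp: B0_def intro!: card_mono)
  qed (use assms(1) in auto)
  finally have "D * ?n / (16 * R) \<le> card B * (D * L)" using R0 by (simp add: field_simps)
  then have "D * ?n \<le> D * (card B * L * (16 * R))" using R0 by (simp add: field_simps)
  then have "?n \<le> card B * L * (16 * R)" using assms(1) by simp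
  also have "\<dots> \<le> card B * L * L" using assms(2,4) by (intro mult_left_mono) auto
  finally have nB: "?n \<le> L\<^sup>2 * card B" by (simp add: power2_eq_square mult_ac)
  show thesis
  proof (rule that[of "Cl i" B i])
    show "Cl i \<subseteq> V" "B \<subseteq> V" by (auto simp: Cl_def lev_def B_def B0_def)
    show "B \<noteq> {}" using nB n0 by auto
    show "card (nbr b) \<le> D * L" if "b \<in> B" for b using that by (auto simp: B_def B0_def)
    show "D / L \<le> card (nbr b \<inter> Cl i)" if "b \<in> B" for b
    proof -
      have "D / L \<le> D / (16 * R)" using assms(1,4) R0 by (intro divide_left_mono) auto
      then show ?thesis using that by (auto simp: B_def)
    qed
    show "(\<forall>a\<in>Cl i. card (nbr a) \<le> D * L ^ (i + 1)) \<or> i = R" by (auto simp: Cl_def)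
    have "card (Cl i) * L ^ i \<le> ?n"
    proof (cases "i = 0")
      case True
      have "card (Cl i) \<le> card V" using finV by (intro card_mono) (auto simp: Cl_def lev_def)
      then show ?thesis using True by simp
    next
      case False
      then have "Cl i \<subseteq> lev i" by (auto simp: Cl_def lev_def)
      then have "card (Cl i) \<le> card (lev i)" using finlev by (intro card_mono)
      then have "card (Cl i) * L ^ i \<le> card (lev i) * L ^ i" using assms(2) by (intro mult_right_mono) auto
      then show ?thesis using lev[of i] by linarith
    qed
    then show "card (Cl i) * L ^ i \<le> L\<^sup>2 * card B" using nB by linarith
  qed
qed


text \<open>On a scale \<open>i < R\<close>, the degree bound
  \<open>\<Delta> = D * L ^ (i + 1)\<close> and the bound on \<open>card A\<close> have a product
  that does not depend on \<open>i\<close>, which is what the regular case asks for. For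
  \<open>i = R\<close>, the factor \<open>L ^ R\<close> between the two sides outweighs the loss of
  the unbalanced case.\<close>

lemma rich_pair_exists:
  fixes D L :: real and k m M R :: nat
  defines "g \<equiv> (4 * k + 2) * k"
  assumes k: "2 \<le> k" and m: "2 \<le> m" and L: "256 * real k ^ (2 * k) < L" "4 * real m \<le> L" "16 * real R \<le> L"
    and D: "D = L ^ M" and M: "g + 1 \<le> M" and R: "(M + 1) * (m + 1) + 2 \<le> R"
    and V: "V \<noteq> {}" and avg: "real (\<Sum>v\<in>V. card (nbr v)) = D * card V"
    and dens: "\<And>W. W \<subseteq> V \<Longrightarrow> real (\<Sum>v\<in>W. card (nbr v \<inter> W)) \<le> D * card W"
    and sparse: "\<And>P Q. P \<subseteq> V \<Longrightarrow> Q \<subseteq> V \<Longrightarrow> card P \<le> D * L \<Longrightarrow> card Q \<le> D * L \<Longrightarrow>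
      real (\<Sum>z\<in>Q. card (nbr z \<inter> P)) \<le> (D / L ^ g)\<^sup>2"
  shows "(\<exists>S T. rich_pair k S T \<and> linear_pair S T) \<or> (\<exists>S T. rich_pair m S T)"
proof -
  have "1 \<le> real k ^ (2 * k)" using k by (intro one_le_power) auto
  then have L1: "256 < L" using L by linarith
  have mono: "L ^ i \<le> L ^ j" if "i \<le> j" for i j using that L1 by (intro power_increasing) auto
  have g: "2 \<le> g" using k by (simp add: g_def)
  have LD: "L ^ (g + 1) \<le> D" unfolding D using M by (rule mono)
  have "1 \<le> L ^ (g + 1)" using L1 by (intro one_le_power) auto
  then have D1: "1 \<le> D" using LD by linarith
  have R1: "1 \<le> R" using R by simp
  obtain A B i where AB: "A \<subseteq> V" "B \<subseteq> V" "B \<noteq> {}" "\<And>b. b \<in> B \<Longrightarrow> D / L \<le> card (nbr b \<inter> A)"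
    "\<And>b. b \<in> B \<Longrightarrow> card (nbr b) \<le> D * L"
    "card A * L ^ i \<le> L\<^sup>2 * card B" "(\<forall>a\<in>A. card (nbr a) \<le> D * L ^ (i + 1)) \<or> i = R"
  proof -
    have "real (16 * R) \<le> L" "0 < D" "2 \<le> L" using L(3) D1 L1 by simp_all
    then show thesis using degree_levels[OF _ _ R1 _ V avg dens, of L thesis] that by blast
  qed
  show ?thesis
  proof (cases "i = R")
    case False
    have 1: "card (nbr a \<inter> B) \<le> D * L ^ (i + 1)" if "a \<in> A" for a
    proof -
      have "card (nbr a \<inter> B) \<le> card (nbr a)" by (intro card_mono) auto
      then show ?thesis using AB(7) that False by force
    qed
    have 2: "card A * (D * L ^ (i + 1)) \<le> D * L ^ 3 * card B"
    proof -
      have "card A * (D * L ^ (i + 1)) = D * L * (card A * L ^ i)" by simp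
      also have "\<dots> \<le> D * L * (L\<^sup>2 * card B)" using AB(6) D1 L1 by (intro mult_left_mono) auto
      finally show ?thesis by (simp add: power3_eq_cube power2_eq_square mult_ac)
    qed
    have 3: "card A \<le> L\<^sup>2 * card B"
    proof -
      have "1 \<le> L ^ i" using L1 by (intro one_le_power) auto
      then have "real (card A) * 1 \<le> real (card A) * L ^ i" by (intro mult_left_mono) auto
      then show ?thesis using AB(6) by simp
    qed
    show ?thesis
      using regular_pair[OF k L(1) LD[unfolded g_def] dens sparse[unfolded g_def] AB(1-5) 1 2 3] by blast
  next
    case True
    have "\<exists>X. X \<subseteq> nbr b \<inter> A \<and> card X = m \<and> indep X" if b: "b \<in> B" for b
    proof -
      let ?N = "nbr b \<inter> A"
      have n: "D / L \<le> card ?N" using AB(4)[OF b] .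
      have "card ?N \<le> card (nbr b)" by (intro card_mono) auto
      then have nDL: "card ?N \<le> D * L" using AB(5)[OF b] by linarith
      have "L ^ g * L \<le> D" using LD by (simp add: mult.commute)
      then have "L ^ g \<le> D / L" using L1 by (simp add: le_divide_eq)
      moreover have "L \<le> L ^ g" using mono[of 1 g] g by simp
      ultimately have "real m \<le> card ?N" using n L(2) by linarith
      then have mn: "m \<le> card ?N" by simp
      have sp: "real (\<Sum>v\<in>?N. card (nbr v \<inter> ?N)) \<le> (D / L ^ g)\<^sup>2"
        using nbr_V nDL by (intro sparse) auto
      have "(2 * real m)\<^sup>2 \<le> L\<^sup>2" using L(2) by (intro power_mono) auto
      then have "4 * (real m)\<^sup>2 \<le> L\<^sup>2" by (simp add: power_mult_distrib)
      from mult_mono[OF this sp] have "4 * (real m)\<^sup>2 * real (\<Sum>v\<in>?N. card (nbr v \<inter> ?N)) \<le> L\<^sup>2 * (D / L ^ g)\<^sup>2"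
        by (simp del: of_nat_sum)
      also have "\<dots> = (L * (D / L ^ g))\<^sup>2" by (simp only: power_mult_distrib)
      also have "\<dots> \<le> (D / L)\<^sup>2"
      proof (intro power_mono)
        have "L\<^sup>2 \<le> L ^ g" using g by (rule mono)
        then have "D * L\<^sup>2 \<le> D * L ^ g" using D1 by (intro mult_left_mono) auto
        then show "L * (D / L ^ g) \<le> D / L" using L1 by (simp add: field_simps power2_eq_square)
      qed (use D1 L1 in auto)
      also have "\<dots> \<le> (real (card ?N))\<^sup>2" using n D1 L1 by (intro power_mono) auto
      finally have "real (card ?N choose m) / 2 \<le> card {X. X \<subseteq> ?N \<and> card X = m \<and> indep X}"
        using mn m by (intro card_indep_subsets_ge) auto
      moreover have "0 < card ?N choose m" using mn by simp
      ultimately have "0 < card {X. X \<subseteq> ?N \<and> card X = m \<and> indep X}" by linarith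
      then have "{X. X \<subseteq> ?N \<and> card X = m \<and> indep X} \<noteq> {}" by (metis card.empty less_irrefl)
      then show ?thesis by blast
    qed
    moreover have "8 * D * (4 * m * D) ^ m * card A < card B"
    proof (cases "card A = 0")
      case True
      have "0 < card B" using AB(2,3) finV by (meson card_gt_0_iff finite_subset)
      then show ?thesis using True by simp
    next
      case False
      \<comment> \<open>Both \<open>4 * m * D\<close> and \<open>8 * D\<close> are at most
        \<open>L ^ (M + 1)\<close>, so the loss times \<open>L\<^sup>2\<close> is below
        \<open>L\<close> to the power \<open>(M + 1) * (m + 1) + 2\<close>.\<close>
      let ?X = "8 * D * (4 * m * D) ^ m"
      have "4 * m * D \<le> L * L ^ M" unfolding D using L L1 by (intro mult_right_mono) auto
      then have "(4 * m * D) ^ m \<le> (L ^ (M + 1)) ^ m" using D1 by (intro power_mono) auto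
      then have le: "(4 * m * D) ^ m \<le> L ^ ((M + 1) * m)" by (simp only: power_mult)
      have "8 * D < L * L ^ M" unfolding D using L1 by (intro mult_strict_right_mono) auto
      from mult_less_le_imp_less[OF this le] have "?X < L * L ^ M * L ^ ((M + 1) * m)"
        using D1 m by simp
      then have "?X * L\<^sup>2 < L * L ^ M * L ^ ((M + 1) * m) * L\<^sup>2" using L1 by (intro mult_strict_right_mono) auto
      also have "\<dots> = L ^ ((M + 1) * (m + 1) + 2)" by (simp add: power_add power2_eq_square algebra_simps)
      also have "\<dots> \<le> L ^ R" using R by (rule mono)
      finally have "card A * (?X * L\<^sup>2) < card A * L ^ R" using False by (intro mult_strict_left_mono) auto
      also have "\<dots> \<le> L\<^sup>2 * card B" using AB(6) True by simp
      finally have "L\<^sup>2 * (?X * card A) < L\<^sup>2 * card B" by (simp add: mult_ac)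
      then show ?thesis using L1 by (simp add: mult_less_cancel_left_pos)
    qed
    ultimately show ?thesis
      using unbalanced_pair[OF _ D1 dens AB(1,2)] m by auto
  qed
qed

section \<open>Densest subgraphs and the bound on the degree sum\<close>

definition induced_edge :: "'a set \<Rightarrow> 'a \<Rightarrow> 'a \<Rightarrow> bool" where
  "induced_edge W u v \<longleftrightarrow> u \<in> W \<and> v \<in> W \<and> E u v"

lemma induced_ugraph:
  assumes "W \<subseteq> V"
  shows "ugraph W (induced_edge W)"
    and "\<And>v. v \<in> W \<Longrightarrow> ugraph.nbr (induced_edge W) v = nbr v \<inter> W"
    and "\<And>s. biclique_free s \<Longrightarrow> ugraph.biclique_free (induced_edge W) s"
    and "\<And>k S T. ugraph.rich_pair W (induced_edge W) k S T \<Longrightarrow> rich_pair k S T"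
    and "\<And>k S T. ugraph.rich_pair W (induced_edge W) k S T \<Longrightarrow> ugraph.linear_pair (induced_edge W) S T \<Longrightarrow> linear_pair S T"
proof -
  show W: "ugraph W (induced_edge W)"
    using finV E_sym E_irrefl finite_subset[OF assms] by unfold_locales (auto simp: induced_edge_def)
  interpret W: ugraph W "induced_edge W" by (rule W)
  show nbr: "W.nbr v = nbr v \<inter> W" if "v \<in> W" for v
    using that by (auto simp: W.nbr_def nbr_def induced_edge_def)
  show "W.biclique_free s" if "biclique_free s" for s
    using that unfolding W.biclique_free_def biclique_free_def induced_edge_def by blast
  have ind: "indep S" if "W.indep S" "S \<subseteq> W" for S
    using that unfolding W.indep_def indep_def induced_edge_def by blast
  show "rich_pair k S T" if r: "W.rich_pair k S T" for k S T
  proof -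
    have "W.nbr v \<inter> S = nbr v \<inter> S" if "v \<in> T" for v
      using r that nbr unfolding W.rich_pair_def by blast
    then show ?thesis using r ind assms unfolding W.rich_pair_def rich_pair_def by auto
  qed
  show "linear_pair S T" if r: "W.rich_pair k S T" and l: "W.linear_pair S T" for k S T
    unfolding linear_pair_def
  proof (intro ballI impI)
    fix u v assume uv: "u \<in> T" "v \<in> T" "u \<noteq> v"
    have "W.nbr u \<inter> W.nbr v \<inter> S = nbr u \<inter> nbr v \<inter> S"
      using r uv nbr unfolding W.rich_pair_def by blast
    then show "card (nbr u \<inter> nbr v \<inter> S) \<le> 1" using l uv unfolding W.linear_pair_def by metis
  qed
qed

end

text \<open>If the degree sum is too large, a densest induced subgraph \<open>W\<close> has a
  density \<open>D\<close> that bounds the density of every vertex set. Defining \<open>L\<close> as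
  the \<open>M\<close>-th root of \<open>D\<close> turns the lower bound on \<open>D\<close> into
  \<open>K * (s + m) \<le> L\<close>, and the size conditions of the two cases become conditions on
  \<open>L\<close>.\<close>

lemma average_degree_bound:
  fixes k :: nat
  assumes k: "2 \<le> k"
  obtains K M :: nat where
    "\<And>(V :: 'a set) E s m. ugraph V E \<Longrightarrow> ugraph.biclique_free E s \<Longrightarrow> 1 \<le> s \<Longrightarrow> 2 \<le> m \<Longrightarrow>
      \<nexists>S T. ugraph.rich_pair V E k S T \<and> ugraph.linear_pair E S T \<Longrightarrow>
      \<nexists>S T. ugraph.rich_pair V E m S T \<Longrightarrow>
      real (\<Sum>v\<in>V. card (ugraph.nbr E v)) \<le> (real K * (real s + real m)) ^ M * card V"
proof -
  obtain A where A: "\<And>(V :: 'a set) E s P Q \<delta> N. ugraph V E \<Longrightarrow> ugraph.biclique_free E s \<Longrightarrow> 1 \<le> s \<Longrightarrow>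
      \<nexists>S T. ugraph.rich_pair V E k S T \<and> ugraph.linear_pair E S T \<Longrightarrow>
      P \<subseteq> V \<Longrightarrow> Q \<subseteq> V \<Longrightarrow> real (card P) \<le> N \<Longrightarrow> real (card Q) \<le> N \<Longrightarrow> 0 < \<delta> \<Longrightarrow> \<delta> \<le> 1 \<Longrightarrow>
      (4 * real s / \<delta>) ^ A \<le> N \<Longrightarrow> real (\<Sum>z\<in>Q. card (ugraph.nbr E z \<inter> P)) \<le> \<delta> * N\<^sup>2"
    using dense_pair_bound[of k, where 'a = 'a] by metis
  define g where "g = (4 * k + 2) * k"
  \<comment> \<open>The first summand gives \<open>(4 * s / \<delta>) ^ A \<le> D * L\<close> for
    the \<open>\<delta>\<close> chosen below, and \<open>g + 1\<close> is the exponent that the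
    regular case requires of \<open>D\<close>.\<close>
  define M where "M = A * (2 * g + 3) + g + 1"
  \<comment> \<open>The first summand is the constant of the regular case; the other two yield
    \<open>16 * R \<le> L\<close>.\<close>
  define K where "K = 256 * k ^ (2 * k) + 32 * (M + 1) + 32"
  show thesis
  proof (rule that[of K M])
    fix V :: "'a set" and E and s m :: nat
    assume G: "ugraph V E" and bf: "ugraph.biclique_free E s" and sm: "1 \<le> s" "2 \<le> m"
      and nk: "\<nexists>S T. ugraph.rich_pair V E k S T \<and> ugraph.linear_pair E S T"
      and nm: "\<nexists>S T. ugraph.rich_pair V E m S T"
    interpret ugraph V E by (rule G)
    let ?L0 = "real K * (real s + real m)"
    let ?d = "\<lambda>W. real (\<Sum>v\<in>W. card (nbr v \<inter> W)) / card W"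
    show "real (\<Sum>v\<in>V. card (nbr v)) \<le> ?L0 ^ M * card V"
    proof (rule ccontr)
      assume contr: "\<not> ?thesis"
      then have V: "V \<noteq> {}" by auto
      have VV: "nbr v \<inter> V = nbr v" for v using nbr_V by auto
      let ?Ws = "Pow V - {{}}"
      have finW: "finite ?Ws" using finV by auto
      have "Max (?d ` ?Ws) \<in> ?d ` ?Ws" using finW V by (intro Max_in) auto
      then obtain W where W: "W \<in> ?Ws" "Max (?d ` ?Ws) = ?d W" by auto
      have max: "?d X \<le> ?d W" if "X \<in> ?Ws" for X
        unfolding W(2)[symmetric] using finW that by (intro Max_ge) auto
      define D where "D = ?d W"
      have card0: "0 < real (card X)" if "X \<in> ?Ws" for X
        using that finV by (auto simp: card_gt_0_iff intro: finite_subset)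
      have avgW: "real (\<Sum>v\<in>W. card (nbr v \<inter> W)) = D * card W"
        using card0[OF W(1)] by (simp add: D_def)
      have densW: "real (\<Sum>v\<in>X. card (nbr v \<inter> X)) \<le> D * card X" if "X \<subseteq> V" for X
      proof (cases "X = {}")
        case False
        then have X: "X \<in> ?Ws" using that by auto
        then show ?thesis using max[OF X] card0[OF X] by (simp only: D_def pos_divide_le_eq)
      qed simp
      have LD: "?L0 ^ M < D"
      proof -
        have "?L0 ^ M * card V < real (\<Sum>v\<in>V. card (nbr v))" using contr by (simp only: not_le)
        also have "\<dots> \<le> D * card V" using densW[of V] by (simp only: VV order_refl)
        finally show ?thesis by (rule mult_right_less_imp_less) simp
      qed
      define L where "L = root M D"
      have M0: "0 < M" by (simp add: M_def)
      have L0: "0 \<le> ?L0" by simp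
      have D0: "0 < D" using LD L0 by (smt (verit) zero_le_power)
      have DL: "D = L ^ M" unfolding L_def using M0 D0 by simp
      have "root M (?L0 ^ M) \<le> root M D" using M0 LD by simp
      then have LL: "?L0 \<le> L" using M0 L0 by (simp add: L_def real_root_power_cancel)
      have K3: "real (256 * k ^ (2 * k)) + 32 * (M + 1) + 32 = K" by (simp add: K_def)
      have sm3: "3 \<le> real s + real m" using sm by linarith
      have KL: "real K * 3 \<le> ?L0" using sm3 by (intro mult_left_mono) auto
      have K1: "1 \<le> real K" "64 \<le> real K" "256 * real k ^ (2 * k) < real K * 3"
      proof -
        have "0 \<le> real k ^ (2 * k)" by simp
        then show "1 \<le> real K" "64 \<le> real K" "256 * real k ^ (2 * k) < real K * 3"
          unfolding K3[symmetric] by (simp_all, linarith)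
      qed
      have L1: "64 \<le> L" using LL KL K1 by linarith
      have L256: "256 * real k ^ (2 * k) < L" using LL KL K1 by linarith
      have "4 * (real s + real m) \<le> ?L0" using K1 by (intro mult_right_mono) auto
      then have "4 * real s + 4 * real m \<le> L" using LL by (simp add: distrib_left)
      then have Ls: "4 * real s \<le> L" and Lm: "4 * real m \<le> L" by linarith+
      define R where "R = (M + 1) * (m + 1) + 2"
      have "16 * real R \<le> L"
      proof -
        have "16 * real R = 16 * (real M + 1) * (real m + 1) + 32" by (simp add: R_def algebra_simps)
        also have "\<dots> \<le> 16 * (real M + 1) * (2 * (real s + real m)) + 32 * (real s + real m)"
          using sm3 by (intro add_mono mult_left_mono) auto
        also have "\<dots> = (32 * (real M + 1) + 32) * (real s + real m)" by (simp add: algebra_simps)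
        also have "\<dots> \<le> ?L0" by (intro mult_right_mono) (auto simp: K_def)
        finally show ?thesis using LL by linarith
      qed
      have WV: "W \<subseteq> V" "W \<noteq> {}" using W by auto
      note ind = induced_ugraph[OF WV(1)]
      interpret W: ugraph W "induced_edge W" by (rule ind(1))
      have nbrW: "W.nbr v \<inter> X = nbr v \<inter> X" if "v \<in> W" "X \<subseteq> W" for v X
        using ind(2)[OF that(1)] that by auto
      have sparse: "real (\<Sum>z\<in>Q. card (W.nbr z \<inter> P)) \<le> (D / L ^ g)\<^sup>2"
        if PQ: "P \<subseteq> W" "Q \<subseteq> W" "card P \<le> D * L" "card Q \<le> D * L" for P Q
      proof -
        \<comment> \<open>Chosen to make \<open>\<delta> * (D * L)\<^sup>2\<close> equal to
          \<open>(D / L ^ g)\<^sup>2\<close>.\<close>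
        let ?\<delta> = "1 / L ^ (2 * g + 2)"
        have "1 \<le> L ^ (2 * g + 2)" using L1 by (intro one_le_power) auto
        then have \<delta>: "0 < ?\<delta>" "?\<delta> \<le> 1" by (auto simp: divide_le_eq)
        have "4 * real s / ?\<delta> \<le> L ^ (2 * g + 3)"
          using mult_right_mono[OF Ls, of "L ^ (2 * g + 2)"] L1 by (simp add: power_add power3_eq_cube power2_eq_square mult_ac)
        then have "(4 * real s / ?\<delta>) ^ A \<le> (L ^ (2 * g + 3)) ^ A" using \<delta> by (intro power_mono) auto
        also have "\<dots> = L ^ ((2 * g + 3) * A)" by (simp only: power_mult)
        also have "\<dots> \<le> L ^ (M + 1)" using L1 by (intro power_increasing) (auto simp: M_def)
        also have "\<dots> = D * L" by (simp add: DL)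
        finally have big: "(4 * real s / ?\<delta>) ^ A \<le> D * L" .
        have "real (\<Sum>z\<in>Q. card (nbr z \<inter> P)) \<le> ?\<delta> * (D * L)\<^sup>2"
          using PQ WV by (intro A[OF G bf sm(1) nk _ _ _ _ \<delta> big]) auto
        also have "?\<delta> * (D * L)\<^sup>2 = (D / L ^ g)\<^sup>2"
        proof -
          have "L ^ (2 * g + 2) = (L ^ g)\<^sup>2 * L\<^sup>2" by (simp only: power_add mult.commute[of 2 g] power_mult)
          then show ?thesis using L1 by (simp add: power_divide power_mult_distrib)
        qed
        also have "(\<Sum>z\<in>Q. card (nbr z \<inter> P)) = (\<Sum>z\<in>Q. card (W.nbr z \<inter> P))"
          using PQ nbrW by (intro sum.cong refl) (metis subsetD)
        finally show ?thesis .
      qed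
      have "(\<exists>S T. W.rich_pair k S T \<and> W.linear_pair S T) \<or> (\<exists>S T. W.rich_pair m S T)"
      proof (rule W.rich_pair_exists[OF k sm(2) L256 Lm \<open>16 * real R \<le> L\<close> DL _ _ WV(2)])
        show "(4 * k + 2) * k + 1 \<le> M" by (simp add: M_def g_def)
        show "(M + 1) * (m + 1) + 2 \<le> R" by (simp add: R_def)
        show "real (\<Sum>v\<in>W. card (W.nbr v)) = D * card W" using avgW ind(2) by simp
        show "real (\<Sum>v\<in>X. card (W.nbr v \<inter> X)) \<le> D * card X" if "X \<subseteq> W" for X
        proof -
          have "(\<Sum>v\<in>X. card (W.nbr v \<inter> X)) = (\<Sum>v\<in>X. card (nbr v \<inter> X))"
            using that nbrW by (intro sum.cong refl) (metis subsetD)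
          then show ?thesis using densW[of X] that WV by auto
        qed
      qed (use sparse[unfolded g_def] in auto)
      then show False using nk nm ind(4,5) by blast
    qed
  qed
qed

section \<open>Back to digraphs\<close>

definition adj :: "'a pair_pre_digraph \<Rightarrow> 'a \<Rightarrow> 'a \<Rightarrow> bool" where
  "adj G u v \<longleftrightarrow> (u, v) \<in> parcs G"

lemma ugraph_adj:
  assumes "pair_graph G"
  shows "ugraph (pverts G) (adj G)"
proof -
  interpret pair_graph G by (rule assms)
  show ?thesis
  proof
    show "finite (pverts G)" by (rule pair_finite_verts)
    show "adj G v u" if "adj G u v" for u v
      using that pair_sym_arcs by (auto simp: adj_def symmetric_def sym_def)
    show "\<not> adj G v v" for v using no_loops' by (auto simp: adj_def)
    show "u \<in> pverts G" if "adj G u v" for u v using that in_arcsD1 by (auto simp: adj_def)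
  qed
qed

lemma out_degree_eq_card_nbr:
  assumes "pair_graph G"
  shows "out_degree (with_proj G) v = card (ugraph.nbr (adj G) v)"
proof -
  interpret ugraph "pverts G" "adj G" by (rule ugraph_adj[OF assms])
  have "out_arcs (with_proj G) v = Pair v ` nbr v"
    by (auto simp: out_arcs_def nbr_def adj_def image_iff)
  then show ?thesis by (simp add: out_degree_def card_image inj_on_def)
qed

lemma contains_biclique_iff:
  assumes "pair_graph G" "1 \<le> s"
  shows "contains_biclique (with_proj G) s \<longleftrightarrow> \<not> ugraph.biclique_free (adj G) s"
proof -
  interpret ugraph "pverts G" "adj G" by (rule ugraph_adj[OF assms(1)])
  interpret G: pair_graph G by (rule assms(1))
  show ?thesis
  proof
    assume "contains_biclique (with_proj G) s"
    then obtain H :: "('a, 'a \<times> 'a) pre_digraph" and P Q where H: "subgraph H (with_proj G)"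
      "card P = s" "card Q = s" "arcs_ends H = P \<times> Q \<union> Q \<times> P"
      unfolding contains_biclique_def complete_bipartite_digraph_def by blast
    have "arcs_ends H \<subseteq> parcs G" using arcs_ends_mono[OF H(1)] by auto
    then have "\<forall>x\<in>P. \<forall>y\<in>Q. adj G x y" using H(4) by (auto simp: adj_def)
    then show "\<not> biclique_free s" using H(2,3) unfolding biclique_free_def by blast
  next
    assume "\<not> biclique_free s"
    then obtain P Q where PQ: "card P = s" "card Q = s" "\<forall>x\<in>P. \<forall>y\<in>Q. adj G x y"
      unfolding biclique_free_def by blast
    let ?H = "\<lparr>pverts = P \<union> Q, parcs = P \<times> Q \<union> Q \<times> P\<rparr>"
    have fin: "finite P" "finite Q" using PQ(1,2) assms(2) by (auto intro: card_ge_0_finite)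
    have "P \<inter> Q = {}" using PQ(3) E_irrefl by blast
    then have K: "K\<^bsub>s,s\<^esub> (with_proj ?H)"
      using PQ(1,2) fin unfolding complete_bipartite_digraph_pair_def by auto
    then interpret H: pair_graph ?H by (rule pair_graphI_complete_bipartite)
    have "P \<noteq> {}" "Q \<noteq> {}" using PQ(1,2) assms(2) by auto
    then have "P \<union> Q \<subseteq> pverts G" using PQ(3) E_V E_sym by blast
    moreover have "P \<times> Q \<union> Q \<times> P \<subseteq> parcs G" using PQ(3) E_sym by (auto simp: adj_def)
    ultimately have "subgraph (with_proj ?H) (with_proj G)"
      using G.wf_digraph H.wf_digraph by (auto simp: subgraph_def compatible_def)
    then show "contains_biclique (with_proj G) s" using K unfolding contains_biclique_def by blast
  qed
qed

text \<open>With e edges between \<open>S\<close> and \<open>T\<close>, the average degree is 2e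
  divided by \<open>card S + card T\<close>, where e is at least \<open>k * card T\<close> and
  \<open>card S \<le> card T\<close>. A 4-cycle would have two vertices in \<open>T\<close> with two
  common neighbours in \<open>S\<close>.\<close>

lemma rich_pair_induced:
  assumes "pair_graph G" "ugraph.rich_pair (pverts G) (adj G) k S T"
  obtains H where "induced_subgraph (with_proj H) (with_proj G)" "pair_graph H" "bipartite (with_proj H)"
    "real k \<le> average_degree (with_proj H)"
    "\<And>s. 1 \<le> s \<Longrightarrow> contains_biclique (with_proj H) s \<Longrightarrow> contains_biclique (with_proj G) s"
    "ugraph.linear_pair (adj G) S T \<Longrightarrow> \<not> contains_biclique (with_proj H) 2"
proof -
  interpret ugraph "pverts G" "adj G" by (rule ugraph_adj[OF assms(1)])
  interpret G: pair_graph G by (rule assms(1))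
  note r = assms(2)[unfolded rich_pair_def]
  define H where "H = \<lparr>pverts = S \<union> T, parcs = {(u, v) \<in> parcs G. u \<in> S \<union> T \<and> v \<in> S \<union> T}\<rparr>"
  have finST: "finite S" "finite T" using r by (auto intro: finite_subset[OF _ finV])
  have STV: "S \<union> T \<subseteq> pverts G" using r by auto
  have HG: "parcs H \<subseteq> parcs G" "pverts H \<subseteq> pverts G" using STV by (auto simp: H_def)
  have pgH: "pair_graph H"
  proof
    show "fst e \<in> pverts H" "snd e \<in> pverts H" if "e \<in> parcs H" for e using that by (auto simp: H_def)
    show "finite (pverts H)" "finite (parcs H)"
      using finite_subset[OF HG(2) finV] finite_subset[OF HG(1) G.pair_finite_arcs] by auto
    show "fst e \<noteq> snd e" if "e \<in> parcs H" for e using that HG G.pair_no_loops by auto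
    show "symmetric (with_proj H)"
      using G.pair_sym_arcs by (auto simp: symmetric_def sym_def H_def)
  qed
  interpret H: pair_graph H by (rule pgH)
  have ind: "induced_subgraph (with_proj H) (with_proj G)"
    using HG G.wf_digraph H.wf_digraph
    by (auto simp: induced_subgraph_def subgraph_def compatible_def) (auto simp: H_def)
  have adjH: "adj H = induced_edge (S \<union> T)" by (auto simp: fun_eq_iff adj_def H_def induced_edge_def)
  note iu = induced_ugraph[OF STV, folded adjH]
  have bip: "bipartite (with_proj H)"
    unfolding bipartite_def
  proof (intro exI conjI)
    show "verts (with_proj H) = S \<union> T" by (simp add: H_def)
    show "S \<inter> T = {}" using r by auto
    have "indep S" "indep T" using r by auto
    then show "arcs_ends (with_proj H) \<subseteq> S \<times> T \<union> T \<times> S"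
      by (auto simp: H_def indep_def adj_def)
  qed
  have nbrH: "ugraph.nbr (adj H) v = nbr v \<inter> S" if "v \<in> T" for v
  proof -
    have "nbr v \<inter> T = {}" using that r by (auto simp: indep_def nbr_def)
    then show ?thesis using iu(2)[of v] that by auto
  qed
  have nbrH': "ugraph.nbr (adj H) v = nbr v \<inter> T" if "v \<in> S" for v
  proof -
    have "nbr v \<inter> S = {}" using that r by (auto simp: indep_def nbr_def)
    then show ?thesis using iu(2)[of v] that by auto
  qed
  have "(\<Sum>v\<in>S \<union> T. real (out_degree (with_proj H) v)) = real (\<Sum>v\<in>S. card (nbr v \<inter> T)) + real (\<Sum>v\<in>T. card (nbr v \<inter> S))"
    using finST r nbrH nbrH' by (simp add: sum.union_disjoint out_degree_eq_card_nbr[OF pgH])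
  also have "(\<Sum>v\<in>S. card (nbr v \<inter> T)) = (\<Sum>v\<in>T. card (nbr v \<inter> S))"
    using finST by (rule sum_card_nbr_swap)
  finally have eq: "(\<Sum>v\<in>S \<union> T. real (out_degree (with_proj H) v)) = 2 * real (\<Sum>v\<in>T. card (nbr v \<inter> S))"
    by simp
  have "(\<Sum>v\<in>T. real k) \<le> (\<Sum>v\<in>T. real (card (nbr v \<inter> S)))" using r by (intro sum_mono) auto
  then have sum: "2 * (real k * card T) \<le> (\<Sum>v\<in>S \<union> T. real (out_degree (with_proj H) v))"
    unfolding eq by (simp add: mult.commute)
  have cardST: "card (S \<union> T) = card S + card T" using finST r by (intro card_Un_disjoint) auto
  have "0 < card T" using r finST by (auto simp: card_gt_0_iff)
  moreover have "card S \<le> card T" using r by auto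
  ultimately have "real k * card (S \<union> T) \<le> 2 * (real k * card T)" "0 < card (S \<union> T)"
    using mult_left_mono[of "real (card S)" "real (card T)" "real k"] cardST by (auto simp: distrib_left)
  then have avg: "real k \<le> average_degree (with_proj H)"
    using sum unfolding average_degree_def by (simp add: H_def pos_le_divide_eq)
  have free: "contains_biclique (with_proj G) s" if "1 \<le> s" "contains_biclique (with_proj H) s" for s
    using that iu(3) contains_biclique_iff[OF pgH that(1)] contains_biclique_iff[OF assms(1) that(1)] by blast
  have lin: "\<not> contains_biclique (with_proj H) 2" if "linear_pair S T"
  proof
    assume "contains_biclique (with_proj H) 2"
    then obtain P Q where PQ: "card P = 2" "card Q = 2" "\<forall>x\<in>P. \<forall>y\<in>Q. adj H x y"
      using contains_biclique_iff[OF pgH, of 2] unfolding ugraph.biclique_free_def[OF iu(1)] by auto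
    \<comment> \<open>Kept general in \<open>X\<close> and \<open>Y\<close> because either side of
      the 4-cycle may be the one in \<open>T\<close>.\<close>
    have no: False if XY: "X \<subseteq> T" "Y \<subseteq> S" "card X = 2" "card Y = 2" "\<forall>x\<in>X. \<forall>y\<in>Y. adj G x y" for X Y
    proof -
      obtain u v where uv: "X = {u, v}" "u \<noteq> v" using XY(3) by (meson card_2_iff)
      have "Y \<subseteq> nbr u \<inter> nbr v \<inter> S" using XY uv by (auto simp: nbr_def)
      then have "2 \<le> card (nbr u \<inter> nbr v \<inter> S)" using XY(4) finST by (metis card_mono finite_Int)
      moreover have "card (nbr u \<inter> nbr v \<inter> S) \<le> 1" using \<open>linear_pair S T\<close> uv XY(1) by (auto simp: linear_pair_def)
      ultimately show False by simp
    qed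
    have adjG1: "\<forall>x\<in>P. \<forall>y\<in>Q. adj G x y" using PQ(3) HG(1) by (auto simp: adj_def)
    then have adjG2: "\<forall>y\<in>Q. \<forall>x\<in>P. adj G y x" using E_sym by blast
    have edge: "x \<in> S \<and> y \<in> T \<or> x \<in> T \<and> y \<in> S" if "adj H x y" for x y
      using that r by (auto simp: adj_def H_def indep_def)
    have ne: "P \<noteq> {}" "Q \<noteq> {}" using PQ(1,2) by auto
    show False
    proof (cases "\<exists>x\<in>P. x \<in> T")
      case True
      then have "Q \<subseteq> S" using PQ(3) edge r by blast
      moreover then have "P \<subseteq> T" using PQ(3) edge r ne by blast
      ultimately show False using no[of P Q] PQ(1,2) adjG1 by blast
    next
      case False
      then have "P \<subseteq> S" "Q \<subseteq> T" using PQ(3) edge ne by blast+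
      then show False using no[of Q P] PQ(1,2) adjG2 by blast
    qed
  qed
  show thesis by (rule that[OF ind pgH bip avg free lin])
qed

theorem theorem1p3:
  fixes \<G> :: "'a pair_pre_digraph set"
  assumes "\<forall>G\<in>\<G>. pair_graph G"
    and "hereditary \<G>"
    and "\<exists>p :: real poly. \<forall>s :: nat. s \<ge> 1 \<longrightarrow>
           (\<forall>G\<in>\<G>. bipartite (with_proj G) \<and> \<not> contains_biclique (with_proj G) s \<longrightarrow>
              average_degree (with_proj G) \<le> poly p (real s))"
  shows "\<exists>p' :: real poly. \<forall>s :: nat. s \<ge> 1 \<longrightarrow>
           (\<forall>G\<in>\<G>. \<not> contains_biclique (with_proj G) s \<longrightarrow>
              average_degree (with_proj G) \<le> poly p' (real s))"
proof -
  obtain p :: "real poly" where p: "\<And>s G. 1 \<le> s \<Longrightarrow> G \<in> \<G> \<Longrightarrow> bipartite (with_proj G) \<Longrightarrow>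
      \<not> contains_biclique (with_proj G) s \<Longrightarrow> average_degree (with_proj G) \<le> poly p (real s)"
    using assms(3) by blast
  have her: "H \<in> \<G>" if "G \<in> \<G>" "induced_subgraph (with_proj H) (with_proj G)" for G H
    using assms(2) that unfolding hereditary_def by blast
  \<comment> \<open>The hypothesis is used at 2 for this constant, and at the given \<open>s\<close>
    for \<open>m\<close>.\<close>
  define k where "k = nat \<lceil>poly p 2\<rceil> + 2"
  have k: "2 \<le> k" "poly p 2 < k" unfolding k_def by linarith+
  obtain K M :: nat where bound: "\<And>(V :: 'a set) E s m. ugraph V E \<Longrightarrow> ugraph.biclique_free E s \<Longrightarrow> 1 \<le> s \<Longrightarrow> 2 \<le> m \<Longrightarrow>
      \<nexists>S T. ugraph.rich_pair V E k S T \<and> ugraph.linear_pair E S T \<Longrightarrow>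
      \<nexists>S T. ugraph.rich_pair V E m S T \<Longrightarrow>
      real (\<Sum>v\<in>V. card (ugraph.nbr E v)) \<le> (real K * (real s + real m)) ^ M * card V"
    using average_degree_bound[OF k(1), where 'a = 'a] by metis
  \<comment> \<open>Absolute values of the coefficients: \<open>m\<close> must exceed
    \<open>p\<close> at \<open>s\<close> and stay below a polynomial plus 3, and the latter could
    fail with \<open>p\<close> itself at a negative value.\<close>
  define pabs where "pabs = (\<Sum>i\<le>degree p. monom \<bar>coeff p i\<bar> i)"
  have pabs: "poly p x \<le> poly pabs x" "0 \<le> poly pabs x" if "0 \<le> x" for x
  proof -
    have "poly pabs x = (\<Sum>i\<le>degree p. \<bar>coeff p i\<bar> * x ^ i)"
      by (simp add: pabs_def poly_sum poly_monom)
    then show "poly p x \<le> poly pabs x" "0 \<le> poly pabs x"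
      using that by (auto simp: poly_altdef intro!: sum_mono mult_right_mono sum_nonneg)
  qed
  \<comment> \<open>As \<open>[:3, 1:]\<close> is X + 3, this evaluates to the bound with
    \<open>m\<close> replaced by \<open>poly pabs s + 3\<close>.\<close>
  define p' where "p' = (smult (real K) ([:3, 1:] + pabs)) ^ M"
  show ?thesis
  proof (intro exI[of _ p'] allI impI ballI)
    fix s :: nat and G
    assume s: "1 \<le> s" and G: "G \<in> \<G>" and free: "\<not> contains_biclique (with_proj G) s"
    have pg: "pair_graph G" using assms(1) G by blast
    interpret ugraph "pverts G" "adj G" by (rule ugraph_adj[OF pg])
    define m where "m = nat \<lceil>poly pabs (real s)\<rceil> + 2"
    have "0 \<le> poly pabs (real s)" by (rule pabs) simp
    then have m: "2 \<le> m" "poly pabs (real s) < m" "m \<le> poly pabs (real s) + 3"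
      unfolding m_def by linarith+
    have 1: "\<nexists>S T. rich_pair k S T \<and> linear_pair S T"
    proof clarify
      fix S T assume ST: "rich_pair k S T" "linear_pair S T"
      obtain H where "induced_subgraph (with_proj H) (with_proj G)" "bipartite (with_proj H)"
        "real k \<le> average_degree (with_proj H)" "\<not> contains_biclique (with_proj H) 2"
        using rich_pair_induced[OF pg ST(1)] ST(2) by metis
      then show False using p[of 2 H] her[OF G] k by fastforce
    qed
    have 2: "\<nexists>S T. rich_pair m S T"
    proof clarify
      fix S T assume ST: "rich_pair m S T"
      obtain H where "induced_subgraph (with_proj H) (with_proj G)" "bipartite (with_proj H)"
        "real m \<le> average_degree (with_proj H)" "\<not> contains_biclique (with_proj H) s"
        using rich_pair_induced[OF pg ST] free s by metis
      then have "real m \<le> poly p (real s)" using p[of s H] her[OF G] s by fastforce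
      then show False using pabs(1)[of "real s"] m by simp
    qed
    have "biclique_free s" using free contains_biclique_iff[OF pg s] by blast
    from bound[OF ugraph_adj[OF pg] this s m(1) 1 2]
    have "real (\<Sum>v\<in>pverts G. card (nbr v)) \<le> (real K * (real s + real m)) ^ M * card (pverts G)" .
    then have "(\<Sum>v\<in>pverts G. real (out_degree (with_proj G) v)) \<le> (real K * (real s + real m)) ^ M * card (pverts G)"
      by (simp add: out_degree_eq_card_nbr[OF pg])
    then have "average_degree (with_proj G) \<le> (real K * (real s + real m)) ^ M"
      unfolding average_degree_def by (cases "card (pverts G) = 0") (auto simp: pos_divide_le_eq)
    also have "\<dots> \<le> (real K * (real s + (poly pabs (real s) + 3))) ^ M"
      using m by (intro power_mono mult_left_mono) auto
    also have "\<dots> = poly p' (real s)" by (simp add: p'_def poly_power algebra_simps)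
    finally show "average_degree (with_proj G) \<le> poly p' (real s)" .
  qed
qed

end
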